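(* Let $k,N\ge 1$ be integers, let $c_1,\dots,c_{N+1},b_1,\dots,b_{N+1}$ be positive real numbers and $t>0$. Suppose that the $k$-tuples of partitions $\boldsymbol\lambda^{(1)},\boldsymbol\mu^{(2)},\boldsymbol\lambda^{(2)},\dots,\boldsymbol\mu^{(N)},\boldsymbol\lambda^{(N)}$ are sampled from the LLT process $$\frac1Z\prod_{i=1}^{N}\mathcal L_{\boldsymbol\lambda^{(i)}/\boldsymbol\mu^{(i)}}(c_i;t)\;\widehat{\mathcal L}_{\boldsymbol\lambda^{(i)}/\boldsymbol\mu^{(i+1)}}(b_{N-i+1};t),\qquad \boldsymbol\mu^{(1)}=\boldsymbol\mu^{(N+1)}=\boldsymbol 0,$$ and suppose that $\boldsymbol\mu^{(N+1)}=\boldsymbol\lambda^{(N+1)}=\boldsymbol 0$ deterministically. Then after the LLT parallel update the new partitions $$\tilde{\boldsymbol\lambda}^{(1)},\tilde{\boldsymbol\mu}^{(2)},\tilde{\boldsymbol\lambda}^{(2)},\dots,\tilde{\boldsymbol\mu}^{(N)},\tilde{\boldsymbol\lambda}^{(N)},\tilde{\boldsymbol\mu}^{(N+1)},\tilde{\boldsymbol\lambda}^{(N+1)}$$ are distributed according to the LLT process $$\frac1{Z'}\prod_{i=1}^{N+1}\mathcal L_{\tilde{\boldsymbol\lambda}^{(i)}/\tilde{\boldsymbol\mu}^{(i)}}(c_i;t)\;\widehat{\mathcal L}_{\tilde{\boldsymbol\lambda}^{(i)}/\tilde{\boldsymbol\mu}^{(i+1)}}(b_{N+2-i};t),\qquad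 \tilde{\boldsymbol\mu}^{(1)}=\tilde{\boldsymbol\mu}^{(N+2)}=\boldsymbol 0,$$ where $Z,Z'$ are the normalizing constants.
   Context: Partitions are padded with infinitely many zero parts. Bold letters denote $k$-tuples of partitions $\boldsymbol\lambda=(\boldsymbol\lambda^{(1)},\dots,\boldsymbol\lambda^{(k)})$, with $\boldsymbol\lambda^{(a)}_i$ the $i$-th part of the $a$-th partition (the color-$a$ component); in a sequence $\boldsymbol\lambda^{(1)},\boldsymbol\mu^{(2)},\dots$ of $k$-tuples the superscript is instead the index in the sequence. $\boldsymbol 0$ is the $k$-tuple of empty partitions, and $|\boldsymbol\lambda|$ is the sum of the sizes of the components. Write $\boldsymbol\lambda\succeq\boldsymbol\mu$ (interlacing) if for every color $\boldsymbol\lambda^{(a)}_1\ge\boldsymbol\mu^{(a)}_1\ge\boldsymbol\lambda^{(a)}_2\ge\boldsymbol\mu^{(a)}_2\ge\cdots$, and $\boldsymbol\lambda\succeq'\boldsymbol\mu$ (co-interlacing) if for every color the conjugate partitions interlace, i.e. $\boldsymbol\lambda^{(a)}_i-\boldsymbol\mu^{(a)}_i\in\{0,1\}$ for all $i$. Coinversion LLT polynomials: for $\boldsymbol\mu\subseteq\boldsymbol\lambda$, $$\mathcal L_{\boldsymbol\lambda/\boldsymbol\mu}(x_1,\dots,x_n;t)=\sum_{\boldsymbol\sigma}x^{\boldsymbol\sigma}t^{\mathrm{coinv}(\boldsymbol\sigma)},$$ summed over $k$-tuples $\boldsymbol\sigma=(\sigma^{(1)},\dots,\sigma^{(k)})$,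 $\sigma^{(a)}$ a semistandard filling of $\boldsymbol\lambda^{(a)}/\boldsymbol\mu^{(a)}$ with entries in $\{1,\dots,n\}$ (weakly increasing along rows, strictly increasing with the row index along columns); it is $0$ if $\boldsymbol\mu\not\subseteq\boldsymbol\lambda$. The statistic $\mathrm{coinv}(\boldsymbol\sigma)$ counts coinversion triples: an entry $y$ at a cell of $\boldsymbol\lambda^{(a)}/\boldsymbol\mu^{(a)}$ together with two horizontally adjacent positions in some row $j\geq 1$ of color $b>a$, with values $x$ (left) and $z$ (right), such that the position of $z$ has the same content (row minus column) as the cell of $y$, and $x\le y\le z$. Positions in row $j$ of color $b$ that are not cells of $\boldsymbol\lambda^{(b)}/\boldsymbol\mu^{(b)}$ are given value $0$ if their column is $\le\boldsymbol\mu^{(b)}_j$ (including column $0$ and negative columns) and $\infty$ if their column is $>\boldsymbol\lambda^{(b)}_j$. We write $\mathcal L_{\boldsymbol\lambda}=\mathcal L_{\boldsymbol\lambda/\boldsymbol 0}$; with no variables $\mathcal L_{\boldsymbol\lambda}$ equals $1$ if $\boldsymbol\lambda=\boldsymbol 0$ and $0$ otherwise. In one variable, $\mathcal L_{\boldsymbol\lambda/\boldsymbol\mu}(x;t)$ is a monomial when $\boldsymbol\lambda\succeq\boldsymbol\mu$ and $0$ otherwise. Dual one-variable weight: $\widehat{\mathcal L}_{\boldsymbol\lambda/\boldsymbol\mu}(y;t)=y^{|\boldsymbol\lambda|-|\boldsymbol\mu|}\,t^{e(\boldsymbol\lambda,\boldsymbol\mu)}$ if $\boldsymbol\lambda\succeq'\boldsymbol\mu$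 and $0$ otherwise, where $e(\boldsymbol\lambda,\boldsymbol\mu)$ is the number of quadruples $(a,b,i,j)$ with colors $a<b$ and rows $i,j\ge1$ such that $$\boldsymbol\lambda^{(b)}_j-j=\boldsymbol\mu^{(b)}_j-j+1=\boldsymbol\mu^{(a)}_i-i=\boldsymbol\lambda^{(a)}_i-i .$$ (In the paper this is written $t^{\tilde d(\boldsymbol\lambda,\boldsymbol\mu)}\tilde{\mathcal L}_{\boldsymbol\lambda/\boldsymbol\mu}(y;t)$.) Transition kernels: write $c_{[1,n]}=(c_1,\dots,c_n)$ and define $$p^{\uparrow}_{\boldsymbol\lambda\to\boldsymbol\mu}(c_{[1,n]}|b)=\frac1{\prod_{i=1}^n\prod_{l=0}^{k-1}(1+c_ib\,t^l)}\,\frac{\mathcal L_{\boldsymbol\mu}(c_{[1,n]};t)}{\mathcal L_{\boldsymbol\lambda}(c_{[1,n]};t)}\,\widehat{\mathcal L}_{\boldsymbol\mu/\boldsymbol\lambda}(b;t),$$ $$p^{\downarrow}_{\boldsymbol\lambda\to\boldsymbol\mu}(c_{[1,n-1]}|c_n)=\frac{\mathcal L_{\boldsymbol\mu}(c_{[1,n-1]};t)}{\mathcal L_{\boldsymbol\lambda}(c_{[1,n]};t)}\,\mathcal L_{\boldsymbol\lambda/\boldsymbol\mu}(c_n;t).$$ LLT parallel update: given $\boldsymbol 0\preceq\boldsymbol\lambda^{(1)}\succeq'\boldsymbol\mu^{(2)}\preceq\boldsymbol\lambda^{(2)}\succeq'\cdots\succeq'\boldsymbol\mu^{(N+1)}\preceq\boldsymbol\lambda^{(N+1)}\succeq'\boldsymbol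 0$: (1) for $n=2,\dots,N+1$ set $\tilde{\boldsymbol\mu}^{(n)}=\boldsymbol\lambda^{(n-1)}$, and $\tilde{\boldsymbol\mu}^{(1)}=\boldsymbol 0$; (2) for $n=1,\dots,N+1$, independently, sample $\tilde{\boldsymbol\lambda}^{(n)}$ with probability $\tilde P_n(\tilde{\boldsymbol\lambda}^{(n)}|\boldsymbol\lambda^{(n)},\tilde{\boldsymbol\mu}^{(n)})$, where $$\tilde P_n(\tilde{\boldsymbol\lambda}|\boldsymbol\lambda,\tilde{\boldsymbol\mu})=\frac{p^{\uparrow}_{\boldsymbol\lambda\to\tilde{\boldsymbol\lambda}}(c_{[1,n]}|b_{N-n+2})\,p^{\downarrow}_{\tilde{\boldsymbol\lambda}\to\tilde{\boldsymbol\mu}}(c_{[1,n-1]}|c_n)}{\sum_{\boldsymbol\kappa}p^{\uparrow}_{\boldsymbol\lambda\to\boldsymbol\kappa}(c_{[1,n]}|b_{N-n+2})\,p^{\downarrow}_{\boldsymbol\kappa\to\tilde{\boldsymbol\mu}}(c_{[1,n-1]}|c_n)}.$$ *)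

theory Defs
  imports "HOL-Probability.Probability"
begin

text \<open>
  Partitions are functions giving the \<open>i\<close>-th part for \<open>i \<ge> 1\<close> (the dummy value at \<open>0\<close> is \<open>0\<close>);
  a \<open>k\<close>-tuple of partitions is indexed by the colours \<open>1, \<dots>, k\<close> and is \<open>0\<close> at all other colours,
  so that every \<open>k\<close>-tuple has exactly one representative.
\<close>

type_synonym ktuple = "nat \<Rightarrow> nat \<Rightarrow> nat"

definition is_partition :: "(nat \<Rightarrow> nat) \<Rightarrow> bool" where
  "is_partition p \<longleftrightarrow> p 0 = 0 \<and> (\<forall>i\<ge>1. p (i + 1) \<le> p i) \<and> finite {i. p i \<noteq> 0}"

definition ktuples :: "nat \<Rightarrow> ktuple set" where
  "ktuples k = {\<alpha>. (\<forall>a\<in>{1..k}. is_partition (\<alpha> a)) \<and> (\<forall>a. a \<notin> {1..k} \<longrightarrow> \<alpha> a = (\<lambda>_. 0))}"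

definition empty_tuple :: ktuple where
  "empty_tuple = (\<lambda>_ _. 0)"

definition tuple_size :: "nat \<Rightarrow> ktuple \<Rightarrow> nat" where
  "tuple_size k \<alpha> = (\<Sum>a\<in>{1..k}. \<Sum>i | \<alpha> a i \<noteq> 0. \<alpha> a i)"

definition contained :: "nat \<Rightarrow> ktuple \<Rightarrow> ktuple \<Rightarrow> bool" where
  "contained k \<mu> \<alpha> \<longleftrightarrow> (\<forall>a\<in>{1..k}. \<forall>i\<ge>1. \<mu> a i \<le> \<alpha> a i)"

definition interlaces :: "nat \<Rightarrow> ktuple \<Rightarrow> ktuple \<Rightarrow> bool" where
  "interlaces k \<alpha> \<mu> \<longleftrightarrow> (\<forall>a\<in>{1..k}. \<forall>i\<ge>1. \<alpha> a i \<ge> \<mu> a i \<and> \<mu> a i \<ge> \<alpha> a (i + 1))"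

definition cointerlaces :: "nat \<Rightarrow> ktuple \<Rightarrow> ktuple \<Rightarrow> bool" where
  "cointerlaces k \<alpha> \<mu> \<longleftrightarrow> (\<forall>a\<in>{1..k}. \<forall>i\<ge>1. \<alpha> a i = \<mu> a i \<or> \<alpha> a i = \<mu> a i + 1)"


subsection \<open>Coinversion LLT polynomials\<close>

text \<open>A cell is a triple (colour, row, column).\<close>

type_synonym cell = "nat \<times> nat \<times> nat"

definition cells :: "nat \<Rightarrow> ktuple \<Rightarrow> ktuple \<Rightarrow> cell set" where
  "cells k \<alpha> \<mu> = {(a, i, j). a \<in> {1..k} \<and> i \<ge> 1 \<and> \<mu> a i < j \<and> j \<le> \<alpha> a i}"

definition fillings :: "nat \<Rightarrow> nat \<Rightarrow> ktuple \<Rightarrow> ktuple \<Rightarrow> (cell \<Rightarrow> nat) set" where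
  "fillings k n \<alpha> \<mu> = {\<sigma> \<in> cells k \<alpha> \<mu> \<rightarrow>\<^sub>E {1..n}.
     (\<forall>a i j j'. (a, i, j) \<in> cells k \<alpha> \<mu> \<and> (a, i, j') \<in> cells k \<alpha> \<mu> \<and> j < j'
        \<longrightarrow> \<sigma> (a, i, j) \<le> \<sigma> (a, i, j')) \<and>
     (\<forall>a i i' j. (a, i, j) \<in> cells k \<alpha> \<mu> \<and> (a, i', j) \<in> cells k \<alpha> \<mu> \<and> i < i'
        \<longrightarrow> \<sigma> (a, i, j) < \<sigma> (a, i', j))}"

text \<open>The value of a position of row \<open>r \<ge> 1\<close>; the column is an arbitrary integer.\<close>

definition entry :: "ktuple \<Rightarrow> ktuple \<Rightarrow> (cell \<Rightarrow> nat) \<Rightarrow> nat \<Rightarrow> nat \<Rightarrow> int \<Rightarrow> enat" where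
  "entry \<alpha> \<mu> \<sigma> b r s =
     (if s \<le> int (\<mu> b r) then 0 else if s > int (\<alpha> b r) then \<infinity> else enat (\<sigma> (b, r, nat s)))"

text \<open>
  A coinversion triple is recorded by the cell \<open>(a, i, j)\<close> of its entry \<open>y\<close> and the position
  \<open>(b, r, s)\<close> of \<open>z\<close>; the position of \<open>x\<close> is then \<open>(b, r, s - 1)\<close>.
\<close>

definition coinv_triples ::
    "nat \<Rightarrow> ktuple \<Rightarrow> ktuple \<Rightarrow> (cell \<Rightarrow> nat) \<Rightarrow> (cell \<times> (nat \<times> nat \<times> int)) set" where
  "coinv_triples k \<alpha> \<mu> \<sigma> = {((a, i, j), (b, r, s)).
     (a, i, j) \<in> cells k \<alpha> \<mu> \<and> a < b \<and> b \<le> k \<and> r \<ge> 1 \<and>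
     int r - s = int i - int j \<and>
     entry \<alpha> \<mu> \<sigma> b r (s - 1) \<le> enat (\<sigma> (a, i, j)) \<and> enat (\<sigma> (a, i, j)) \<le> entry \<alpha> \<mu> \<sigma> b r s}"

definition coinv :: "nat \<Rightarrow> ktuple \<Rightarrow> ktuple \<Rightarrow> (cell \<Rightarrow> nat) \<Rightarrow> nat" where
  "coinv k \<alpha> \<mu> \<sigma> = card (coinv_triples k \<alpha> \<mu> \<sigma>)"

text \<open>\<open>LLT k n x t \<alpha> \<mu>\<close> is the value at \<open>x 1, \<dots>, x n\<close> of the polynomial of shape \<open>\<alpha>/\<mu>\<close>.\<close>

definition LLT :: "nat \<Rightarrow> nat \<Rightarrow> (nat \<Rightarrow> real) \<Rightarrow> real \<Rightarrow> ktuple \<Rightarrow> ktuple \<Rightarrow> real" where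
  "LLT k n x t \<alpha> \<mu> =
     (if contained k \<mu> \<alpha>
      then \<Sum>\<sigma>\<in>fillings k n \<alpha> \<mu>. (\<Prod>u\<in>cells k \<alpha> \<mu>. x (\<sigma> u)) * t ^ coinv k \<alpha> \<mu> \<sigma>
      else 0)"

abbreviation LLT1 :: "nat \<Rightarrow> real \<Rightarrow> real \<Rightarrow> ktuple \<Rightarrow> ktuple \<Rightarrow> real" where
  "LLT1 k x t \<alpha> \<mu> \<equiv> LLT k 1 (\<lambda>_. x) t \<alpha> \<mu>"

definition dual_exponent :: "nat \<Rightarrow> ktuple \<Rightarrow> ktuple \<Rightarrow> nat" where
  "dual_exponent k \<alpha> \<mu> = card {(a, b, i, j).
     a \<in> {1..k} \<and> b \<in> {1..k} \<and> a < b \<and> i \<ge> 1 \<and> j \<ge> 1 \<and>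
     int (\<alpha> b j) - int j = int (\<mu> b j) - int j + 1 \<and>
     int (\<mu> b j) - int j + 1 = int (\<mu> a i) - int i \<and>
     int (\<mu> a i) - int i = int (\<alpha> a i) - int i}"

definition dual_LLT1 :: "nat \<Rightarrow> real \<Rightarrow> real \<Rightarrow> ktuple \<Rightarrow> ktuple \<Rightarrow> real" where
  "dual_LLT1 k y t \<alpha> \<mu> =
     (if cointerlaces k \<alpha> \<mu>
      then y ^ (tuple_size k \<alpha> - tuple_size k \<mu>) * t ^ dual_exponent k \<alpha> \<mu> else 0)"


subsection \<open>The LLT process\<close>

text \<open>
  A configuration is a pair of sequences \<open>(\<Lambda>, M)\<close>, holding the \<open>k\<close>-tuples
  \<open>\<Lambda> 1, M 2, \<Lambda> 2, \<dots>, M N, \<Lambda> N\<close> and the empty tuple at all other indices.  In particular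
  \<open>M 1\<close>, \<open>M (N + 1)\<close> and \<open>\<Lambda> (N + 1)\<close> are empty.
\<close>

type_synonym config = "(nat \<Rightarrow> ktuple) \<times> (nat \<Rightarrow> ktuple)"

definition configs :: "nat \<Rightarrow> nat \<Rightarrow> config set" where
  "configs k N = {(\<Lambda>, M).
     (\<forall>n. \<Lambda> n \<in> ktuples k \<and> M n \<in> ktuples k) \<and>
     (\<forall>n. n \<notin> {1..N} \<longrightarrow> \<Lambda> n = empty_tuple) \<and>
     (\<forall>n. n \<notin> {2..N} \<longrightarrow> M n = empty_tuple)}"

definition process_weight ::
    "nat \<Rightarrow> nat \<Rightarrow> (nat \<Rightarrow> real) \<Rightarrow> (nat \<Rightarrow> real) \<Rightarrow> real \<Rightarrow> config \<Rightarrow> real" where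
  "process_weight k N c b t = (\<lambda>(\<Lambda>, M).
     \<Prod>i\<in>{1..N}. LLT1 k (c i) t (\<Lambda> i) (M i) * dual_LLT1 k (b (N + 1 - i)) t (\<Lambda> i) (M (i + 1)))"

definition partition_function ::
    "nat \<Rightarrow> nat \<Rightarrow> (nat \<Rightarrow> real) \<Rightarrow> (nat \<Rightarrow> real) \<Rightarrow> real \<Rightarrow> real" where
  "partition_function k N c b t = (\<Sum>\<^sub>\<infinity>\<omega>\<in>configs k N. process_weight k N c b t \<omega>)"

definition LLT_process ::
    "nat \<Rightarrow> nat \<Rightarrow> (nat \<Rightarrow> real) \<Rightarrow> (nat \<Rightarrow> real) \<Rightarrow> real \<Rightarrow> config pmf" where
  "LLT_process k N c b t = embed_pmf (\<lambda>\<omega>.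
     if \<omega> \<in> configs k N then process_weight k N c b t \<omega> / partition_function k N c b t else 0)"


subsection \<open>Transition kernels and the parallel update\<close>

definition p_up ::
    "nat \<Rightarrow> real \<Rightarrow> nat \<Rightarrow> (nat \<Rightarrow> real) \<Rightarrow> real \<Rightarrow> ktuple \<Rightarrow> ktuple \<Rightarrow> real" where
  "p_up k t n c y \<alpha> \<mu> =
     1 / (\<Prod>i\<in>{1..n}. \<Prod>l<k. 1 + c i * y * t ^ l)
     * (LLT k n c t \<mu> empty_tuple / LLT k n c t \<alpha> empty_tuple) * dual_LLT1 k y t \<mu> \<alpha>"

definition p_down :: "nat \<Rightarrow> real \<Rightarrow> nat \<Rightarrow> (nat \<Rightarrow> real) \<Rightarrow> ktuple \<Rightarrow> ktuple \<Rightarrow> real" where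
  "p_down k t n c \<alpha> \<mu> =
     LLT k (n - 1) c t \<mu> empty_tuple / LLT k n c t \<alpha> empty_tuple * LLT1 k (c n) t \<alpha> \<mu>"

text \<open>
  \<open>update_prob k N c b t n \<alpha> \<mu>' \<alpha>'\<close> is the probability \<open>P\<^sub>n(\<alpha>' | \<alpha>, \<mu>')\<close> that the new tuple at
  position \<open>n\<close> is \<open>\<alpha>'\<close>, where \<open>\<alpha>\<close> is the old tuple there and \<open>\<mu>'\<close> the new tuple preceding it.
\<close>

definition update_prob ::
    "nat \<Rightarrow> nat \<Rightarrow> (nat \<Rightarrow> real) \<Rightarrow> (nat \<Rightarrow> real) \<Rightarrow> real \<Rightarrow> nat \<Rightarrow> ktuple \<Rightarrow> ktuple \<Rightarrow> ktuple \<Rightarrow> real"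
  where
  "update_prob k N c b t n \<alpha> \<mu>' \<alpha>' =
     p_up k t n c (b (N + 2 - n)) \<alpha> \<alpha>' * p_down k t n c \<alpha>' \<mu>'
     / (\<Sum>\<^sub>\<infinity>\<kappa>\<in>ktuples k. p_up k t n c (b (N + 2 - n)) \<alpha> \<kappa> * p_down k t n c \<kappa> \<mu>')"

definition update_pmf ::
    "nat \<Rightarrow> nat \<Rightarrow> (nat \<Rightarrow> real) \<Rightarrow> (nat \<Rightarrow> real) \<Rightarrow> real \<Rightarrow> nat \<Rightarrow> ktuple \<Rightarrow> ktuple \<Rightarrow> ktuple pmf" where
  "update_pmf k N c b t n \<alpha> \<mu>' = embed_pmf (\<lambda>\<alpha>'.
     if \<alpha>' \<in> ktuples k then update_prob k N c b t n \<alpha> \<mu>' \<alpha>' else 0)"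

definition new_mu :: "nat \<Rightarrow> (nat \<Rightarrow> ktuple) \<Rightarrow> nat \<Rightarrow> ktuple" where
  "new_mu N \<Lambda> n = (if n \<in> {2..N + 1} then \<Lambda> (n - 1) else empty_tuple)"

definition parallel_update ::
    "nat \<Rightarrow> nat \<Rightarrow> (nat \<Rightarrow> real) \<Rightarrow> (nat \<Rightarrow> real) \<Rightarrow> real \<Rightarrow> config \<Rightarrow> config pmf" where
  "parallel_update k N c b t = (\<lambda>(\<Lambda>, M).
     map_pmf (\<lambda>\<Lambda>'. (\<Lambda>', new_mu N \<Lambda>))
       (Pi_pmf {1..N + 1} empty_tuple
          (\<lambda>n. update_pmf k N c b t n (\<Lambda> n) (new_mu N \<Lambda> n))))"


subsection \<open>Well-definedness\<close>

text \<open>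
  \<open>embed_pmf\<close> is only meaningful for a probability mass function.  The results below show that
  this is the case for \<open>LLT_process\<close>, and for \<open>update_pmf\<close> at every input that occurs when the
  parallel update is applied to a configuration of positive weight.
\<close>

lemma pmf_embed_normalized:
  fixes w :: "'a \<Rightarrow> real"
  assumes nn: "\<And>x. x \<in> A \<Longrightarrow> w x \<ge> 0"
    and fin: "finite {x \<in> A. w x \<noteq> 0}"
    and pos: "x0 \<in> A" "w x0 > 0"
  shows "pmf (embed_pmf (\<lambda>x. if x \<in> A then w x / (\<Sum>\<^sub>\<infinity>y\<in>A. w y) else 0)) x
         = (if x \<in> A then w x / (\<Sum>\<^sub>\<infinity>y\<in>A. w y) else 0)"
proof -
  define F where "F = {x \<in> A. w x \<noteq> 0}"
  define f where "f = (\<lambda>x. if x \<in> A then w x / (\<Sum>\<^sub>\<infinity>y\<in>A. w y) else 0)"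
  have Z: "(\<Sum>\<^sub>\<infinity>y\<in>A. w y) = sum w F"
  proof -
    have "(\<Sum>\<^sub>\<infinity>y\<in>A. w y) = (\<Sum>\<^sub>\<infinity>y\<in>F. w y)"
      by (rule infsum_cong_neutral) (auto simp: F_def)
    then show ?thesis using fin by (simp add: F_def)
  qed
  have Zpos: "sum w F > 0"
    using fin nn pos by (intro sum_pos2[of F x0]) (auto simp: F_def)
  have nnf: "f x \<ge> 0" for x
    using nn Zpos by (auto simp: f_def Z)
  have "(\<integral>\<^sup>+x. ennreal (f x) \<partial>count_space UNIV) = (\<Sum>x\<in>F. ennreal (f x))"
    using fin by (intro nn_integral_count_space') (auto simp: F_def f_def)
  also have "\<dots> = ennreal (\<Sum>x\<in>F. f x)"
    using nnf by simp
  also have "(\<Sum>x\<in>F. f x) = (\<Sum>x\<in>F. w x / sum w F)"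
    by (rule sum.cong) (auto simp: f_def F_def Z[unfolded F_def])
  also have "\<dots> = 1"
    using Zpos by (simp flip: sum_divide_distrib)
  finally have "pmf (embed_pmf f) x = f x"
    using nnf by (intro pmf_embed_pmf) auto
  then show ?thesis by (simp add: f_def)
qed

lemma ktuple_antimono:
  assumes "\<alpha> \<in> ktuples k" "i \<ge> 1" "i \<le> j"
  shows "\<alpha> a j \<le> \<alpha> a i"
proof (cases "a \<in> {1..k}")
  case True
  then have *: "\<forall>i\<ge>1. \<alpha> a (i + 1) \<le> \<alpha> a i"
    using assms by (auto simp: ktuples_def is_partition_def)
  show ?thesis using assms(3)
  proof (induction j rule: dec_induct)
    case (step m)
    then show ?case using * assms(2) by (metis Suc_eq_plus1 le_trans)
  qed simp
next
  case False
  then show ?thesis using assms(1) by (auto simp: ktuples_def)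
qed

lemma ktuple_outside: "\<alpha> \<in> ktuples k \<Longrightarrow> a \<notin> {1..k} \<or> i = 0 \<Longrightarrow> \<alpha> a i = 0"
  by (cases "a \<in> {1..k}") (auto simp: ktuples_def is_partition_def)

lemma empty_tuple_ktuple [simp]: "empty_tuple \<in> ktuples k"
  by (simp add: empty_tuple_def ktuples_def is_partition_def)

lemma finite_cells:
  assumes "\<alpha> \<in> ktuples k"
  shows "finite (cells k \<alpha> \<mu>)"
proof (rule finite_subset)
  show "cells k \<alpha> \<mu> \<subseteq> (SIGMA a:{1..k}. SIGMA i:{i. \<alpha> a i \<noteq> 0}. {..\<alpha> a i})"
    by (auto simp: cells_def)
  show "finite (SIGMA a:{1..k}. SIGMA i:{i. \<alpha> a i \<noteq> 0}. {..\<alpha> a i})"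
    using assms by (auto simp: ktuples_def is_partition_def)
qed

lemma finite_fillings: "\<alpha> \<in> ktuples k \<Longrightarrow> finite (fillings k n \<alpha> \<mu>)"
  by (rule finite_subset[of _ "cells k \<alpha> \<mu> \<rightarrow>\<^sub>E {1..n}"])
     (auto simp: fillings_def intro!: finite_PiE finite_cells)

lemma filling_range: "\<sigma> \<in> fillings k n \<alpha> \<mu> \<Longrightarrow> u \<in> cells k \<alpha> \<mu> \<Longrightarrow> \<sigma> u \<in> {1..n}"
  unfolding fillings_def by (blast dest: PiE_mem)

lemma LLT_nonneg:
  assumes "\<And>i. i \<in> {1..n} \<Longrightarrow> x i \<ge> 0" "t \<ge> 0"
  shows "LLT k n x t \<alpha> \<mu> \<ge> 0"
  unfolding LLT_def using assms(2)
  by (auto intro!: sum_nonneg mult_nonneg_nonneg prod_nonneg assms(1) dest: filling_range)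

lemma LLT_pos:
  assumes "\<And>i. i \<in> {1..n} \<Longrightarrow> x i > 0" "t > 0" "\<alpha> \<in> ktuples k" "contained k \<mu> \<alpha>"
    and "\<sigma> \<in> fillings k n \<alpha> \<mu>"
  shows "LLT k n x t \<alpha> \<mu> > 0"
proof -
  have "(\<Prod>u\<in>cells k \<alpha> \<mu>. x (\<tau> u)) * t ^ coinv k \<alpha> \<mu> \<tau> > 0" if "\<tau> \<in> fillings k n \<alpha> \<mu>" for \<tau>
    using that assms(2) by (intro mult_pos_pos prod_pos ballI assms(1) filling_range) auto
  then show ?thesis
    unfolding LLT_def using assms finite_fillings[OF assms(3)]
    by (auto intro!: sum_pos)
qed

lemma LLT_empty_pos:
  assumes "\<And>i. i \<in> {1..n} \<Longrightarrow> x i > 0" "t > 0" "\<alpha> \<in> ktuples k"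
    and rows: "\<And>a i. i > n \<Longrightarrow> \<alpha> a i = 0"
  shows "LLT k n x t \<alpha> empty_tuple > 0"
proof (rule LLT_pos)
  have "i \<le> n" if "(a, i, j) \<in> cells k \<alpha> empty_tuple" for a i j
    using that rows[of i a] by (cases "i \<le> n") (auto simp: cells_def)
  then show "restrict (\<lambda>(a, i, j). i) (cells k \<alpha> empty_tuple) \<in> fillings k n \<alpha> empty_tuple"
    by (auto simp: fillings_def) (auto simp: cells_def)
qed (use assms in \<open>auto simp: contained_def empty_tuple_def\<close>)

lemma LLT1_pos:
  assumes "x > 0" "t > 0" "\<alpha> \<in> ktuples k" "interlaces k \<alpha> \<mu>"
  shows "LLT1 k x t \<alpha> \<mu> > 0"
proof (rule LLT_pos)
  have False if "(a, i, j) \<in> cells k \<alpha> \<mu>" "(a, i', j) \<in> cells k \<alpha> \<mu>" "i < i'" for a i i' j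
  proof -
    have "j \<le> \<alpha> a i'" "\<mu> a i < j" "i \<ge> 1" "a \<in> {1..k}" using that by (auto simp: cells_def)
    moreover have "\<alpha> a i' \<le> \<alpha> a (i + 1)" using that by (intro ktuple_antimono[OF assms(3)]) auto
    moreover have "\<alpha> a (i + 1) \<le> \<mu> a i"
      using assms(4) calculation by (auto simp: interlaces_def)
    ultimately show False by linarith
  qed
  then show "restrict (\<lambda>_. 1) (cells k \<alpha> \<mu>) \<in> fillings k 1 \<alpha> \<mu>"
    by (auto simp: fillings_def)
qed (use assms in \<open>auto simp: contained_def interlaces_def\<close>)

lemma LLT1_nonzero_interlaces:
  assumes "LLT1 k x t \<alpha> \<mu> \<noteq> 0" "\<alpha> \<in> ktuples k" "\<mu> \<in> ktuples k"
  shows "interlaces k \<alpha> \<mu>"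
proof -
  have con: "contained k \<mu> \<alpha>" and "fillings k 1 \<alpha> \<mu> \<noteq> {}"
    using assms(1) by (auto simp: LLT_def split: if_splits)
  then obtain \<sigma> where \<sigma>: "\<sigma> \<in> fillings k 1 \<alpha> \<mu>" by auto
  have "\<alpha> a (i + 1) \<le> \<mu> a i" if ai: "a \<in> {1..k}" "i \<ge> 1" for a i
  proof (rule ccontr)
    define j where "j = \<alpha> a (i + 1)"
    assume "\<not> \<alpha> a (i + 1) \<le> \<mu> a i"
    moreover have "\<mu> a (i + 1) \<le> \<mu> a i" "\<alpha> a (i + 1) \<le> \<alpha> a i"
      using ai by (simp_all add: ktuple_antimono[OF assms(2)] ktuple_antimono[OF assms(3)])
    ultimately have cs: "(a, i, j) \<in> cells k \<alpha> \<mu>" "(a, i + 1, j) \<in> cells k \<alpha> \<mu>"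
      using ai by (auto simp: cells_def j_def)
    then have "\<sigma> (a, i, j) < \<sigma> (a, i + 1, j)"
      using \<sigma> unfolding fillings_def by (metis (mono_tags, lifting) less_add_one mem_Collect_eq)
    with filling_range[OF \<sigma> cs(1)] filling_range[OF \<sigma> cs(2)] show False by simp
  qed
  with con show ?thesis by (auto simp: interlaces_def contained_def)
qed

lemma dual_LLT1_nonneg: "y \<ge> 0 \<Longrightarrow> t \<ge> 0 \<Longrightarrow> dual_LLT1 k y t \<alpha> \<mu> \<ge> 0"
  by (simp add: dual_LLT1_def)

lemma dual_LLT1_pos: "y > 0 \<Longrightarrow> t > 0 \<Longrightarrow> cointerlaces k \<alpha> \<mu> \<Longrightarrow> dual_LLT1 k y t \<alpha> \<mu> > 0"
  by (simp add: dual_LLT1_def)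

lemma dual_LLT1_nonzero_cointerlaces: "dual_LLT1 k y t \<alpha> \<mu> \<noteq> 0 \<Longrightarrow> cointerlaces k \<alpha> \<mu>"
  by (auto simp: dual_LLT1_def split: if_splits)

lemma finite_bounded_ktuples: "finite {\<alpha> \<in> ktuples k. (\<forall>a. \<forall>i>m. \<alpha> a i = 0) \<and> (\<forall>a i. \<alpha> a i \<le> n)}"
proof -
  define R where "R = {f :: nat \<Rightarrow> nat. \<forall>i. (i \<in> {..m} \<longrightarrow> f i \<in> {..n}) \<and> (i \<notin> {..m} \<longrightarrow> f i = 0)}"
  have "finite R" unfolding R_def by (rule finite_set_of_finite_funs) auto
  then have "finite {\<alpha>. \<forall>a. (a \<in> {1..k} \<longrightarrow> \<alpha> a \<in> R) \<and> (a \<notin> {1..k} \<longrightarrow> \<alpha> a = (\<lambda>_. 0))}"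
    by (intro finite_set_of_finite_funs) auto
  then show ?thesis
    by (rule rev_finite_subset) (auto simp: R_def ktuples_def)
qed

lemma process_weight_nonneg:
  assumes "\<And>i. i \<in> {1..N} \<Longrightarrow> c i > 0" "\<And>i. i \<in> {1..N} \<Longrightarrow> b i > 0" "t > 0"
  shows "process_weight k N c b t \<omega> \<ge> 0"
proof -
  have "c i \<ge> 0" "b (N + 1 - i) \<ge> 0" if "i \<in> {1..N}" for i
    using that assms(1)[of i] assms(2)[of "N + 1 - i"] by fastforce+
  then show ?thesis
    unfolding process_weight_def case_prod_beta using assms(3)
    by (intro prod_nonneg ballI mult_nonneg_nonneg LLT_nonneg dual_LLT1_nonneg) auto
qed

lemma process_weight_nonzero_interlaces:
  assumes "(\<Lambda>, M) \<in> configs k N" "process_weight k N c b t (\<Lambda>, M) \<noteq> 0" "i \<in> {1..N}"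
  shows "interlaces k (\<Lambda> i) (M i)" "cointerlaces k (\<Lambda> i) (M (i + 1))"
proof -
  have "LLT1 k (c i) t (\<Lambda> i) (M i) * dual_LLT1 k (b (N + 1 - i)) t (\<Lambda> i) (M (i + 1)) \<noteq> 0"
    using assms(2,3) unfolding process_weight_def by simp
  then show "interlaces k (\<Lambda> i) (M i)" "cointerlaces k (\<Lambda> i) (M (i + 1))"
    using assms(1) by (auto intro!: LLT1_nonzero_interlaces dual_LLT1_nonzero_cointerlaces
                            simp: configs_def)
qed

lemma interlaces_rows:
  assumes "interlaces k \<alpha> \<mu>" "\<alpha> \<in> ktuples k" "\<And>i. i > n \<Longrightarrow> \<mu> a i = 0" "i > n + 1"
  shows "\<alpha> a i = 0"
proof (cases "a \<in> {1..k}")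
  case True
  obtain j where j: "i = j + 1" "j > n" using assms(4) by (cases i) auto
  have "j \<ge> 1" using j by simp
  then have "\<alpha> a (j + 1) \<le> \<mu> a j" using assms(1) True unfolding interlaces_def by blast
  with assms(3)[of j] j show ?thesis by simp
qed (use assms ktuple_outside in auto)

lemma cointerlaces_le:
  assumes "cointerlaces k \<alpha> \<mu>" "\<alpha> \<in> ktuples k" "\<mu> \<in> ktuples k"
  shows "\<mu> a i \<le> \<alpha> a i" "\<alpha> a i \<le> \<mu> a i + 1"
proof -
  have "\<mu> a i \<le> \<alpha> a i \<and> \<alpha> a i \<le> \<mu> a i + 1"
  proof (cases "a \<in> {1..k} \<and> i \<ge> 1")
    case True
    then have "\<alpha> a i = \<mu> a i \<or> \<alpha> a i = \<mu> a i + 1"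
      using assms(1) unfolding cointerlaces_def by blast
    then show ?thesis by auto
  next
    case False
    then have "a \<notin> {1..k} \<or> i = 0" by auto
    then show ?thesis by (simp add: ktuple_outside[OF assms(2)] ktuple_outside[OF assms(3)])
  qed
  then show "\<mu> a i \<le> \<alpha> a i" "\<alpha> a i \<le> \<mu> a i + 1" by auto
qed

lemma interlaces_le:
  assumes "interlaces k \<alpha> \<mu>" "\<alpha> \<in> ktuples k" "\<mu> \<in> ktuples k"
  shows "\<mu> a i \<le> \<alpha> a i"
proof (cases "a \<in> {1..k} \<and> i \<ge> 1")
  case True
  then show ?thesis using assms(1) unfolding interlaces_def by blast
next
  case False
  then have "a \<notin> {1..k} \<or> i = 0" by auto
  then show ?thesis by (simp add: ktuple_outside[OF assms(2)] ktuple_outside[OF assms(3)])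
qed

lemma process_rows:
  assumes cfg: "(\<Lambda>, M) \<in> configs k N" and w: "process_weight k N c b t (\<Lambda>, M) \<noteq> 0"
  shows "j > i \<Longrightarrow> \<Lambda> i a j = 0" "j > i - 1 \<Longrightarrow> M i a j = 0"
proof -
  have kt: "\<Lambda> n \<in> ktuples k" "M n \<in> ktuples k" for n using cfg by (auto simp: configs_def)
  have M0: "M n = empty_tuple" if "n \<notin> {2..N}" for n
    using cfg that unfolding configs_def by blast
  have L0: "\<Lambda> n = empty_tuple" if "n \<notin> {1..N}" for n
    using cfg that unfolding configs_def by blast
  have "\<forall>j a. (j > i \<longrightarrow> \<Lambda> i a j = 0) \<and> (j > i - 1 \<longrightarrow> M i a j = 0)" for i
  proof (induction i)
    case 0
    then show ?case using M0[of 0] L0[of 0] by (simp add: empty_tuple_def)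
  next
    case (Suc i)
    have M: "M (Suc i) a j = 0" if "j > i" for a j
    proof (cases "i \<in> {1..N}")
      case True
      have "M (i + 1) a j \<le> \<Lambda> i a j"
        by (rule cointerlaces_le(1)[OF process_weight_nonzero_interlaces(2)[OF cfg w True] kt])
      then show ?thesis using Suc that by simp
    next
      case False
      then show ?thesis using M0[of "Suc i"] by (auto simp: empty_tuple_def)
    qed
    have "\<Lambda> (Suc i) a j = 0" if "j > Suc i" for a j
    proof (cases "Suc i \<in> {1..N}")
      case True
      show ?thesis
        using that M
        by (intro interlaces_rows[where n = i,
              OF process_weight_nonzero_interlaces(1)[OF cfg w True] kt(1)]) auto
    next
      case False
      then show ?thesis using L0[of "Suc i"] by (auto simp: empty_tuple_def)
    qed
    with M show ?case by auto
  qed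
  then show "j > i \<Longrightarrow> \<Lambda> i a j = 0" "j > i - 1 \<Longrightarrow> M i a j = 0" by blast+
qed

lemma process_columns:
  assumes cfg: "(\<Lambda>, M) \<in> configs k N" and w: "process_weight k N c b t (\<Lambda>, M) \<noteq> 0"
  shows "\<Lambda> i a j \<le> N" "M i a j \<le> N"
proof -
  have kt: "\<Lambda> n \<in> ktuples k" "M n \<in> ktuples k" for n using cfg by (auto simp: configs_def)
  have M0: "M n = empty_tuple" if "n \<notin> {2..N}" for n
    using cfg that unfolding configs_def by blast
  have L0: "\<Lambda> n = empty_tuple" if "n \<notin> {1..N}" for n
    using cfg that unfolding configs_def by blast
  have le: "M n a j \<le> \<Lambda> n a j" for n
  proof (cases "n \<in> {1..N}")
    case True
    show ?thesis
      by (rule interlaces_le[OF process_weight_nonzero_interlaces(1)[OF cfg w True] kt])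
  next
    case False
    then show ?thesis using M0[of n] by (auto simp: empty_tuple_def)
  qed
  have L: "\<Lambda> (N - d) a j \<le> d + 1" for d
  proof (induction d)
    case 0
    show ?case
    proof (cases "N \<in> {1..N}")
      case True
      show ?thesis
        using cointerlaces_le(2)[OF process_weight_nonzero_interlaces(2)[OF cfg w True] kt, of a j]
          M0[of "N + 1"] by (simp add: empty_tuple_def)
    qed (use L0[of N] in \<open>auto simp: empty_tuple_def\<close>)
  next
    case (Suc d)
    show ?case
    proof (cases "N - Suc d \<in> {1..N}")
      case True
      then have "N - Suc d + 1 = N - d" by auto
      then show ?thesis
        using cointerlaces_le(2)[OF process_weight_nonzero_interlaces(2)[OF cfg w True] kt, of a j]
          le[of "N - d"] Suc by simp
    qed (use L0[of "N - Suc d"] in \<open>auto simp: empty_tuple_def\<close>)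
  qed
  show *: "\<Lambda> i a j \<le> N" for i
  proof (cases "i \<in> {1..N}")
    case True
    then show ?thesis using L[of "N - i"] by auto
  qed (use L0[of i] in \<open>auto simp: empty_tuple_def\<close>)
  show "M i a j \<le> N" using le[of i] *[of i] by simp
qed

lemma finite_process_support: "finite {\<omega> \<in> configs k N. process_weight k N c b t \<omega> \<noteq> 0}"
proof -
  define B where "B = {\<alpha> \<in> ktuples k. (\<forall>a. \<forall>i>N. \<alpha> a i = 0) \<and> (\<forall>a i. \<alpha> a i \<le> N)}"
  define S where
    "S = {f. \<forall>n. (n \<in> {1..N} \<longrightarrow> f n \<in> B) \<and> (n \<notin> {1..N} \<longrightarrow> f n = empty_tuple)}"
  have "finite S"
    unfolding S_def B_def by (intro finite_set_of_finite_funs finite_bounded_ktuples) auto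
  then have "finite (S \<times> S)" by simp
  moreover have "{\<omega> \<in> configs k N. process_weight k N c b t \<omega> \<noteq> 0} \<subseteq> S \<times> S"
  proof safe
    fix \<Lambda> M
    assume cfg: "(\<Lambda>, M) \<in> configs k N" and w: "process_weight k N c b t (\<Lambda>, M) \<noteq> 0"
    note r = process_rows[OF cfg w] process_columns[OF cfg w]
    have "\<Lambda> n \<in> B" "M n \<in> B" if "n \<in> {1..N}" for n
      using that cfg unfolding B_def by (auto simp: r configs_def)
    then show "\<Lambda> \<in> S" "M \<in> S" using cfg by (auto simp: S_def configs_def)
  qed
  ultimately show ?thesis by (rule rev_finite_subset)
qed

theorem pmf_LLT_process:
  assumes "\<And>i. i \<in> {1..N} \<Longrightarrow> c i > 0" "\<And>i. i \<in> {1..N} \<Longrightarrow> b i > 0" "t > 0"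
  shows "pmf (LLT_process k N c b t) \<omega> =
    (if \<omega> \<in> configs k N then process_weight k N c b t \<omega> / partition_function k N c b t else 0)"
  unfolding LLT_process_def partition_function_def
proof (rule pmf_embed_normalized)
  define \<omega>0 :: config where "\<omega>0 = ((\<lambda>_. empty_tuple), (\<lambda>_. empty_tuple))"
  show "\<omega>0 \<in> configs k N" by (auto simp: configs_def \<omega>0_def)
  show "process_weight k N c b t \<omega>0 > 0"
  proof -
    have "c i > 0" "b (N + 1 - i) > 0" if "i \<in> {1..N}" for i
      using that assms(1)[of i] assms(2)[of "N + 1 - i"] by fastforce+
    moreover have "interlaces k empty_tuple empty_tuple" "cointerlaces k empty_tuple empty_tuple"
      by (auto simp: interlaces_def cointerlaces_def empty_tuple_def)
    ultimately show ?thesis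
      unfolding process_weight_def \<omega>0_def prod.case using assms(3)
      by (intro prod_pos ballI mult_pos_pos LLT1_pos dual_LLT1_pos empty_tuple_ktuple)
  qed
qed (use assms in \<open>auto intro!: process_weight_nonneg finite_process_support\<close>)

lemma pmf_update_pmf_legal:
  assumes c: "\<And>i. i \<in> {1..n} \<Longrightarrow> c i > 0" and "n \<ge> 1" "b (N + 2 - n) > 0" "t > 0"
    and kt: "\<alpha> \<in> ktuples k" "\<mu>' \<in> ktuples k" "\<nu> \<in> ktuples k"
    and il: "interlaces k \<alpha> \<nu>" and ci: "cointerlaces k \<mu>' \<nu>"
    and rows: "\<And>a i. i > n \<Longrightarrow> \<alpha> a i = 0" "\<And>a i. i > n - 1 \<Longrightarrow> \<mu>' a i = 0"
  shows "pmf (update_pmf k N c b t n \<alpha> \<mu>') \<alpha>' =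
    (if \<alpha>' \<in> ktuples k then update_prob k N c b t n \<alpha> \<mu>' \<alpha>' else 0)"
  unfolding update_pmf_def update_prob_def
proof (rule pmf_embed_normalized)
  let ?y = "b (N + 2 - n)"
  let ?w = "\<lambda>\<kappa>. p_up k t n c ?y \<alpha> \<kappa> * p_down k t n c \<kappa> \<mu>'"
  have P: "(\<Prod>i\<in>{1..n}. \<Prod>l<k. 1 + c i * ?y * t ^ l) > 0"
    using c assms(3,4) by (intro prod_pos ballI add_pos_pos mult_pos_pos) auto
  have cn: "c n > 0" using c[of n] assms(2) by simp
  have c': "c i > 0" if "i \<in> {1..n - 1}" for i using c[of i] that by auto
  show "?w \<kappa> \<ge> 0" for \<kappa>
    unfolding p_up_def p_down_def using P c c' cn assms(3,4)
    by (intro mult_nonneg_nonneg divide_nonneg_nonneg LLT_nonneg dual_LLT1_nonneg)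
       (auto intro: less_imp_le)
  define m where "m = (\<lambda>a i. max (\<alpha> a i) (\<mu>' a i))"
  have mk: "m \<in> ktuples k"
  proof -
    have "is_partition (m a)" if "a \<in> {1..k}" for a
    proof -
      have "{i. m a i \<noteq> 0} \<subseteq> {i. \<alpha> a i \<noteq> 0} \<union> {i. \<mu>' a i \<noteq> 0}" by (auto simp: m_def max_def)
      moreover have "finite ({i. \<alpha> a i \<noteq> 0} \<union> {i. \<mu>' a i \<noteq> 0})"
        using kt that by (auto simp: ktuples_def is_partition_def)
      ultimately have "finite {i. m a i \<noteq> 0}" by (rule finite_subset)
      moreover have "m a (i + 1) \<le> m a i" if "i \<ge> 1" for i
        using ktuple_antimono[OF kt(1) that, of "i + 1" a] ktuple_antimono[OF kt(2) that, of "i + 1" a]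
        unfolding m_def by (intro max.mono) auto
      ultimately show ?thesis
        using kt that by (auto simp: is_partition_def m_def ktuples_def)
    qed
    then show ?thesis using kt by (auto simp: ktuples_def m_def)
  qed
  then show "m \<in> ktuples k" .
  have ci': "cointerlaces k m \<alpha>"
    unfolding cointerlaces_def
  proof (intro ballI allI impI)
    fix a i :: nat assume ai: "a \<in> {1..k}" "i \<ge> 1"
    then have "\<nu> a i \<le> \<alpha> a i" using il by (auto simp: interlaces_def)
    with cointerlaces_le[OF ci kt(2,3), of a i]
    show "m a i = \<alpha> a i \<or> m a i = \<alpha> a i + 1" by (auto simp: m_def max_def)
  qed
  have il': "interlaces k m \<mu>'"
    unfolding interlaces_def
  proof (intro ballI allI impI conjI)
    fix a i :: nat assume ai: "a \<in> {1..k}" "i \<ge> 1"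
    then have "\<alpha> a (i + 1) \<le> \<nu> a i" using il by (auto simp: interlaces_def)
    with cointerlaces_le[OF ci kt(2,3), of a i] ktuple_antimono[OF kt(2) ai(2), of "i + 1" a]
    show "m a (i + 1) \<le> \<mu>' a i" by (auto simp: m_def)
  qed (auto simp: m_def)
  have "m a i = 0" if "i > n" for a i using rows[of i a] that by (auto simp: m_def)
  then show "?w m > 0"
    unfolding p_up_def p_down_def using P c c' cn assms(3,4) ci' il' mk kt rows
    by (intro mult_pos_pos divide_pos_pos LLT_empty_pos LLT1_pos dual_LLT1_pos) auto
  define C where "C = (\<Sum>a\<in>{1..k}. \<alpha> a 1)"
  show "finite {\<kappa> \<in> ktuples k. ?w \<kappa> \<noteq> 0}"
  proof (rule finite_subset)
    show "finite {\<kappa> \<in> ktuples k. (\<forall>a. \<forall>i>n. \<kappa> a i = 0) \<and> (\<forall>a i. \<kappa> a i \<le> C + 1)}"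
      by (rule finite_bounded_ktuples)
    show "{\<kappa> \<in> ktuples k. ?w \<kappa> \<noteq> 0}
      \<subseteq> {\<kappa> \<in> ktuples k. (\<forall>a. \<forall>i>n. \<kappa> a i = 0) \<and> (\<forall>a i. \<kappa> a i \<le> C + 1)}"
    proof safe
      fix \<kappa> a i assume k: "\<kappa> \<in> ktuples k" and w: "?w \<kappa> \<noteq> 0"
      have "LLT1 k (c n) t \<kappa> \<mu>' \<noteq> 0" "dual_LLT1 k ?y t \<kappa> \<alpha> \<noteq> 0"
        using w unfolding p_up_def p_down_def mult_eq_0_iff de_Morgan_disj by blast+
      then have "interlaces k \<kappa> \<mu>'" "cointerlaces k \<kappa> \<alpha>"
        using LLT1_nonzero_interlaces[OF _ k kt(2)] dual_LLT1_nonzero_cointerlaces by blast+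
      note * = interlaces_rows[OF this(1) k] cointerlaces_le(2)[OF this(2) k kt(1)]
      show "\<kappa> a i = 0" if "i > n" using *(1)[of "n - 1" a i] rows(2)[of _ a] that assms(2) by simp
      have "\<alpha> a i \<le> C"
      proof (cases "a \<in> {1..k} \<and> i \<ge> 1")
        case True
        then have "\<alpha> a i \<le> \<alpha> a 1" by (intro ktuple_antimono[OF kt(1)]) auto
        also have "\<dots> \<le> C" unfolding C_def using True by (intro member_le_sum) auto
        finally show ?thesis .
      next
        case False
        then have "a \<notin> {1..k} \<or> i = 0" by auto
        then show ?thesis using ktuple_outside[OF kt(1), of a i] by simp
      qed
      then show "\<kappa> a i \<le> C + 1" using *(2)[of a i] by simp
    qed
  qed
qed

theorem pmf_update_pmf:
  assumes c: "\<And>i. i \<in> {1..N + 1} \<Longrightarrow> c i > 0" and b: "\<And>i. i \<in> {1..N + 1} \<Longrightarrow> b i > 0"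
    and "t > 0" and n: "n \<in> {1..N + 1}"
    and "(\<Lambda>, M) \<in> set_pmf (LLT_process k N c b t)"
  shows "pmf (update_pmf k N c b t n (\<Lambda> n) (new_mu N \<Lambda> n)) \<alpha>' =
    (if \<alpha>' \<in> ktuples k then update_prob k N c b t n (\<Lambda> n) (new_mu N \<Lambda> n) \<alpha>' else 0)"
proof -
  have "pmf (LLT_process k N c b t) (\<Lambda>, M) \<noteq> 0"
    using assms(5) by (simp add: set_pmf_iff)
  then have cfg: "(\<Lambda>, M) \<in> configs k N" and w: "process_weight k N c b t (\<Lambda>, M) \<noteq> 0"
    using c b assms(3) by (subst (asm) pmf_LLT_process; auto split: if_splits)+
  note rows = process_rows[OF cfg w]
  have kt: "\<Lambda> n \<in> ktuples k" "M n \<in> ktuples k" for n using cfg by (auto simp: configs_def)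
  have M0: "M n = empty_tuple" if "n \<notin> {2..N}" for n
    using cfg that unfolding configs_def by blast
  have L0: "\<Lambda> n = empty_tuple" if "n \<notin> {1..N}" for n
    using cfg that unfolding configs_def by blast
  show ?thesis
  proof (rule pmf_update_pmf_legal[where \<nu> = "M n"])
    show "interlaces k (\<Lambda> n) (M n)"
    proof (cases "n \<le> N")
      case True
      then show ?thesis using n by (intro process_weight_nonzero_interlaces(1)[OF cfg w]) auto
    qed (use M0[of n] L0[of n] n in \<open>auto simp: interlaces_def empty_tuple_def\<close>)
    show "cointerlaces k (new_mu N \<Lambda> n) (M n)"
    proof (cases "n = 1")
      case False
      then have "n - 1 \<in> {1..N}" "n - 1 + 1 = n" "n \<in> {2..N + 1}" using n by auto
      then show ?thesis
        using process_weight_nonzero_interlaces(2)[OF cfg w, of "n - 1"] by (simp add: new_mu_def)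
    qed (use M0[of 1] in \<open>auto simp: new_mu_def cointerlaces_def empty_tuple_def\<close>)
    show "new_mu N \<Lambda> n \<in> ktuples k" using kt by (simp add: new_mu_def)
    show "new_mu N \<Lambda> n a i = 0" if "i > n - 1" for a i
      using rows(1)[of "n - 1" i a] that by (simp add: new_mu_def empty_tuple_def)
    have "N + 2 - n \<in> {1..N + 1}" using n by auto
    then show "b (N + 2 - n) > 0" by (rule b)
  qed (use n kt rows(1) c assms(3) in auto)
qed

end

theory Submission
  imports Defs
begin

text \<open>
  Dividing the update probabilities by the constants in them reduces the claim to a skew Cauchy
  identity for one-variable weights:
  \<open>\<Sum>\<kappa>. LLT1 x \<kappa> \<beta> * dual_LLT1 y \<kappa> \<alpha> = (\<Prod>l<k. 1 + x * y * t ^ l) * (\<Sum>\<nu>. LLT1 x \<alpha> \<nu> * dual_LLT1 y \<beta> \<nu>)\<close>.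
  Given it, the sum of the old weight over the \<open>M n\<close> with the \<open>\<Lambda> n\<close> fixed factorises over \<open>n\<close> into
  the normalising sums of the update up to constants, and constants are irrelevant in an equality
  of probability distributions.

  For the identity, pass to particle positions \<open>pos \<alpha> a i\<close> and let \<open>U a\<close> be the union of the integer
  intervals from \<open>pos \<beta> a i\<close> to \<open>pos \<alpha> a i\<close>.  In \<open>\<kappa>\<close> exactly the particles at right ends of
  components of \<open>U a\<close> are free to jump, in \<open>\<nu>\<close> exactly those at left ends.  The exponents of \<open>t\<close>
  in \<open>LLT1\<close> and \<open>dual_LLT1\<close> are both quadratic in these choices, but the quadratic parts cancel in
  the sum, so that both sides are products over ends of components.  The two products are compared
  by a telescoping argument.
\<close>

section \<open>One-variable weights in particle positions\<close>

text \<open>Far to the left every position lies in \<open>U a\<close> and far to the right none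
  does, so each colour has exactly one more right end than left ends. The k surplus ends account for
  the k factors of the identity: at t = 1 every factor is 1 + x * y and counting ends would finish
  the proof. For general t the exponents at right and left ends do not match individually, since
  they depend on how the other colours occupy the neighbouring positions; hence a scan along the
  line that trades the factors position by position. A particle for which \<beta> lies one above
  \<alpha> has an empty interval. Its jump is forced in every \<kappa> and every \<nu>, so it
  contributes equally to both sides and has to be kept apart from the free choices. In the update,
  the old \<open>\<Lambda>\<close> remains visible in the new configuration as the shifted
  \<open>M\<close>; only the old \<open>M\<close> is lost. So the law of the new configuration is a
  finite sum over the old \<open>M\<close> alone.\<close>

definition pos :: "ktuple \<Rightarrow> nat \<Rightarrow> nat \<Rightarrow> int" where
  "pos \<alpha> a i = int (\<alpha> a i) - int i"

text \<open>The contents, column minus row, of the cells of colour \<open>a\<close>; in terms of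
  particles, the positions entered while moving from \<mu> to \<alpha>.\<close>

definition enters :: "ktuple \<Rightarrow> ktuple \<Rightarrow> nat \<Rightarrow> int set" where
  "enters \<alpha> \<mu> a = {p. \<exists>i\<ge>1. pos \<mu> a i < p \<and> p \<le> pos \<alpha> a i}"

text \<open>The coinversion condition on the second colour when every entry is 1: the left value may
  be 0, and the right value may be the infinity just past the row, hence the bound
  \<open>pos \<alpha> a i + 1\<close>.\<close>

definition reach :: "ktuple \<Rightarrow> ktuple \<Rightarrow> nat \<Rightarrow> int set" where
  "reach \<alpha> \<mu> a = {p. \<exists>i\<ge>1. pos \<mu> a i < p \<and> p \<le> pos \<alpha> a i + 1}"

text \<open>Indexed by the landing position because this is the common value of the four expressions
  in \<open>dual_exponent\<close>.\<close>

definition jumps :: "ktuple \<Rightarrow> ktuple \<Rightarrow> nat \<Rightarrow> int set" where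
  "jumps \<alpha> \<mu> a = {p. \<exists>i\<ge>1. pos \<alpha> a i = p \<and> pos \<mu> a i = p - 1}"

definition stays :: "ktuple \<Rightarrow> ktuple \<Rightarrow> nat \<Rightarrow> int set" where
  "stays \<alpha> \<mu> a = {p. \<exists>i\<ge>1. pos \<alpha> a i = p \<and> pos \<mu> a i = p}"

definition pairs :: "nat \<Rightarrow> (nat \<times> nat) set" where
  "pairs k = (SIGMA a:{1..k}. {a<..k})"

lemma finite_pairs [simp]: "finite (pairs k)"
  by (simp add: pairs_def)

lemma pos_strict:
  assumes "\<alpha> \<in> ktuples k" "i \<ge> 1" "i < j"
  shows "pos \<alpha> a j < pos \<alpha> a i"
  using ktuple_antimono[OF assms(1,2), of j a] assms(3) by (simp add: pos_def)

lemma pos_inj: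
  assumes "\<alpha> \<in> ktuples k" "i \<ge> 1" "j \<ge> 1" "pos \<alpha> a i = pos \<alpha> a j"
  shows "i = j"
  using pos_strict[OF assms(1), of i j a] pos_strict[OF assms(1), of j i a] assms
  by (metis less_irrefl linorder_neqE_nat)

lemma interlaces_parts:
  assumes "interlaces k \<alpha> \<mu>" "\<alpha> \<in> ktuples k" "a \<in> {1..k}" "i \<ge> 1" "i < j"
  shows "\<alpha> a j \<le> \<mu> a i"
proof -
  have "\<alpha> a j \<le> \<alpha> a (i + 1)" using assms(4,5) by (intro ktuple_antimono[OF assms(2)]) auto
  also have "\<dots> \<le> \<mu> a i" using assms unfolding interlaces_def by blast
  finally show ?thesis .
qed

lemma interlaces_pos:
  assumes "interlaces k \<alpha> \<mu>" "\<alpha> \<in> ktuples k" "a \<in> {1..k}" "i \<ge> 1" "i < j"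
  shows "pos \<alpha> a j < pos \<mu> a i"
  using interlaces_parts[OF assms] assms(5) by (simp add: pos_def)

lemma cointerlaces_pos:
  assumes "cointerlaces k \<alpha> \<mu>" "a \<in> {1..k}" "i \<ge> 1"
  shows "pos \<alpha> a i = pos \<mu> a i \<or> pos \<alpha> a i = pos \<mu> a i + 1"
  using assms unfolding cointerlaces_def pos_def by fastforce

lemma interlaces_pos_le:
  assumes "interlaces k \<alpha> \<mu>" "a \<in> {1..k}" "i \<ge> 1"
  shows "pos \<mu> a i \<le> pos \<alpha> a i"
  using assms unfolding interlaces_def pos_def by fastforce

section \<open>The one-variable coinversion weight\<close>

lemma enters_eq_image:
  assumes "a \<in> {1..k}"
  shows "enters \<alpha> \<mu> a = (\<lambda>(a, i, j). int j - int i) ` {u \<in> cells k \<alpha> \<mu>. fst u = a}" (is "?L = ?R")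
proof
  show "?L \<subseteq> ?R"
  proof
    fix p assume "p \<in> ?L"
    then obtain i where i: "i \<ge> 1" "pos \<mu> a i < p" "p \<le> pos \<alpha> a i" by (auto simp: enters_def)
    then have "p = int (nat (p + int i)) - int i" "(a, i, nat (p + int i)) \<in> cells k \<alpha> \<mu>"
      using assms by (auto simp: cells_def pos_def)
    then show "p \<in> ?R"
      by (intro image_eqI[of _ _ "(a, i, nat (p + int i))"]) auto
  qed
  show "?R \<subseteq> ?L" by (auto simp: enters_def cells_def pos_def)
qed

lemma finite_enters: "\<alpha> \<in> ktuples k \<Longrightarrow> a \<in> {1..k} \<Longrightarrow> finite (enters \<alpha> \<mu> a)"
  by (subst enters_eq_image[where k = k]) (simp_all add: finite_cells)

text \<open>In particle positions, later rows of \<alpha> lie strictly left of earlier rows of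
  \<mu>, so the intervals of different rows stay disjoint even when extended by one to the right.
  Content thus determines the row, which is what the counts of cells and of coinversion triples rest
  on.\<close>

lemma interlaces_row_unique:
  assumes "interlaces k \<alpha> \<mu>" "\<alpha> \<in> ktuples k" "a \<in> {1..k}" "i \<ge> 1" "j \<ge> 1"
    and "pos \<mu> a i < p" "p \<le> pos \<alpha> a i + 1" "pos \<mu> a j < p" "p \<le> pos \<alpha> a j + 1"
  shows "i = j"
  using interlaces_pos[OF assms(1-3,4), of j] interlaces_pos[OF assms(1-3,5), of i] assms(6-)
  by (cases i j rule: linorder_cases) auto

lemma cells_eq_Union:
  "cells k \<alpha> \<mu> = (\<Union>a\<in>{1..k}. {u \<in> cells k \<alpha> \<mu>. fst u = a})"
  by (auto simp: cells_def)

lemma card_cells: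
  assumes \<alpha>: "\<alpha> \<in> ktuples k" and il: "interlaces k \<alpha> \<mu>"
  shows "card (cells k \<alpha> \<mu>) = (\<Sum>a\<in>{1..k}. card (enters \<alpha> \<mu> a))"
proof -
  have "card (cells k \<alpha> \<mu>) = (\<Sum>a\<in>{1..k}. card {u \<in> cells k \<alpha> \<mu>. fst u = a})"
    by (subst cells_eq_Union, rule card_UN_disjoint) (auto simp: finite_cells[OF \<alpha>])
  also have "\<dots> = (\<Sum>a\<in>{1..k}. card (enters \<alpha> \<mu> a))"
  proof (rule sum.cong)
    fix a assume a: "a \<in> {1..k}"
    have "inj_on (\<lambda>(a, i, j). int j - int i) {u \<in> cells k \<alpha> \<mu>. fst u = a}"
    proof (rule inj_onI, clarsimp)
      fix i j i' j'
      assume u: "(a, i, j) \<in> cells k \<alpha> \<mu>" "(a, i', j') \<in> cells k \<alpha> \<mu>"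
        and eq: "int j - int i = int j' - int i'"
      then have "i = i'"
        using interlaces_row_unique[OF il \<alpha> a, of i i' "int j - int i"]
        by (auto simp: cells_def pos_def)
      then show "i = i' \<and> j = j'" using eq by simp
    qed
    then show "card {u \<in> cells k \<alpha> \<mu>. fst u = a} = card (enters \<alpha> \<mu> a)"
      by (simp add: enters_eq_image[OF a] card_image)
  qed simp
  finally show ?thesis .
qed

text \<open>Interlacing leaves at most one cell in each column, so the constant filling is
  admissible.\<close>

lemma fillings_one_variable:
  assumes \<alpha>: "\<alpha> \<in> ktuples k" and il: "interlaces k \<alpha> \<mu>"
  shows "fillings k 1 \<alpha> \<mu> = {restrict (\<lambda>_. 1) (cells k \<alpha> \<mu>)}"
proof -
  have "\<sigma> = restrict (\<lambda>_. 1) (cells k \<alpha> \<mu>)" if "\<sigma> \<in> fillings k 1 \<alpha> \<mu>" for \<sigma>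
  proof
    fix u show "\<sigma> u = restrict (\<lambda>_. 1) (cells k \<alpha> \<mu>) u"
      using filling_range[OF that, of u] that
      by (cases "u \<in> cells k \<alpha> \<mu>") (auto simp: fillings_def PiE_def extensional_def)
  qed
  moreover have False if "(a, i, j) \<in> cells k \<alpha> \<mu>" "(a, i', j) \<in> cells k \<alpha> \<mu>" "i < i'" for a i i' j
    using that interlaces_parts[OF il \<alpha>, of a i i'] by (auto simp: cells_def)
  then have "restrict (\<lambda>_. 1) (cells k \<alpha> \<mu>) \<in> fillings k 1 \<alpha> \<mu>"
    by (auto simp: fillings_def)
  ultimately show ?thesis by blast
qed

text \<open>A triple is determined by its two colours and the common content: the content fixes the
  row in each colour, and with it the column.\<close>

lemma coinv_one_variable:
  assumes \<alpha>: "\<alpha> \<in> ktuples k" and il: "interlaces k \<alpha> \<mu>"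
  shows "coinv k \<alpha> \<mu> (restrict (\<lambda>_. 1) (cells k \<alpha> \<mu>))
       = (\<Sum>(a, b)\<in>pairs k. card (enters \<alpha> \<mu> a \<inter> reach \<alpha> \<mu> b))"
proof -
  define \<sigma> :: "cell \<Rightarrow> nat" where "\<sigma> = restrict (\<lambda>_. 1) (cells k \<alpha> \<mu>)"
  let ?T = "coinv_triples k \<alpha> \<mu> \<sigma>"
  let ?S = "SIGMA ab:pairs k. enters \<alpha> \<mu> (fst ab) \<inter> reach \<alpha> \<mu> (snd ab)"
  let ?f = "\<lambda>((a, i, j), (b, r, s)). ((a :: nat, b :: nat), int j - int i)"
  have \<sigma>1: "\<sigma> u = 1" if "u \<in> cells k \<alpha> \<mu>" for u using that by (simp add: \<sigma>_def)
  have entry: "entry \<alpha> \<mu> \<sigma> b r (s - 1) \<le> 1 \<and> 1 \<le> entry \<alpha> \<mu> \<sigma> b r s \<longleftrightarrow>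
      int (\<mu> b r) < s \<and> s \<le> int (\<alpha> b r) + 1" if "b \<in> {1..k}" "r \<ge> 1" for b r and s :: int
  proof -
    have "\<mu> b r \<le> \<alpha> b r" using il that by (auto simp: interlaces_def)
    moreover have "\<sigma> (b, r, nat s) = 1" if "int (\<mu> b r) < s" "s \<le> int (\<alpha> b r)" for s
      using that \<open>b \<in> {1..k}\<close> \<open>r \<ge> 1\<close> by (auto simp: \<sigma>_def cells_def)
    then have "entry \<alpha> \<mu> \<sigma> b r s = (if s \<le> int (\<mu> b r) then 0 else if s > int (\<alpha> b r) then \<infinity> else 1)" for s
      by (auto simp: entry_def one_enat_def simp del: restrict_apply One_nat_def)
    ultimately show ?thesis by auto
  qed
  have T: "((a, i, j), (b, r, s)) \<in> ?T \<longleftrightarrow> (a, i, j) \<in> cells k \<alpha> \<mu> \<and> (a, b) \<in> pairs k \<and> r \<ge> 1 \<and>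
      s = int j - int i + int r \<and> pos \<mu> b r < int j - int i \<and> int j - int i \<le> pos \<alpha> b r + 1"
    for a i j b r s
  proof (cases "(a, i, j) \<in> cells k \<alpha> \<mu> \<and> b \<in> {1..k} \<and> r \<ge> 1")
    case True
    then show ?thesis
      using entry[of b r s] \<sigma>1 unfolding coinv_triples_def
      by (auto simp: pairs_def pos_def one_enat_def cells_def)
  qed (auto simp: coinv_triples_def pairs_def cells_def)
  have "bij_betw ?f ?T ?S"
    unfolding bij_betw_def
  proof
    show "inj_on ?f ?T"
    proof (rule inj_onI)
      fix u v assume uv: "u \<in> ?T" "v \<in> ?T" and f: "?f u = ?f v"
      obtain a i j b r s where u: "u = ((a, i, j), (b, r, s))" by (metis prod.exhaust)
      obtain i' j' r' s' where v: "v = ((a, i', j'), (b, r', s'))"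
        using f u by (cases v) auto
      have eq: "int j - int i = int j' - int i'" using f u v by simp
      note uv = uv[unfolded u v T]
      have ab: "a \<in> {1..k}" "b \<in> {1..k}" using uv by (auto simp: pairs_def)
      have "i = i'"
        using uv eq by (intro interlaces_row_unique[OF il \<alpha> ab(1), of i i' "int j - int i"])
          (auto simp: cells_def pos_def)
      moreover have "r = r'"
        using uv eq by (intro interlaces_row_unique[OF il \<alpha> ab(2), of r r' "int j' - int i'"]) auto
      ultimately show "u = v" using eq uv by (simp add: u v)
    qed
    show "?f ` ?T = ?S"
    proof safe
      fix a b p assume ab: "(a, b) \<in> pairs k"
        and p: "p \<in> enters \<alpha> \<mu> (fst (a, b))" "p \<in> reach \<alpha> \<mu> (snd (a, b))"
      then have "a \<in> {1..k}" by (auto simp: pairs_def)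
      with p(1) obtain i j where u: "(a, i, j) \<in> cells k \<alpha> \<mu>" "p = int j - int i"
        by (auto simp: enters_eq_image)
      from p(2) obtain r where "r \<ge> 1" "pos \<mu> b r < p" "p \<le> pos \<alpha> b r + 1" by (auto simp: reach_def)
      then show "((a, b), p) \<in> ?f ` ?T"
        using u ab by (intro image_eqI[of _ _ "((a, i, j), (b, r, p + int r))"]) (auto simp: T)
    qed (auto simp: T reach_def enters_def cells_def pos_def)
  qed
  then have "coinv k \<alpha> \<mu> \<sigma> = card ?S" unfolding coinv_def by (rule bij_betw_same_card)
  \<comment> \<open>Finiteness comes from \<open>enters\<close> alone; \<open>reach\<close> contains
    all sufficiently negative positions.\<close>
  also have "\<dots> = (\<Sum>ab\<in>pairs k. card (enters \<alpha> \<mu> (fst ab) \<inter> reach \<alpha> \<mu> (snd ab)))"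
    by (rule card_SigmaI) (auto intro!: finite_Int disjI1 finite_enters[OF \<alpha>] simp: pairs_def)
  finally show ?thesis by (simp add: case_prod_unfold \<sigma>_def)
qed

lemma LLT1_eq:
  assumes \<alpha>: "\<alpha> \<in> ktuples k" and il: "interlaces k \<alpha> \<mu>"
  shows "LLT1 k x t \<alpha> \<mu> = x ^ (\<Sum>a\<in>{1..k}. card (enters \<alpha> \<mu> a))
       * t ^ (\<Sum>(a, b)\<in>pairs k. card (enters \<alpha> \<mu> a \<inter> reach \<alpha> \<mu> b))"
proof -
  have "contained k \<mu> \<alpha>" using il by (auto simp: contained_def interlaces_def)
  then show ?thesis
    by (simp add: LLT_def fillings_one_variable[OF assms] coinv_one_variable[OF assms] card_cells[OF assms] del: One_nat_def)
qed

section \<open>The dual one-variable weight\<close>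

lemma jumps_subset: "jumps \<alpha> \<mu> a \<subseteq> pos \<alpha> a ` {i. \<alpha> a i \<noteq> 0}"
proof
  fix p assume "p \<in> jumps \<alpha> \<mu> a"
  then obtain i where i: "pos \<alpha> a i = p" "pos \<mu> a i = p - 1" by (auto simp: jumps_def)
  then have "\<alpha> a i = \<mu> a i + 1" by (auto simp: pos_def)
  then show "p \<in> pos \<alpha> a ` {i. \<alpha> a i \<noteq> 0}" using i by (intro image_eqI[of _ _ i]) auto
qed

lemma finite_parts: "\<alpha> \<in> ktuples k \<Longrightarrow> finite {i. \<alpha> a i \<noteq> 0}"
  by (cases "a \<in> {1..k}") (auto simp: ktuples_def is_partition_def)

lemma finite_jumps: "\<alpha> \<in> ktuples k \<Longrightarrow> finite (jumps \<alpha> \<mu> a)"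
  using finite_subset[OF jumps_subset] finite_parts by blast

text \<open>Each row grows by 0 or 1, and the growing rows correspond to landing positions because
  positions are injective in the row. The proof goes through an additive equation per colour, after
  which the natural-number subtraction is harmless.\<close>

lemma tuple_size_diff:
  assumes ci: "cointerlaces k \<alpha> \<mu>" and kt: "\<alpha> \<in> ktuples k" "\<mu> \<in> ktuples k"
  shows "tuple_size k \<alpha> - tuple_size k \<mu> = (\<Sum>a\<in>{1..k}. card (jumps \<alpha> \<mu> a))"
proof -
  note le = cointerlaces_le[OF ci kt]
  have "(\<Sum>i | \<alpha> a i \<noteq> 0. \<alpha> a i) = (\<Sum>i | \<mu> a i \<noteq> 0. \<mu> a i) + card (jumps \<alpha> \<mu> a)" for a
  proof -
    let ?I = "{i. \<alpha> a i \<noteq> 0}"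
    have "jumps \<alpha> \<mu> a = pos \<alpha> a ` {i \<in> ?I. \<alpha> a i \<noteq> \<mu> a i}"
    proof (intro set_eqI iffI)
      fix p assume "p \<in> jumps \<alpha> \<mu> a"
      then obtain i where "pos \<alpha> a i = p" "pos \<mu> a i = p - 1" by (auto simp: jumps_def)
      then show "p \<in> pos \<alpha> a ` {i \<in> ?I. \<alpha> a i \<noteq> \<mu> a i}"
        using le(1)[of a i] by (intro image_eqI[of _ _ i]) (auto simp: pos_def)
    next
      fix p assume "p \<in> pos \<alpha> a ` {i \<in> ?I. \<alpha> a i \<noteq> \<mu> a i}"
      then obtain i where i: "p = pos \<alpha> a i" "\<alpha> a i \<noteq> 0" "\<alpha> a i \<noteq> \<mu> a i" by auto
      have "i \<noteq> 0" using ktuple_outside[OF kt(1), of a 0] i(2) by (cases i) auto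
      moreover have "pos \<mu> a i = p - 1" using le[of a i] i by (auto simp: pos_def)
      ultimately show "p \<in> jumps \<alpha> \<mu> a" using i(1) by (auto simp: jumps_def intro!: exI[of _ i])
    qed
    moreover have "inj_on (pos \<alpha> a) {i \<in> ?I. \<alpha> a i \<noteq> \<mu> a i}"
    proof (rule inj_onI)
      fix i j assume h: "i \<in> {i \<in> ?I. \<alpha> a i \<noteq> \<mu> a i}" "j \<in> {i \<in> ?I. \<alpha> a i \<noteq> \<mu> a i}" "pos \<alpha> a i = pos \<alpha> a j"
      have "\<alpha> a 0 = 0" by (rule ktuple_outside[OF kt(1)]) simp
      with h(1,2) have "i \<noteq> 0" "j \<noteq> 0" by (cases i; cases j; simp)+
      then show "i = j" using h(3) by (intro pos_inj[OF kt(1)]) auto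
    qed
    ultimately have "card (jumps \<alpha> \<mu> a) = card {i \<in> ?I. \<alpha> a i \<noteq> \<mu> a i}" by (simp add: card_image)
    also have "\<dots> = (\<Sum>i\<in>?I. if \<alpha> a i \<noteq> \<mu> a i then 1 else 0)"
      using finite_parts[OF kt(1), of a] by (simp add: sum.If_cases Collect_conj_eq)
    also have "\<dots> = (\<Sum>i\<in>?I. \<alpha> a i - \<mu> a i)"
    proof (rule sum.cong)
      fix i show "(if \<alpha> a i \<noteq> \<mu> a i then 1 else 0) = \<alpha> a i - \<mu> a i" using le[of a i] by auto
    qed simp
    finally have "(\<Sum>i\<in>?I. \<mu> a i) + card (jumps \<alpha> \<mu> a) = (\<Sum>i\<in>?I. \<alpha> a i)"
      using le by (simp flip: sum.distrib)
    moreover have "(\<Sum>i\<in>?I. \<mu> a i) = (\<Sum>i | \<mu> a i \<noteq> 0. \<mu> a i)"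
    proof (rule sum.mono_neutral_right[OF finite_parts[OF kt(1)]])
      show "{i. \<mu> a i \<noteq> 0} \<subseteq> ?I" using le(1)[of a] by (metis (mono_tags, lifting) Collect_mono le_zero_eq)
    qed auto
    ultimately show ?thesis by simp
  qed
  then show ?thesis by (simp add: tuple_size_def sum.distrib)
qed

text \<open>The equalities in the exponent say that colour \<open>b\<close> jumps onto a position
  where colour \<open>a\<close> stands still; that position recovers both rows.\<close>

lemma dual_exponent_eq:
  assumes kt: "\<alpha> \<in> ktuples k" "\<mu> \<in> ktuples k"
  shows "dual_exponent k \<alpha> \<mu> = (\<Sum>(a, b)\<in>pairs k. card (jumps \<alpha> \<mu> b \<inter> stays \<alpha> \<mu> a))"
proof -
  let ?Q = "{(a, b, i, j). a \<in> {1..k} \<and> b \<in> {1..k} \<and> a < b \<and> i \<ge> 1 \<and> j \<ge> 1 \<and>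
     pos \<alpha> b j = pos \<mu> b j + 1 \<and> pos \<mu> b j + 1 = pos \<mu> a i \<and> pos \<mu> a i = pos \<alpha> a i}"
  let ?S = "SIGMA ab:pairs k. jumps \<alpha> \<mu> (snd ab) \<inter> stays \<alpha> \<mu> (fst ab)"
  let ?f = "\<lambda>(a, b, i, j). ((a, b), pos \<alpha> a i)"
  have "bij_betw ?f ?Q ?S"
    unfolding bij_betw_def
  proof
    show "inj_on ?f ?Q"
    proof (rule inj_onI, clarsimp)
      fix a b i j i' j'
      assume "Suc 0 \<le> i" "Suc 0 \<le> i'" "Suc 0 \<le> j" "Suc 0 \<le> j'"
        "pos \<mu> b j + 1 = pos \<alpha> a i'" "pos \<mu> b j' + 1 = pos \<alpha> a i'" "pos \<alpha> a i = pos \<alpha> a i'"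
      then show "i = i' \<and> j = j'"
        using pos_inj[OF kt(1), of i i' a] pos_inj[OF kt(2), of j j' b] by simp
    qed
    show "?f ` ?Q = ?S"
    proof safe
      fix a b p assume ab: "(a, b) \<in> pairs k"
        and p: "p \<in> jumps \<alpha> \<mu> (snd (a, b))" "p \<in> stays \<alpha> \<mu> (fst (a, b))"
      then obtain i j where "i \<ge> 1" "j \<ge> 1" "pos \<alpha> b j = p" "pos \<mu> b j = p - 1" "pos \<alpha> a i = p" "pos \<mu> a i = p"
        by (auto simp: jumps_def stays_def)
      then show "((a, b), p) \<in> ?f ` ?Q"
        using ab by (intro image_eqI[of _ _ "(a, b, i, j)"]) (auto simp: pairs_def)
    qed (auto simp: pairs_def jumps_def stays_def)
  qed
  then have "card ?Q = card ?S" by (rule bij_betw_same_card)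
  also have "\<dots> = (\<Sum>ab\<in>pairs k. card (jumps \<alpha> \<mu> (snd ab) \<inter> stays \<alpha> \<mu> (fst ab)))"
    by (rule card_SigmaI) (auto intro!: finite_Int disjI1 finite_jumps[OF kt(1)])
  finally show ?thesis by (simp add: dual_exponent_def pos_def case_prod_unfold)
qed

lemma dual_LLT1_eq:
  assumes "\<alpha> \<in> ktuples k" "\<mu> \<in> ktuples k" "cointerlaces k \<alpha> \<mu>"
  shows "dual_LLT1 k y t \<alpha> \<mu> = y ^ (\<Sum>a\<in>{1..k}. card (jumps \<alpha> \<mu> a))
       * t ^ (\<Sum>(a, b)\<in>pairs k. card (jumps \<alpha> \<mu> b \<inter> stays \<alpha> \<mu> a))"
  using assms by (simp add: dual_LLT1_def tuple_size_diff dual_exponent_eq)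

section \<open>Telescoping over positions\<close>

text \<open>Contribution to the exponent of \<open>t\<close> of a free particle of colour \<open>a\<close> choosing to cross from
  \<open>p - 1\<close> to \<open>p\<close>.\<close>

definition colour_rank :: "nat \<Rightarrow> (nat \<Rightarrow> int set) \<Rightarrow> nat \<Rightarrow> int \<Rightarrow> nat" where
  "colour_rank k U a p = card {b \<in> {a<..k}. p - 1 \<in> U b} + card {b \<in> {1..<a}. p \<in> U b}"

text \<open>For n = k and s = x * y this is the factor of the Cauchy identity; during the scan n is
  the current number of occupied colours.\<close>

definition q_prod :: "real \<Rightarrow> real \<Rightarrow> nat \<Rightarrow> real" where
  "q_prod s t n = (\<Prod>l<n. 1 + s * t ^ l)"

lemma q_prod_pos: "s > 0 \<Longrightarrow> t > 0 \<Longrightarrow> q_prod s t n > 0"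
  unfolding q_prod_def by (intro prod_pos ballI add_pos_pos mult_pos_pos) auto

definition starts :: "nat \<Rightarrow> (nat \<Rightarrow> int set) \<Rightarrow> (nat \<times> int) set" where
  "starts k U = {(a, p). a \<in> {1..k} \<and> p \<in> U a \<and> p - 1 \<notin> U a}"

text \<open>A right end is recorded by the empty position just after it, a left end by its own
  position. In both cases p is then the upper of the two positions between which the free particle
  chooses.\<close>

definition ends :: "nat \<Rightarrow> (nat \<Rightarrow> int set) \<Rightarrow> (nat \<times> int) set" where
  "ends k U = {(a, p). a \<in> {1..k} \<and> p \<notin> U a \<and> p - 1 \<in> U a}"

text \<open>Occupation at \<open>p - 1\<close> is turned into occupation at \<open>p\<close> one colour at a time, in increasing order.
  When colour \<open>a\<close> is changed, \<open>colour_rank k U a p\<close> is the number of other occupied colours.\<close>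

lemma q_prod_step:
  fixes s t :: real and U :: "nat \<Rightarrow> int set" and k :: nat
  defines "h \<equiv> \<lambda>a p. 1 + s * t ^ colour_rank k U a p"
  shows "(\<Prod>a\<in>{1..k}. if p \<notin> U a \<and> p - 1 \<in> U a then h a p else 1) * q_prod s t (card {a \<in> {1..k}. p \<in> U a})
       = (\<Prod>a\<in>{1..k}. if p \<in> U a \<and> p - 1 \<notin> U a then h a p else 1) * q_prod s t (card {a \<in> {1..k}. p - 1 \<in> U a})"
proof -
  define c where "c = (\<lambda>j. card {a \<in> {1..j}. p \<in> U a} + card {a \<in> {j<..k}. p - 1 \<in> U a})"
  have step: "(\<Prod>a\<in>{1..j}. if p \<notin> U a \<and> p - 1 \<in> U a then h a p else 1) * q_prod s t (c j)
      = (\<Prod>a\<in>{1..j}. if p \<in> U a \<and> p - 1 \<notin> U a then h a p else 1) * q_prod s t (c 0)" if "j \<le> k" for j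
    using that
  proof (induction j)
    case 0
    then show ?case by simp
  next
    case (Suc j)
    define r where "r = colour_rank k U (Suc j) p"
    have "{a \<in> {1..Suc j}. p \<in> U a} = (if p \<in> U (Suc j) then {Suc j} else {}) \<union> {a \<in> {1..<Suc j}. p \<in> U a}"
      by (auto simp: le_Suc_eq)
    then have c1: "c (Suc j) = r + (if p \<in> U (Suc j) then 1 else 0)"
      by (simp add: c_def r_def colour_rank_def)
    have "{a \<in> {j<..k}. p - 1 \<in> U a} = (if p - 1 \<in> U (Suc j) then {Suc j} else {}) \<union> {a \<in> {Suc j<..k}. p - 1 \<in> U a}"
    proof -
      have "{j<..k} = insert (Suc j) {Suc j<..k}" using Suc.prems by auto
      then show ?thesis by auto
    qed
    then have c0: "c j = r + (if p - 1 \<in> U (Suc j) then 1 else 0)"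
      by (simp add: c_def r_def colour_rank_def atLeastLessThanSuc_atLeastAtMost)
    have G: "q_prod s t (Suc r) = q_prod s t r * h (Suc j) p"
      by (simp add: q_prod_def h_def r_def)
    show ?case
      using Suc.IH Suc.prems by (auto simp: c0 c1 G algebra_simps)
  qed
  moreover have "c k = card {a \<in> {1..k}. p \<in> U a}"
  proof -
    have "{a \<in> {k<..k}. p - 1 \<in> U a} = {}" by auto
    then show ?thesis by (simp only: c_def card.empty add_0 add_0_right)
  qed
  moreover have "c 0 = card {a \<in> {1..k}. p - 1 \<in> U a}"
  proof -
    have "{a \<in> {1..0}. p \<in> U a} = {}" "{0<..k} = {1..k}" by auto
    then show ?thesis by (simp only: c_def card.empty add_0 add_0_right)
  qed
  ultimately show ?thesis using step[of k] by simp
qed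

text \<open>Regroups a product over boundary points by position inside a finite window, the form in
  which the scan runs.\<close>

lemma prod_boundary:
  fixes h :: "nat \<Rightarrow> int \<Rightarrow> real"
  assumes "\<And>a p. a \<in> {1..k} \<Longrightarrow> P a p \<Longrightarrow> p0 \<le> p \<and> p < p0 + int m"
  shows "(\<Prod>(a, p)\<in>{(a, p). a \<in> {1..k} \<and> P a p}. h a p)
       = (\<Prod>j<m. \<Prod>a\<in>{1..k}. if P a (p0 + int j) then h a (p0 + int j) else 1)"
proof -
  have bij: "bij_betw (\<lambda>j. p0 + int j) {..<m} {p0..<p0 + int m}"
  proof (rule bij_betw_byWitness[of _ "\<lambda>p. nat (p - p0)"])
  qed auto
  have "(\<Prod>j<m. \<Prod>a\<in>{1..k}. if P a (p0 + int j) then h a (p0 + int j) else 1)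
      = (\<Prod>p\<in>{p0..<p0 + int m}. \<Prod>a\<in>{1..k}. if P a p then h a p else 1)"
    by (rule prod.reindex_bij_betw[OF bij, of "\<lambda>p. \<Prod>a\<in>{1..k}. if P a p then h a p else 1"])
  also have "\<dots> = (\<Prod>a\<in>{1..k}. \<Prod>p\<in>{p0..<p0 + int m}. if P a p then h a p else 1)"
    by (rule prod.swap)
  also have "\<dots> = (\<Prod>(a, p)\<in>{1..k} \<times> {p0..<p0 + int m}. if P a p then h a p else 1)"
    by (rule prod.cartesian_product)
  also have "\<dots> = (\<Prod>(a, p)\<in>{(a, p). a \<in> {1..k} \<and> P a p}. h a p)"
    by (rule prod.mono_neutral_cong_right) (use assms in \<open>force split: if_splits\<close>)+
  finally show ?thesis by simp
qed

text \<open>The identities at single positions telescope: left of the window all k colours are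
  occupied, which leaves \<open>q_prod s t k\<close>; at its right end none is, which leaves the
  empty product 1.\<close>

lemma q_prod_boundary:
  fixes s t :: real and B :: int and U :: "nat \<Rightarrow> int set" and k :: nat
  defines "h \<equiv> \<lambda>a p. 1 + s * t ^ colour_rank k U a p"
  assumes low: "\<And>a p. a \<in> {1..k} \<Longrightarrow> p < - B \<Longrightarrow> p \<in> U a"
    and high: "\<And>a p. a \<in> {1..k} \<Longrightarrow> p \<ge> B \<Longrightarrow> p \<notin> U a"
  shows "(\<Prod>(a, p)\<in>ends k U. h a p) = q_prod s t k * (\<Prod>(a, p)\<in>starts k U. h a p)"
proof (cases "k = 0")
  case True
  then show ?thesis by (simp add: ends_def starts_def q_prod_def)
next
  case False
  define n where "n = (\<lambda>p. card {a \<in> {1..k}. p \<in> U a})"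
  \<comment> \<open>The window is -B, ..., B. It includes B because a component may reach up to B -
    1, and its end is recorded one position later.\<close>
  define m where "m = nat (2 * B + 1)"
  \<comment> \<open>With at least one colour, - B - 1 cannot be both occupied and empty, so
    \<open>nat\<close> does not truncate in \<open>m\<close>.\<close>
  have "B > - B - 1"
  proof (rule ccontr)
    assume "\<not> B > - B - 1"
    then show False using low[of 1 "-B - 1"] high[of 1 "- B - 1"] False by simp
  qed
  then have m: "int m = 2 * B + 1" by (simp add: m_def)
  have tele: "(\<Prod>j<i. \<Prod>a\<in>{1..k}. if - B + int j \<notin> U a \<and> - B + int j - 1 \<in> U a then h a (- B + int j) else 1)
        * q_prod s t (n (- B + int i - 1))
      = (\<Prod>j<i. \<Prod>a\<in>{1..k}. if - B + int j \<in> U a \<and> - B + int j - 1 \<notin> U a then h a (- B + int j) else 1)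
        * q_prod s t (n (- B - 1))" (is "?E i * _ = ?S i * _") for i
  proof (induction i)
    case (Suc i)
    let ?p = "- B + int i"
    let ?e = "\<Prod>a\<in>{1..k}. if ?p \<notin> U a \<and> ?p - 1 \<in> U a then h a ?p else 1"
    let ?s = "\<Prod>a\<in>{1..k}. if ?p \<in> U a \<and> ?p - 1 \<notin> U a then h a ?p else 1"
    have p: "- B + int (Suc i) - 1 = ?p" by simp
    have "?E (Suc i) * q_prod s t (n ?p) = ?E i * (?e * q_prod s t (n ?p))"
      by simp
    also have "?e * q_prod s t (n ?p) = ?s * q_prod s t (n (?p - 1))"
      unfolding n_def h_def by (rule q_prod_step)
    also have "?E i * (?s * q_prod s t (n (?p - 1))) = ?s * (?E i * q_prod s t (n (?p - 1)))"
      by (simp only: mult_ac)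
    also have "\<dots> = ?s * (?S i * q_prod s t (n (- B - 1)))" by (simp only: Suc.IH)
    also have "\<dots> = ?S (Suc i) * q_prod s t (n (- B - 1))" by (simp add: mult_ac)
    finally show ?case by (simp only: p)
  qed simp
  have "{a \<in> {1..k}. - B - 1 \<in> U a} = {1..k}" using low by auto
  then have n0: "n (- B - 1) = k" by (simp add: n_def)
  have "{a \<in> {1..k}. - B + int m - 1 \<in> U a} = {}" using high by (auto simp: m)
  then have n1: "n (- B + int m - 1) = 0" by (simp only: n_def card.empty)
  have range: "- B \<le> p \<and> p < - B + int m"
    if "a \<in> {1..k}" "p \<notin> U a \<and> p - 1 \<in> U a \<or> p \<in> U a \<and> p - 1 \<notin> U a" for a p
    using low[OF that(1), of p] low[OF that(1), of "p - 1"] high[OF that(1), of p]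
      high[OF that(1), of "p - 1"] that(2) m by (smt (verit))
  have "(\<Prod>(a, p)\<in>ends k U. h a p) = ?E m"
    unfolding ends_def by (rule prod_boundary) (use range in blast)
  moreover have "(\<Prod>(a, p)\<in>starts k U. h a p) = ?S m"
    unfolding starts_def by (rule prod_boundary) (use range in blast)
  ultimately show ?thesis using tele[of m] unfolding n0 n1 by (simp add: q_prod_def)
qed

lemma finite_boundary:
  fixes B :: int
  assumes low: "\<And>a p. a \<in> {1..k} \<Longrightarrow> p < - B \<Longrightarrow> p \<in> U a"
    and high: "\<And>a p. a \<in> {1..k} \<Longrightarrow> p \<ge> B \<Longrightarrow> p \<notin> U a"
  shows "finite (starts k U)" "finite (ends k U)"
proof -
  have "- B \<le> p \<and> p \<le> B"
    if "a \<in> {1..k}" "p \<notin> U a \<and> p - 1 \<in> U a \<or> p \<in> U a \<and> p - 1 \<notin> U a" for a p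
    using low[OF that(1), of p] low[OF that(1), of "p - 1"] high[OF that(1), of p]
      high[OF that(1), of "p - 1"] that(2) by (smt (verit))
  then have "starts k U \<union> ends k U \<subseteq> {1..k} \<times> {- B..B}" by (auto simp: starts_def ends_def)
  then show "finite (starts k U)" "finite (ends k U)" by (auto dest: finite_subset)
qed

section \<open>Separating the free choices from the common factor\<close>

lemma card_filter_eq_sum: "finite A \<Longrightarrow> card {x \<in> A. P x} = (\<Sum>x\<in>A. of_bool (P x))"
  by (simp add: of_bool_def sum.If_cases Collect_conj_eq Int_commute)

lemma sum_pairs:
  "(\<Sum>(a, b)\<in>pairs k. f a b) = (\<Sum>a\<in>{1..k}. \<Sum>b\<in>{a<..k}. f a b)"
  "(\<Sum>(a, b)\<in>pairs k. f a b) = (\<Sum>b\<in>{1..k}. \<Sum>a\<in>{1..<b}. f a b)"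
  for f :: "nat \<Rightarrow> nat \<Rightarrow> 'a :: comm_monoid_add"
proof -
  show *: "(\<Sum>(a, b)\<in>pairs k. f a b) = (\<Sum>a\<in>{1..k}. \<Sum>b\<in>{a<..k}. f a b)"
    by (simp add: pairs_def sum.Sigma)
  show "(\<Sum>(a, b)\<in>pairs k. f a b) = (\<Sum>b\<in>{1..k}. \<Sum>a\<in>{1..<b}. f a b)"
    unfolding * sum.Sigma[OF finite_atLeastAtMost ballI, OF finite_greaterThanAtMost]
      sum.Sigma[OF finite_atLeastAtMost ballI, OF finite_atLeastLessThan]
    by (rule sum.reindex_bij_witness[of _ "\<lambda>(b, a). (a, b)" "\<lambda>(a, b). (b, a)"]) auto
qed

lemma prod_one_add:
  fixes f :: "'a \<Rightarrow> real"
  assumes "finite A"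
  shows "(\<Sum>B\<in>Pow A. \<Prod>x\<in>B. f x) = (\<Prod>x\<in>A. 1 + f x)"
  using prod_add[OF assms, of f "\<lambda>_. 1"] by (simp add: add.commute)

text \<open>\<open>X\<close> and \<open>F\<close> hold what is common to all choices,
  \<open>T\<close> the free choices. Each choice adds the same point to \<open>E\<close> and to
  \<open>J\<close>, giving one factor x and one factor y. The exponent of t is additive in
  \<open>E\<close> and \<open>J\<close>; a chosen point of colour a meets the larger colours through
  \<open>E\<close> and the smaller ones through \<open>J\<close>, and together these counts are
  \<open>colour_rank\<close>.\<close>

lemma weight_factor:
  fixes x y t :: real and E X J F U :: "nat \<Rightarrow> int set" and T :: "(nat \<times> int) set"
  assumes T: "finite T" "fst ` T \<subseteq> {1..k}"
    and E: "\<And>a. a \<in> {1..k} \<Longrightarrow> E a = X a \<union> T `` {a}" "\<And>a. a \<in> {1..k} \<Longrightarrow> X a \<inter> T `` {a} = {}"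
    and J: "\<And>a. a \<in> {1..k} \<Longrightarrow> J a = F a \<union> T `` {a}" "\<And>a. a \<in> {1..k} \<Longrightarrow> F a \<inter> T `` {a} = {}"
    and fin: "\<And>a. a \<in> {1..k} \<Longrightarrow> finite (X a)" "\<And>a. a \<in> {1..k} \<Longrightarrow> finite (F a)"
  shows "x ^ (\<Sum>a\<in>{1..k}. card (E a)) * y ^ (\<Sum>a\<in>{1..k}. card (J a))
       * t ^ (\<Sum>(a, b)\<in>pairs k. card {p \<in> E a. p - 1 \<in> U b} + card {p \<in> J b. p \<in> U a})
     = x ^ (\<Sum>a\<in>{1..k}. card (X a)) * y ^ (\<Sum>a\<in>{1..k}. card (F a))
       * t ^ (\<Sum>(a, b)\<in>pairs k. card {p \<in> X a. p - 1 \<in> U b} + card {p \<in> F b. p \<in> U a})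
       * (\<Prod>(a, p)\<in>T. x * y * t ^ colour_rank k U a p)"
proof -
  have finT: "finite (T `` {a})" for a using T(1) by (rule finite_Image)
  have slices: "(\<Sum>(a, p)\<in>T. f a p) = (\<Sum>a\<in>{1..k}. \<Sum>p\<in>T `` {a}. f a p)"
    for f :: "nat \<Rightarrow> int \<Rightarrow> nat"
  proof -
    have "(SIGMA a:{1..k}. T `` {a}) = T" using T(2) by auto
    then show ?thesis using finT by (simp add: sum.Sigma)
  qed
  have cT: "card T = (\<Sum>a\<in>{1..k}. card (T `` {a}))" using slices[of "\<lambda>_ _. 1"] by simp
  have split: "card {p \<in> A \<union> B. P p} = card {p \<in> A. P p} + card {p \<in> B. P p}"
    if "finite A" "finite B" "A \<inter> B = {}" for A B :: "int set" and P
    using that by (subst card_Un_disjoint[symmetric]) (auto intro: arg_cong[where f = card])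
  have e1: "(\<Sum>a\<in>{1..k}. card (E a)) = (\<Sum>a\<in>{1..k}. card (X a)) + card T"
    unfolding cT sum.distrib[symmetric]
    using E fin(1) finT by (intro sum.cong refl) (simp add: card_Un_disjoint)
  have e2: "(\<Sum>a\<in>{1..k}. card (J a)) = (\<Sum>a\<in>{1..k}. card (F a)) + card T"
    unfolding cT sum.distrib[symmetric]
    using J fin(2) finT by (intro sum.cong refl) (simp add: card_Un_disjoint)
  have "(\<Sum>(a, p)\<in>T. card {b \<in> {a<..k}. p - 1 \<in> U b})
      = (\<Sum>a\<in>{1..k}. \<Sum>p\<in>T `` {a}. \<Sum>b\<in>{a<..k}. of_bool (p - 1 \<in> U b))"
    unfolding slices by (intro sum.cong refl card_filter_eq_sum) simp_all
  also have "\<dots> = (\<Sum>(a, b)\<in>pairs k. card {p \<in> T `` {a}. p - 1 \<in> U b})"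
    unfolding sum_pairs(1) by (intro sum.cong refl, subst sum.swap) (intro sum.cong refl card_filter_eq_sum[symmetric] finT)
  finally have r1: "(\<Sum>(a, p)\<in>T. card {b \<in> {a<..k}. p - 1 \<in> U b})
      = (\<Sum>(a, b)\<in>pairs k. card {p \<in> T `` {a}. p - 1 \<in> U b})" .
  have "(\<Sum>(a, p)\<in>T. card {b \<in> {1..<a}. p \<in> U b})
      = (\<Sum>a\<in>{1..k}. \<Sum>p\<in>T `` {a}. \<Sum>b\<in>{1..<a}. of_bool (p \<in> U b))"
    unfolding slices by (intro sum.cong refl card_filter_eq_sum) simp_all
  also have "\<dots> = (\<Sum>(a, b)\<in>pairs k. card {p \<in> T `` {b}. p \<in> U a})"
    unfolding sum_pairs(2) by (intro sum.cong refl, subst sum.swap) (intro sum.cong refl card_filter_eq_sum[symmetric] finT)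
  finally have r2: "(\<Sum>(a, p)\<in>T. card {b \<in> {1..<a}. p \<in> U b})
      = (\<Sum>(a, b)\<in>pairs k. card {p \<in> T `` {b}. p \<in> U a})" .
  have "(\<Sum>(a, b)\<in>pairs k. card {p \<in> E a. p - 1 \<in> U b} + card {p \<in> J b. p \<in> U a})
      = (\<Sum>(a, b)\<in>pairs k. (card {p \<in> X a. p - 1 \<in> U b} + card {p \<in> F b. p \<in> U a})
          + (card {p \<in> T `` {a}. p - 1 \<in> U b} + card {p \<in> T `` {b}. p \<in> U a}))"
  proof (rule sum.cong, safe)
    fix a b assume "(a, b) \<in> pairs k"
    then have ab: "a \<in> {1..k}" "b \<in> {1..k}" by (auto simp: pairs_def)
    show "card {p \<in> E a. p - 1 \<in> U b} + card {p \<in> J b. p \<in> U a}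
        = card {p \<in> X a. p - 1 \<in> U b} + card {p \<in> F b. p \<in> U a}
          + (card {p \<in> T `` {a}. p - 1 \<in> U b} + card {p \<in> T `` {b}. p \<in> U a})"
      unfolding E(1)[OF ab(1)] J(1)[OF ab(2)]
        split[OF fin(1)[OF ab(1)] finT E(2)[OF ab(1)]] split[OF fin(2)[OF ab(2)] finT J(2)[OF ab(2)]]
      by simp
  qed
  also have "\<dots> = (\<Sum>(a, b)\<in>pairs k. card {p \<in> X a. p - 1 \<in> U b} + card {p \<in> F b. p \<in> U a})
      + (\<Sum>(a, p)\<in>T. colour_rank k U a p)"
    unfolding colour_rank_def case_prod_unfold sum.distrib
    using r1 r2 by (simp add: case_prod_unfold)
  finally have e3: "(\<Sum>(a, b)\<in>pairs k. card {p \<in> E a. p - 1 \<in> U b} + card {p \<in> J b. p \<in> U a}) = \<dots>" .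
  have "(\<Prod>(a, p)\<in>T. x * y * t ^ colour_rank k U a p)
      = x ^ card T * y ^ card T * t ^ (\<Sum>(a, p)\<in>T. colour_rank k U a p)"
    by (simp add: case_prod_unfold prod.distrib power_sum power_mult_distrib)
  then show ?thesis unfolding e1 e2 e3 by (simp add: power_add mult_ac)
qed

text \<open>The term \<open>card (J \<inter> S)\<close> comes from the dual weight.  It is what makes the right-hand side
  free of products of the choices made in two different colours: there \<open>E\<close> is paired with \<open>V0\<close> and
  \<open>J\<close> with \<open>U\<close>, and neither \<open>V0\<close> nor \<open>U\<close> depends on the choices.\<close>

lemma pair_exponent:
  fixes E V J U S :: "int set" and d :: int
  assumes "finite E" "finite J"
    and V: "V = V0 \<union> (\<lambda>p. p + d) ` J" "V0 \<inter> (\<lambda>p. p + d) ` J = {}"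
    and U: "\<And>p. p \<in> U \<longleftrightarrow> p + d \<in> E \<or> p \<in> S" "\<And>p. p \<in> S \<Longrightarrow> p + d \<notin> E"
  shows "card (E \<inter> V) + card (J \<inter> S) = card (E \<inter> V0) + card {p \<in> J. p \<in> U}"
proof -
  have "E \<inter> V = (E \<inter> V0) \<union> (E \<inter> (\<lambda>p. p + d) ` J)" using V(1) by auto
  then have 1: "card (E \<inter> V) = card (E \<inter> V0) + card (E \<inter> (\<lambda>p. p + d) ` J)"
    using V(2) assms(1) by (subst card_Un_disjoint[symmetric]) auto
  have "E \<inter> (\<lambda>p. p + d) ` J = (\<lambda>p. p + d) ` {p \<in> J. p + d \<in> E}" by auto
  then have 2: "card (E \<inter> (\<lambda>p. p + d) ` J) = card {p \<in> J. p + d \<in> E}"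
    by (simp add: card_image inj_on_def)
  have "{p \<in> J. p \<in> U} = {p \<in> J. p + d \<in> E} \<union> (J \<inter> S)" using U(1) by auto
  then have "card {p \<in> J. p \<in> U} = card {p \<in> J. p + d \<in> E} + card (J \<inter> S)"
    using U(2) assms(2) by (subst card_Un_disjoint[symmetric]) auto
  with 1 2 show ?thesis by simp
qed

section \<open>The skew Cauchy identity\<close>

text \<open>Closed at both ends, unlike \<open>enters\<close>, so that a resting particle still
  occupies a point, while a row with \<beta> one above \<alpha> contributes nothing.\<close>

definition occupied :: "ktuple \<Rightarrow> ktuple \<Rightarrow> nat \<Rightarrow> int set" where
  "occupied \<alpha> \<beta> a = {p. \<exists>i\<ge>1. pos \<beta> a i \<le> p \<and> p \<le> pos \<alpha> a i}"

definition ups :: "nat \<Rightarrow> ktuple \<Rightarrow> ktuple \<Rightarrow> ktuple set" where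
  "ups k \<alpha> \<beta> = {\<kappa> \<in> ktuples k. interlaces k \<kappa> \<beta> \<and> cointerlaces k \<kappa> \<alpha>}"

definition downs :: "nat \<Rightarrow> ktuple \<Rightarrow> ktuple \<Rightarrow> ktuple set" where
  "downs k \<alpha> \<beta> = {\<nu> \<in> ktuples k. interlaces k \<alpha> \<nu> \<and> cointerlaces k \<beta> \<nu>}"

lemma reach_iff_occupied: "p \<in> reach \<alpha> \<beta> a \<longleftrightarrow> p - 1 \<in> occupied \<alpha> \<beta> a"
  by (auto simp: reach_def occupied_def)

text \<open>These inequalities follow from the existence of a single \<kappa> in \<open>ups\<close>
  or a single \<nu> in \<open>downs\<close>. Conversely they make both sets nonempty, since the
  empty set of free choices yields a member of each.\<close>

locale compatible_pair =
  fixes k :: nat and \<alpha> \<beta> :: ktuple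
  assumes \<alpha>: "\<alpha> \<in> ktuples k" and \<beta>: "\<beta> \<in> ktuples k"
    and upper: "a \<in> {1..k} \<Longrightarrow> i \<ge> 1 \<Longrightarrow> \<beta> a i \<le> \<alpha> a i + 1"
    and lower: "a \<in> {1..k} \<Longrightarrow> i \<ge> 1 \<Longrightarrow> \<alpha> a (i + 1) \<le> \<beta> a i"
begin

abbreviation U :: "nat \<Rightarrow> int set" where "U \<equiv> occupied \<alpha> \<beta>"

text \<open>The weight when no free particle jumps: the motion already present between \<beta> and
  \<alpha> together with the forced jumps. It is the same for \<kappa> and for \<nu>.\<close>

definition base :: "real \<Rightarrow> real \<Rightarrow> real \<Rightarrow> real" where
  "base x y t = x ^ (\<Sum>a\<in>{1..k}. card (enters \<alpha> \<beta> a)) * y ^ (\<Sum>a\<in>{1..k}. card (jumps \<beta> \<alpha> a))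
     * t ^ (\<Sum>(a, b)\<in>pairs k. card {p \<in> enters \<alpha> \<beta> a. p - 1 \<in> U b} + card {p \<in> jumps \<beta> \<alpha> b. p \<in> U a})"

lemma pos_upper: "a \<in> {1..k} \<Longrightarrow> i \<ge> 1 \<Longrightarrow> pos \<beta> a i \<le> pos \<alpha> a i + 1"
  using upper[of a i] by (simp add: pos_def)

text \<open>In rows where both tuples vanish, the interval is the single point -i; on the right the
  first parts of \<alpha> bound everything. The sum of the two bounds serves both sides, as the scan
  asks for a symmetric window.\<close>

lemma occupied_bounds:
  obtains B :: int where "\<And>a p. a \<in> {1..k} \<Longrightarrow> p < - B \<Longrightarrow> p \<in> U a"
    and "\<And>a p. a \<in> {1..k} \<Longrightarrow> p \<ge> B \<Longrightarrow> p \<notin> U a"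
proof -
  define Z where "Z = (\<Union>a\<in>{1..k}. {i. \<alpha> a i \<noteq> 0} \<union> {i. \<beta> a i \<noteq> 0})"
  have "finite Z" unfolding Z_def using finite_parts[OF \<alpha>] finite_parts[OF \<beta>] by auto
  then obtain n where n: "\<And>i. i \<in> Z \<Longrightarrow> i \<le> n" using finite_nat_set_iff_bounded_le by metis
  define C where "C = (\<Sum>a\<in>{1..k}. \<alpha> a 1)"
  show ?thesis
  proof (rule that[of "int (n + C)"])
    fix a p assume a: "a \<in> {1..k}" and p: "p < - int (n + C)"
    define i where "i = nat (- p)"
    have i: "i > n" "i \<ge> 1" "p = - int i" using p by (auto simp: i_def)
    then have "i \<notin> Z" using n[of i] by auto
    then have "\<alpha> a i = 0" "\<beta> a i = 0" using a by (auto simp: Z_def)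
    then show "p \<in> U a" using i by (auto simp: occupied_def pos_def intro!: exI[of _ i])
  next
    fix a p assume a: "a \<in> {1..k}" and p: "p \<ge> int (n + C)"
    show "p \<notin> U a"
    proof
      assume "p \<in> U a"
      then obtain i where i: "i \<ge> 1" "p \<le> pos \<alpha> a i" by (auto simp: occupied_def)
      have "\<alpha> a i \<le> \<alpha> a 1" using i by (intro ktuple_antimono[OF \<alpha>]) auto
      also have "\<alpha> a 1 \<le> C" unfolding C_def using a by (intro member_le_sum) auto
      finally show False using i p by (simp add: pos_def)
    qed
  qed
qed

text \<open>An entered position lies in the same interval as its predecessor. Hence
  \<open>enters \<alpha> \<beta>\<close> avoids both kinds of boundary points, and free choices are
  genuinely new entries.\<close>

lemma enters_boundary:
  assumes "a \<in> {1..k}" "p \<in> enters \<alpha> \<beta> a"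
  shows "p \<in> U a" "p - 1 \<in> U a"
  using assms by (fastforce simp: enters_def occupied_def)+

text \<open>The row of a forced jump has an empty interval, and strict monotonicity of positions
  keeps all other rows away from p - 1 and p. So forced jumps never compete with free ones.\<close>

lemma jumps_not_boundary:
  assumes a: "a \<in> {1..k}" and p: "p \<in> jumps \<beta> \<alpha> a"
  shows "p \<notin> U a" "p - 1 \<notin> U a"
proof -
  from p obtain i where i: "i \<ge> 1" "pos \<beta> a i = p" "pos \<alpha> a i = p - 1" by (auto simp: jumps_def)
  have "\<not> (pos \<beta> a j \<le> p \<and> p - 1 \<le> pos \<alpha> a j)" if "j \<ge> 1" "j \<noteq> i" for j
    using that i pos_strict[OF \<alpha>, of i j a] pos_strict[OF \<beta>, of j i a]
    by (cases i j rule: linorder_cases) auto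
  then show "p \<notin> U a" "p - 1 \<notin> U a" using i by (fastforce simp: occupied_def)+
qed

text \<open>Finds the particle that a chosen right end sets in motion: an interval containing p - 1
  but not p must stop at p - 1.\<close>

lemma end_imp_pos:
  assumes "(a, p) \<in> ends k U"
  obtains i where "i \<ge> 1" "pos \<alpha> a i = p - 1"
proof -
  obtain i where i: "i \<ge> 1" "pos \<beta> a i \<le> p - 1" "p - 1 \<le> pos \<alpha> a i" and "p \<notin> U a"
    using assms by (auto simp: ends_def occupied_def)
  then have "\<not> p \<le> pos \<alpha> a i" by (fastforce simp: occupied_def)
  then have "pos \<alpha> a i = p - 1" using i by simp
  then show ?thesis using i(1) that by blast
qed

lemma start_imp_pos:
  assumes "(a, p) \<in> starts k U"
  obtains i where "i \<ge> 1" "pos \<beta> a i = p"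
proof -
  obtain i where i: "i \<ge> 1" "pos \<beta> a i \<le> p" "p \<le> pos \<alpha> a i" and "p - 1 \<notin> U a"
    using assms by (auto simp: starts_def occupied_def)
  then have "\<not> pos \<beta> a i \<le> p - 1" by (fastforce simp: occupied_def)
  then have "pos \<beta> a i = p" using i by simp
  then show ?thesis using i(1) that by blast
qed

text \<open>The members of \<open>jumps \<beta> \<alpha> a\<close> are the forced jumps, common to all \<open>\<kappa>\<close> and \<open>\<nu>\<close>.\<close>

definition up_set :: "ktuple \<Rightarrow> (nat \<times> int) set" where
  "up_set \<kappa> = {(a, p). a \<in> {1..k} \<and> p \<in> jumps \<kappa> \<alpha> a - jumps \<beta> \<alpha> a}"

definition down_set :: "ktuple \<Rightarrow> (nat \<times> int) set" where
  "down_set \<nu> = {(a, p). a \<in> {1..k} \<and> p \<in> jumps \<beta> \<nu> a - jumps \<beta> \<alpha> a}"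

definition up_tuple :: "(nat \<times> int) set \<Rightarrow> ktuple" where
  "up_tuple T = (\<lambda>a i. \<alpha> a i + of_bool (a \<in> {1..k} \<and> i \<ge> 1 \<and>
     (pos \<alpha> a i + 1 \<in> jumps \<beta> \<alpha> a \<or> (a, pos \<alpha> a i + 1) \<in> T)))"

text \<open>The subtraction is on natural numbers. For a set \<open>T\<close> of left ends it does
  not truncate, because \<open>down_tuple_room\<close> gives the moved part a positive
  value.\<close>

definition down_tuple :: "(nat \<times> int) set \<Rightarrow> ktuple" where
  "down_tuple T = (\<lambda>a i. \<beta> a i - of_bool (a \<in> {1..k} \<and> i \<ge> 1 \<and>
     (pos \<beta> a i \<in> jumps \<beta> \<alpha> a \<or> (a, pos \<beta> a i) \<in> T)))"

section \<open>Tuples in \<open>ups\<close>: weight and free jumps\<close>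

context
  fixes \<kappa> assumes \<kappa>: "\<kappa> \<in> ups k \<alpha> \<beta>"
begin

lemma
  shows up_ktuple: "\<kappa> \<in> ktuples k" and up_interlaces: "interlaces k \<kappa> \<beta>"
    and up_cointerlaces: "cointerlaces k \<kappa> \<alpha>"
  using \<kappa> by (auto simp: ups_def)

lemma up_pos:
  assumes "a \<in> {1..k}" "i \<ge> 1"
  shows "pos \<kappa> a i = pos \<alpha> a i \<or> pos \<kappa> a i = pos \<alpha> a i + 1" "pos \<beta> a i \<le> pos \<kappa> a i"
    "i < j \<Longrightarrow> pos \<kappa> a j < pos \<beta> a i"
  using cointerlaces_pos[OF up_cointerlaces assms] interlaces_pos_le[OF up_interlaces assms]
    interlaces_pos[OF up_interlaces up_ktuple assms] by auto

lemma up_jumps_split: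
  assumes a: "a \<in> {1..k}"
  shows "jumps \<kappa> \<alpha> a = jumps \<beta> \<alpha> a \<union> up_set \<kappa> `` {a}"
proof -
  have "jumps \<beta> \<alpha> a \<subseteq> jumps \<kappa> \<alpha> a"
  proof
    fix p assume "p \<in> jumps \<beta> \<alpha> a"
    then obtain i where "i \<ge> 1" "pos \<beta> a i = p" "pos \<alpha> a i = p - 1" by (auto simp: jumps_def)
    then show "p \<in> jumps \<kappa> \<alpha> a"
      using up_pos(1,2)[OF a, of i] by (auto simp: jumps_def intro!: exI[of _ i])
  qed
  then show ?thesis using a by (auto simp: up_set_def)
qed

text \<open>A free particle starts from p - 1, which lies in the interval of its own row. No row
  covers p: later rows of \<alpha> are further left, and the intervals of earlier rows begin beyond
  p because \<kappa> interlaces with \<beta>.\<close>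

lemma up_set_ends: "up_set \<kappa> \<subseteq> ends k U"
proof (clarify)
  fix a p assume "(a, p) \<in> up_set \<kappa>"
  then have a: "a \<in> {1..k}" and p: "p \<in> jumps \<kappa> \<alpha> a" "p \<notin> jumps \<beta> \<alpha> a" by (auto simp: up_set_def)
  then obtain i where i: "i \<ge> 1" "pos \<kappa> a i = p" "pos \<alpha> a i = p - 1" by (auto simp: jumps_def)
  with p(2) have "pos \<beta> a i \<noteq> p" by (auto simp: jumps_def)
  then have "p - 1 \<in> U a" using i up_pos(2)[OF a, of i] by (auto simp: occupied_def intro!: exI[of _ i])
  moreover have "\<not> (pos \<beta> a j \<le> p \<and> p \<le> pos \<alpha> a j)" if "j \<ge> 1" for j
    using that i pos_strict[OF \<alpha>, of i j a] up_pos(3)[OF a that, of i]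
    by (cases i j rule: linorder_cases) auto
  then have "p \<notin> U a" by (auto simp: occupied_def)
  ultimately show "(a, p) \<in> ends k U" using a by (simp add: ends_def)
qed

text \<open>A forced jump lands exactly on the particle of \<beta>, so it enters nothing; a free
  jump enters just its landing position.\<close>

lemma up_enters:
  assumes a: "a \<in> {1..k}"
  shows "enters \<kappa> \<beta> a = enters \<alpha> \<beta> a \<union> up_set \<kappa> `` {a}"
proof (intro set_eqI iffI)
  fix p assume "p \<in> enters \<kappa> \<beta> a"
  then obtain i where i: "i \<ge> 1" "pos \<beta> a i < p" "p \<le> pos \<kappa> a i" by (auto simp: enters_def)
  show "p \<in> enters \<alpha> \<beta> a \<union> up_set \<kappa> `` {a}"
  proof (cases "p \<le> pos \<alpha> a i")
    case False
    then have p: "p = pos \<kappa> a i" "pos \<alpha> a i = p - 1" using up_pos(1)[OF a i(1)] i by auto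
    have "p \<notin> jumps \<beta> \<alpha> a"
    proof
      assume "p \<in> jumps \<beta> \<alpha> a"
      then obtain j where j: "j \<ge> 1" "pos \<beta> a j = p" "pos \<alpha> a j = p - 1" by (auto simp: jumps_def)
      then have "i = j" using p i by (intro pos_inj[OF \<alpha>, of i j a]) auto
      then show False using i j by simp
    qed
    then show ?thesis using a i p by (auto simp: up_set_def jumps_def)
  qed (use i in \<open>auto simp: enters_def\<close>)
next
  fix p assume "p \<in> enters \<alpha> \<beta> a \<union> up_set \<kappa> `` {a}"
  then show "p \<in> enters \<kappa> \<beta> a"
  proof
    assume "p \<in> enters \<alpha> \<beta> a"
    then obtain i where "i \<ge> 1" "pos \<beta> a i < p" "p \<le> pos \<alpha> a i" by (auto simp: enters_def)
    then show ?thesis using up_pos(1)[OF a, of i] by (auto simp: enters_def intro!: exI[of _ i])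
  next
    assume "p \<in> up_set \<kappa> `` {a}"
    then have p: "p \<in> jumps \<kappa> \<alpha> a" "p \<notin> jumps \<beta> \<alpha> a" by (auto simp: up_set_def)
    then obtain i where i: "i \<ge> 1" "pos \<kappa> a i = p" "pos \<alpha> a i = p - 1" by (auto simp: jumps_def)
    with p(2) have "pos \<beta> a i \<noteq> p" by (auto simp: jumps_def)
    then show ?thesis using i up_pos(2)[OF a i(1)] by (auto simp: enters_def intro!: exI[of _ i])
  qed
qed

text \<open>Unlike \<open>enters\<close>, \<open>reach\<close> grows with forced and free jumps
  alike, each adding the position after the landing point. This is the shift \<open>d = 1\<close> in
  \<open>pair_exponent\<close>.\<close>

lemma up_reach:
  assumes a: "a \<in> {1..k}"
  shows "reach \<kappa> \<beta> a = reach \<alpha> \<beta> a \<union> (\<lambda>p. p + 1) ` jumps \<kappa> \<alpha> a"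
    and "reach \<alpha> \<beta> a \<inter> (\<lambda>p. p + 1) ` jumps \<kappa> \<alpha> a = {}"
proof -
  show "reach \<kappa> \<beta> a = reach \<alpha> \<beta> a \<union> (\<lambda>p. p + 1) ` jumps \<kappa> \<alpha> a"
  proof (intro set_eqI iffI)
    fix p assume "p \<in> reach \<kappa> \<beta> a"
    then obtain i where i: "i \<ge> 1" "pos \<beta> a i < p" "p \<le> pos \<kappa> a i + 1" by (auto simp: reach_def)
    show "p \<in> reach \<alpha> \<beta> a \<union> (\<lambda>p. p + 1) ` jumps \<kappa> \<alpha> a"
    proof (cases "p \<le> pos \<alpha> a i + 1")
      case False
      then have "p - 1 \<in> jumps \<kappa> \<alpha> a"
        using i up_pos(1)[OF a i(1)] by (auto simp: jumps_def intro!: exI[of _ i])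
      then show ?thesis by (auto intro!: image_eqI[of _ _ "p - 1"])
    qed (use i in \<open>auto simp: reach_def\<close>)
  next
    fix p assume "p \<in> reach \<alpha> \<beta> a \<union> (\<lambda>p. p + 1) ` jumps \<kappa> \<alpha> a"
    then obtain i where "i \<ge> 1" "pos \<beta> a i < p \<and> p \<le> pos \<alpha> a i + 1 \<or> p - 1 = pos \<kappa> a i"
      by (auto simp: reach_def jumps_def)
    then show "p \<in> reach \<kappa> \<beta> a"
      using up_pos(1,2)[OF a, of i] by (auto simp: reach_def intro!: exI[of _ i])
  qed
  have False if p: "p \<in> jumps \<kappa> \<alpha> a" "p + 1 \<in> reach \<alpha> \<beta> a" for p
  proof -
    obtain i where i: "i \<ge> 1" "pos \<kappa> a i = p" "pos \<alpha> a i = p - 1"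
      using p(1) by (auto simp: jumps_def)
    moreover obtain j where j: "j \<ge> 1" "pos \<beta> a j \<le> p" "p \<le> pos \<alpha> a j"
      using p(2) by (auto simp: reach_def)
    ultimately show False
      using pos_strict[OF \<alpha>, of i j a] up_pos(3)[OF a j(1), of i]
      by (cases i j rule: linorder_cases) auto
  qed
  then show "reach \<alpha> \<beta> a \<inter> (\<lambda>p. p + 1) ` jumps \<kappa> \<alpha> a = {}" by auto
qed

text \<open>A position of \<open>U a\<close> is either below the particle of \<kappa> in its row, so
  that its successor is entered, or the place of a particle that does not jump. Both terms vary with
  \<kappa> but their union does not, which is how the choices of the first colour leave the
  exponent.\<close>

lemma up_occupied:
  assumes a: "a \<in> {1..k}"
  shows "p \<in> U a \<longleftrightarrow> p + 1 \<in> enters \<kappa> \<beta> a \<or> p \<in> stays \<kappa> \<alpha> a"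
    and "p \<in> stays \<kappa> \<alpha> a \<Longrightarrow> p + 1 \<notin> enters \<kappa> \<beta> a"
proof -
  show "p \<in> U a \<longleftrightarrow> p + 1 \<in> enters \<kappa> \<beta> a \<or> p \<in> stays \<kappa> \<alpha> a"
  proof
    assume "p \<in> U a"
    then obtain i where i: "i \<ge> 1" "pos \<beta> a i \<le> p" "p \<le> pos \<alpha> a i" by (auto simp: occupied_def)
    then show "p + 1 \<in> enters \<kappa> \<beta> a \<or> p \<in> stays \<kappa> \<alpha> a"
      using up_pos(1,2)[OF a i(1)]
      by (cases "p < pos \<kappa> a i") (auto simp: enters_def stays_def intro!: exI[of _ i])
  next
    assume "p + 1 \<in> enters \<kappa> \<beta> a \<or> p \<in> stays \<kappa> \<alpha> a"
    then obtain i where "i \<ge> 1" "pos \<beta> a i \<le> p \<and> p < pos \<kappa> a i \<or> p = pos \<kappa> a i \<and> p = pos \<alpha> a i"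
      by (auto simp: enters_def stays_def)
    then show "p \<in> U a"
      using up_pos(1,2)[OF a, of i] by (auto simp: occupied_def intro!: exI[of _ i])
  qed
  show "p + 1 \<notin> enters \<kappa> \<beta> a" if p: "p \<in> stays \<kappa> \<alpha> a"
  proof
    assume "p + 1 \<in> enters \<kappa> \<beta> a"
    then obtain j where j: "j \<ge> 1" "pos \<beta> a j \<le> p" "p < pos \<kappa> a j"
      by (auto simp: enters_def)
    obtain i where i: "i \<ge> 1" "pos \<kappa> a i = p" using p by (auto simp: stays_def)
    show False
      using i j up_pos(2)[OF a i(1)] up_pos(3)[OF a i(1), of j] up_pos(3)[OF a j(1), of i]
      by (cases i j rule: linorder_cases) auto
  qed
qed

lemma up_weight:
  "LLT1 k x t \<kappa> \<beta> * dual_LLT1 k y t \<kappa> \<alpha>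
     = base x y t * (\<Prod>(a, p)\<in>up_set \<kappa>. x * y * t ^ colour_rank k U a p)"
proof -
  have e: "card (enters \<kappa> \<beta> a \<inter> reach \<kappa> \<beta> b) + card (jumps \<kappa> \<alpha> b \<inter> stays \<kappa> \<alpha> a)
      = card {p \<in> enters \<kappa> \<beta> a. p - 1 \<in> U b} + card {p \<in> jumps \<kappa> \<alpha> b. p \<in> U a}"
    if "(a, b) \<in> pairs k" for a b
  proof -
    have ab: "a \<in> {1..k}" "b \<in> {1..k}" using that by (auto simp: pairs_def)
    have "enters \<kappa> \<beta> a \<inter> reach \<alpha> \<beta> b = {p \<in> enters \<kappa> \<beta> a. p - 1 \<in> U b}"
      by (auto simp: reach_iff_occupied)
    with pair_exponent[OF finite_enters[OF up_ktuple ab(1)] finite_jumps[OF up_ktuple]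
        up_reach[OF ab(2)] up_occupied[OF ab(1)]]
    show ?thesis by simp
  qed
  have "LLT1 k x t \<kappa> \<beta> * dual_LLT1 k y t \<kappa> \<alpha>
      = x ^ (\<Sum>a\<in>{1..k}. card (enters \<kappa> \<beta> a)) * y ^ (\<Sum>a\<in>{1..k}. card (jumps \<kappa> \<alpha> a))
        * t ^ ((\<Sum>(a, b)\<in>pairs k. card (enters \<kappa> \<beta> a \<inter> reach \<kappa> \<beta> b))
             + (\<Sum>(a, b)\<in>pairs k. card (jumps \<kappa> \<alpha> b \<inter> stays \<kappa> \<alpha> a)))"
    by (simp only: LLT1_eq[OF up_ktuple up_interlaces] dual_LLT1_eq[OF up_ktuple \<alpha> up_cointerlaces]
        power_add mult_ac)
  also have "(\<Sum>(a, b)\<in>pairs k. card (enters \<kappa> \<beta> a \<inter> reach \<kappa> \<beta> b))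
        + (\<Sum>(a, b)\<in>pairs k. card (jumps \<kappa> \<alpha> b \<inter> stays \<kappa> \<alpha> a))
      = (\<Sum>(a, b)\<in>pairs k. card {p \<in> enters \<kappa> \<beta> a. p - 1 \<in> U b} + card {p \<in> jumps \<kappa> \<alpha> b. p \<in> U a})"
    unfolding sum.distrib[symmetric] by (rule sum.cong) (use e in auto)
  also have "x ^ (\<Sum>a\<in>{1..k}. card (enters \<kappa> \<beta> a)) * y ^ (\<Sum>a\<in>{1..k}. card (jumps \<kappa> \<alpha> a)) * t ^ \<dots>
      = base x y t * (\<Prod>(a, p)\<in>up_set \<kappa>. x * y * t ^ colour_rank k U a p)"
    unfolding base_def
  proof (rule weight_factor)
    have "up_set \<kappa> = (SIGMA a:{1..k}. jumps \<kappa> \<alpha> a - jumps \<beta> \<alpha> a)" by (auto simp: up_set_def)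
    then show "finite (up_set \<kappa>)" using finite_jumps[OF up_ktuple] by simp
    show "fst ` up_set \<kappa> \<subseteq> {1..k}" by (auto simp: up_set_def)
    show "enters \<alpha> \<beta> a \<inter> up_set \<kappa> `` {a} = {}" if "a \<in> {1..k}" for a
      using enters_boundary(1)[OF that] up_set_ends by (auto simp: ends_def)
    show "jumps \<beta> \<alpha> a \<inter> up_set \<kappa> `` {a} = {}" for a by (auto simp: up_set_def)
  qed (use up_enters up_jumps_split finite_enters[OF \<alpha>] finite_jumps[OF \<beta>] in auto)
  finally show ?thesis .
qed

lemma up_tuple_up_set: "up_tuple (up_set \<kappa>) = \<kappa>"
proof (intro ext)
  fix a i
  show "up_tuple (up_set \<kappa>) a i = \<kappa> a i"
  proof (cases "a \<in> {1..k} \<and> i \<ge> 1")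
    case True
    then have a: "a \<in> {1..k}" and i: "i \<ge> 1" by auto
    have "pos \<alpha> a i + 1 \<in> jumps \<beta> \<alpha> a \<or> (a, pos \<alpha> a i + 1) \<in> up_set \<kappa> \<longleftrightarrow> pos \<alpha> a i + 1 \<in> jumps \<kappa> \<alpha> a"
      using up_jumps_split[OF a] by auto
    also have "\<dots> \<longleftrightarrow> pos \<kappa> a i = pos \<alpha> a i + 1"
      using i pos_inj[OF \<alpha>, of _ i a] by (auto simp: jumps_def)
    finally show ?thesis using a i up_pos(1)[OF a i] by (auto simp: up_tuple_def pos_def)
  next
    case False
    then have "a \<notin> {1..k} \<or> i = 0" by auto
    then show ?thesis
      using False ktuple_outside[OF \<alpha>, of a i] ktuple_outside[OF up_ktuple, of a i]
      by (simp only: up_tuple_def) auto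
  qed
qed

end

section \<open>Every set of right ends is realised by a tuple in \<open>ups\<close>\<close>

context
  fixes T assumes T: "T \<subseteq> ends k U"
begin

lemma up_tuple_jump:
  assumes "a \<in> {1..k}" "i \<ge> 1"
  shows "pos (up_tuple T) a i = pos \<alpha> a i
    + of_bool (pos \<alpha> a i + 1 \<in> jumps \<beta> \<alpha> a \<or> (a, pos \<alpha> a i + 1) \<in> T)"
  using assms by (simp add: pos_def up_tuple_def)

lemma up_tuple_cointerlaces: "cointerlaces k (up_tuple T) \<alpha>"
  by (auto simp: cointerlaces_def up_tuple_def)

text \<open>The only danger is a jump of row i + 1 when
  \<open>\<alpha> a (i + 1) = \<beta> a i\<close>, which would land on row i of \<beta>. If forced,
  it would identify rows i and i + 1. If free, the landing point would be outside
  \<open>U a\<close>, so the interval of row i would be empty, putting rows i and i + 1 of \<alpha>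
  at the same position.\<close>

lemma up_tuple_interlaces: "interlaces k (up_tuple T) \<beta>"
  unfolding interlaces_def
proof (intro ballI allI impI conjI)
  fix a i :: nat assume a: "a \<in> {1..k}" and i: "i \<ge> 1"
  show "\<beta> a i \<le> up_tuple T a i"
  proof (cases "\<beta> a i = \<alpha> a i + 1")
    case True
    then have "pos \<alpha> a i + 1 \<in> jumps \<beta> \<alpha> a" using i by (auto simp: jumps_def pos_def)
    then show ?thesis using True a i by (simp add: up_tuple_def)
  next
    case False
    then show ?thesis using upper[OF a i] by (simp add: up_tuple_def)
  qed
  show "up_tuple T a (i + 1) \<le> \<beta> a i"
  proof (rule ccontr)
    assume "\<not> up_tuple T a (i + 1) \<le> \<beta> a i"
    then have eq: "\<alpha> a (i + 1) = \<beta> a i"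
      and J: "pos \<alpha> a (i + 1) + 1 \<in> jumps \<beta> \<alpha> a \<or> (a, pos \<alpha> a (i + 1) + 1) \<in> T"
      using lower[OF a i] by (auto simp: up_tuple_def of_bool_def split: if_splits)
    then have q: "pos \<alpha> a (i + 1) + 1 = pos \<beta> a i" by (simp add: pos_def)
    from J show False
    proof
      assume "pos \<alpha> a (i + 1) + 1 \<in> jumps \<beta> \<alpha> a"
      then obtain j where j: "j \<ge> 1" "pos \<beta> a j = pos \<beta> a i" "pos \<alpha> a j = pos \<alpha> a (i + 1)"
        unfolding jumps_def q[symmetric] by force
      then have "j = i" "j = i + 1" using i pos_inj[OF \<beta>, of j i a] pos_inj[OF \<alpha>, of j "i + 1" a] by auto
      then show False by simp
    next
      assume "(a, pos \<alpha> a (i + 1) + 1) \<in> T"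
      then have "(a, pos \<beta> a i) \<in> ends k U" using T unfolding q by blast
      then have "pos \<beta> a i \<notin> U a" by (simp add: ends_def)
      then have "pos \<alpha> a i < pos \<beta> a i" using i by (auto simp: occupied_def)
      then have "pos \<alpha> a i = pos \<alpha> a (i + 1)" using pos_upper[OF a i] q by simp
      then show False using pos_inj[OF \<alpha>, of i "i + 1" a] i by simp
    qed
  qed
qed

lemma up_tuple_in_ups: "up_tuple T \<in> ups k \<alpha> \<beta>"
proof -
  note il = up_tuple_interlaces[unfolded interlaces_def, rule_format]
  have "is_partition (up_tuple T a)" if a: "a \<in> {1..k}" for a
    unfolding is_partition_def
  proof (intro conjI allI impI)
    show "up_tuple T a 0 = 0" using ktuple_outside[OF \<alpha>, of a 0] by (simp add: up_tuple_def)
    show "up_tuple T a (i + 1) \<le> up_tuple T a i" if "i \<ge> 1" for i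
      using il[OF a that] by linarith
    \<comment> \<open>Interlacing bounds row j + 1 by row j of \<beta>; rows 0 and 1 have no such
      bound and are added by hand.\<close>
    have "{i. up_tuple T a i \<noteq> 0} \<subseteq> {0, 1} \<union> Suc ` {i. \<beta> a i \<noteq> 0}"
    proof
      fix i assume i: "i \<in> {i. up_tuple T a i \<noteq> 0}"
      show "i \<in> {0, 1} \<union> Suc ` {i. \<beta> a i \<noteq> 0}"
      proof (cases "i \<le> 1")
        case False
        then obtain j where j: "i = j + 1" "j \<ge> 1" by (cases i) auto
        then have "\<beta> a j \<noteq> 0" using il[OF a j(2)] i by auto
        then show ?thesis using j by auto
      qed auto
    qed
    then show "finite {i. up_tuple T a i \<noteq> 0}"
      by (rule finite_subset) (use finite_parts[OF \<beta>] in auto)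
  qed
  then have "up_tuple T \<in> ktuples k"
    using \<alpha> by (auto simp: ktuples_def up_tuple_def fun_eq_iff)
  then show ?thesis using up_tuple_interlaces up_tuple_cointerlaces by (simp add: ups_def)
qed

lemma up_set_up_tuple: "up_set (up_tuple T) = T"
proof (intro set_eqI iffI; clarify)
  fix a p assume "(a, p) \<in> up_set (up_tuple T)"
  then have a: "a \<in> {1..k}" and p: "p \<in> jumps (up_tuple T) \<alpha> a" "p \<notin> jumps \<beta> \<alpha> a"
    by (auto simp: up_set_def)
  then obtain i where "i \<ge> 1" "pos (up_tuple T) a i = p" "pos \<alpha> a i = p - 1" by (auto simp: jumps_def)
  then show "(a, p) \<in> T" using up_tuple_jump[OF a, of i] p(2) by (auto split: if_splits)
next
  fix a p assume ap: "(a, p) \<in> T"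
  then have e: "(a, p) \<in> ends k U" using T by auto
  then have a: "a \<in> {1..k}" and "p - 1 \<in> U a" by (auto simp: ends_def)
  then have "p \<notin> jumps \<beta> \<alpha> a" using jumps_not_boundary(2) by blast
  moreover obtain i where "i \<ge> 1" "pos \<alpha> a i = p - 1" using end_imp_pos[OF e] .
  then have "p \<in> jumps (up_tuple T) \<alpha> a"
    using up_tuple_jump[OF a, of i] ap by (auto simp: jumps_def intro!: exI[of _ i])
  ultimately show "(a, p) \<in> up_set (up_tuple T)" using a by (simp add: up_set_def)
qed

end

lemma bij_betw_up_set: "bij_betw up_set (ups k \<alpha> \<beta>) (Pow (ends k U))"
  by (rule bij_betw_byWitness[of _ up_tuple])
    (use up_tuple_up_set up_set_up_tuple up_set_ends up_tuple_in_ups in blast)+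

lemma finite_ups_compatible: "finite (ups k \<alpha> \<beta>)"
proof -
  obtain B :: int where B: "\<And>a p. a \<in> {1..k} \<Longrightarrow> p < - B \<Longrightarrow> p \<in> U a"
    "\<And>a p. a \<in> {1..k} \<Longrightarrow> p \<ge> B \<Longrightarrow> p \<notin> U a" using occupied_bounds by blast
  show ?thesis
    using bij_betw_finite[OF bij_betw_up_set] finite_boundary(2)[of k B U] B by simp
qed

text \<open>The free jumps are independent of each other, so summing over subsets of
  \<open>ends k U\<close> gives one binomial for each end.\<close>

lemma sum_ups:
  "(\<Sum>\<kappa>\<in>ups k \<alpha> \<beta>. LLT1 k x t \<kappa> \<beta> * dual_LLT1 k y t \<kappa> \<alpha>)
     = base x y t * (\<Prod>(a, p)\<in>ends k U. 1 + x * y * t ^ colour_rank k U a p)"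
proof -
  obtain B :: int where B: "\<And>a p. a \<in> {1..k} \<Longrightarrow> p < - B \<Longrightarrow> p \<in> U a"
    "\<And>a p. a \<in> {1..k} \<Longrightarrow> p \<ge> B \<Longrightarrow> p \<notin> U a" using occupied_bounds by blast
  have "(\<Sum>\<kappa>\<in>ups k \<alpha> \<beta>. \<Prod>(a, p)\<in>up_set \<kappa>. x * y * t ^ colour_rank k U a p)
      = (\<Sum>T\<in>Pow (ends k U). \<Prod>(a, p)\<in>T. x * y * t ^ colour_rank k U a p)"
    by (rule sum.reindex_bij_betw[OF bij_betw_up_set])
  also have "\<dots> = (\<Prod>(a, p)\<in>ends k U. 1 + x * y * t ^ colour_rank k U a p)"
    using prod_one_add[where f = "\<lambda>(a, p). x * y * t ^ colour_rank k U a p"] finite_boundary(2)[of k B U] B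
    by (simp add: case_prod_unfold)
  finally show ?thesis by (simp only: up_weight sum_distrib_left[symmetric] cong: sum.cong)
qed

section \<open>Tuples in \<open>downs\<close>: the mirror argument at left ends\<close>

context
  fixes \<nu> assumes \<nu>: "\<nu> \<in> downs k \<alpha> \<beta>"
begin

lemma
  shows down_ktuple: "\<nu> \<in> ktuples k" and down_interlaces: "interlaces k \<alpha> \<nu>"
    and down_cointerlaces: "cointerlaces k \<beta> \<nu>"
  using \<nu> by (auto simp: downs_def)

lemma down_pos:
  assumes "a \<in> {1..k}" "i \<ge> 1"
  shows "pos \<nu> a i = pos \<beta> a i \<or> pos \<nu> a i = pos \<beta> a i - 1" "pos \<nu> a i \<le> pos \<alpha> a i"
    "i < j \<Longrightarrow> pos \<alpha> a j < pos \<nu> a i"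
  using cointerlaces_pos[OF down_cointerlaces assms] interlaces_pos_le[OF down_interlaces assms]
    interlaces_pos[OF down_interlaces \<alpha> assms] by auto

lemma down_jumps_split:
  assumes a: "a \<in> {1..k}"
  shows "jumps \<beta> \<nu> a = jumps \<beta> \<alpha> a \<union> down_set \<nu> `` {a}"
proof -
  have "jumps \<beta> \<alpha> a \<subseteq> jumps \<beta> \<nu> a"
  proof
    fix p assume "p \<in> jumps \<beta> \<alpha> a"
    then obtain i where "i \<ge> 1" "pos \<beta> a i = p" "pos \<alpha> a i = p - 1" by (auto simp: jumps_def)
    then show "p \<in> jumps \<beta> \<nu> a"
      using down_pos(1,2)[OF a, of i] by (auto simp: jumps_def intro!: exI[of _ i])
  qed
  then show ?thesis using a by (auto simp: down_set_def)
qed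

text \<open>As the jump is not forced, row i of \<alpha> is at p or beyond, so p is in its interval.
  Position p - 1 is the place of row i of \<nu>, and interlacing keeps the later rows of \<alpha>
  strictly left of it.\<close>

lemma down_set_starts: "down_set \<nu> \<subseteq> starts k U"
proof (clarify)
  fix a p assume "(a, p) \<in> down_set \<nu>"
  then have a: "a \<in> {1..k}" and p: "p \<in> jumps \<beta> \<nu> a" "p \<notin> jumps \<beta> \<alpha> a" by (auto simp: down_set_def)
  then obtain i where i: "i \<ge> 1" "pos \<beta> a i = p" "pos \<nu> a i = p - 1" by (auto simp: jumps_def)
  with p(2) have "pos \<alpha> a i \<noteq> p - 1" by (auto simp: jumps_def)
  then have "p \<in> U a" using i down_pos(2)[OF a, of i] by (auto simp: occupied_def intro!: exI[of _ i])
  moreover have "\<not> (pos \<beta> a j \<le> p - 1 \<and> p - 1 \<le> pos \<alpha> a j)" if "j \<ge> 1" for j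
    using that i pos_strict[OF \<beta>, of j i a] down_pos(3)[OF a i(1), of j]
    by (cases i j rule: linorder_cases) auto
  then have "p - 1 \<notin> U a" by (auto simp: occupied_def)
  ultimately show "(a, p) \<in> starts k U" using a by (simp add: starts_def)
qed

lemma down_enters:
  assumes a: "a \<in> {1..k}"
  shows "enters \<alpha> \<nu> a = enters \<alpha> \<beta> a \<union> down_set \<nu> `` {a}"
proof (intro set_eqI iffI)
  fix p assume "p \<in> enters \<alpha> \<nu> a"
  then obtain i where i: "i \<ge> 1" "pos \<nu> a i < p" "p \<le> pos \<alpha> a i" by (auto simp: enters_def)
  show "p \<in> enters \<alpha> \<beta> a \<union> down_set \<nu> `` {a}"
  proof (cases "pos \<beta> a i < p")
    case False
    then have p: "pos \<beta> a i = p" "pos \<nu> a i = p - 1" using down_pos(1)[OF a i(1)] i by auto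
    have "p \<notin> jumps \<beta> \<alpha> a"
    proof
      assume "p \<in> jumps \<beta> \<alpha> a"
      then obtain j where j: "j \<ge> 1" "pos \<beta> a j = p" "pos \<alpha> a j = p - 1" by (auto simp: jumps_def)
      then have "i = j" using p i by (intro pos_inj[OF \<beta>, of i j a]) auto
      then show False using i j by simp
    qed
    then show ?thesis using a i p by (auto simp: down_set_def jumps_def)
  qed (use i in \<open>auto simp: enters_def\<close>)
next
  fix p assume "p \<in> enters \<alpha> \<beta> a \<union> down_set \<nu> `` {a}"
  then show "p \<in> enters \<alpha> \<nu> a"
  proof
    assume "p \<in> enters \<alpha> \<beta> a"
    then obtain i where "i \<ge> 1" "pos \<beta> a i < p" "p \<le> pos \<alpha> a i" by (auto simp: enters_def)
    then show ?thesis using down_pos(1)[OF a, of i] by (auto simp: enters_def intro!: exI[of _ i])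
  next
    assume "p \<in> down_set \<nu> `` {a}"
    then have p: "p \<in> jumps \<beta> \<nu> a" "p \<notin> jumps \<beta> \<alpha> a" by (auto simp: down_set_def)
    then obtain i where i: "i \<ge> 1" "pos \<beta> a i = p" "pos \<nu> a i = p - 1" by (auto simp: jumps_def)
    with p(2) have "pos \<alpha> a i \<noteq> p - 1" by (auto simp: jumps_def)
    then show ?thesis using i down_pos(2)[OF a i(1)] by (auto simp: enters_def intro!: exI[of _ i])
  qed
qed

text \<open>Moving the lower end of an interval back by one adds the old end itself, so
  \<open>pair_exponent\<close> is used here with \<open>d = 0\<close>.\<close>

lemma down_reach:
  assumes a: "a \<in> {1..k}"
  shows "reach \<alpha> \<nu> a = reach \<alpha> \<beta> a \<union> jumps \<beta> \<nu> a"
    and "reach \<alpha> \<beta> a \<inter> jumps \<beta> \<nu> a = {}"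
proof -
  show "reach \<alpha> \<nu> a = reach \<alpha> \<beta> a \<union> jumps \<beta> \<nu> a"
  proof (intro set_eqI iffI)
    fix p assume "p \<in> reach \<alpha> \<nu> a"
    then obtain i where i: "i \<ge> 1" "pos \<nu> a i < p" "p \<le> pos \<alpha> a i + 1" by (auto simp: reach_def)
    show "p \<in> reach \<alpha> \<beta> a \<union> jumps \<beta> \<nu> a"
    proof (cases "pos \<beta> a i < p")
      case False
      then have "p \<in> jumps \<beta> \<nu> a"
        using i down_pos(1)[OF a i(1)] by (auto simp: jumps_def intro!: exI[of _ i])
      then show ?thesis by simp
    qed (use i in \<open>auto simp: reach_def\<close>)
  next
    fix p assume "p \<in> reach \<alpha> \<beta> a \<union> jumps \<beta> \<nu> a"
    then obtain i where "i \<ge> 1" "pos \<beta> a i < p \<and> p \<le> pos \<alpha> a i + 1 \<or> p - 1 = pos \<nu> a i"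
      by (auto simp: reach_def jumps_def)
    then show "p \<in> reach \<alpha> \<nu> a"
      using down_pos(1,2)[OF a, of i] by (auto simp: reach_def intro!: exI[of _ i])
  qed
  have False if p: "p \<in> jumps \<beta> \<nu> a" "p \<in> reach \<alpha> \<beta> a" for p
  proof -
    obtain i where i: "i \<ge> 1" "pos \<beta> a i = p" "pos \<nu> a i = p - 1"
      using p(1) by (auto simp: jumps_def)
    moreover obtain j where j: "j \<ge> 1" "pos \<beta> a j < p" "p - 1 \<le> pos \<alpha> a j"
      using p(2) by (auto simp: reach_def)
    ultimately show False
      using pos_strict[OF \<beta>, of j i a] down_pos(3)[OF a i(1), of j]
      by (cases i j rule: linorder_cases) auto
  qed
  then show "reach \<alpha> \<beta> a \<inter> jumps \<beta> \<nu> a = {}" by auto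
qed

lemma down_occupied:
  assumes a: "a \<in> {1..k}"
  shows "p \<in> U a \<longleftrightarrow> p \<in> enters \<alpha> \<nu> a \<or> p \<in> stays \<beta> \<nu> a"
    and "p \<in> stays \<beta> \<nu> a \<Longrightarrow> p \<notin> enters \<alpha> \<nu> a"
proof -
  show "p \<in> U a \<longleftrightarrow> p \<in> enters \<alpha> \<nu> a \<or> p \<in> stays \<beta> \<nu> a"
  proof
    assume "p \<in> U a"
    then obtain i where i: "i \<ge> 1" "pos \<beta> a i \<le> p" "p \<le> pos \<alpha> a i" by (auto simp: occupied_def)
    then show "p \<in> enters \<alpha> \<nu> a \<or> p \<in> stays \<beta> \<nu> a"
      using down_pos(1,2)[OF a i(1)]
      by (cases "pos \<nu> a i < p") (auto simp: enters_def stays_def intro!: exI[of _ i])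
  next
    assume "p \<in> enters \<alpha> \<nu> a \<or> p \<in> stays \<beta> \<nu> a"
    then obtain i where "i \<ge> 1" "pos \<nu> a i < p \<and> p \<le> pos \<alpha> a i \<or> p = pos \<nu> a i \<and> p = pos \<beta> a i"
      by (auto simp: enters_def stays_def)
    then show "p \<in> U a"
      using down_pos(1,2)[OF a, of i] by (auto simp: occupied_def intro!: exI[of _ i])
  qed
  show "p \<notin> enters \<alpha> \<nu> a" if p: "p \<in> stays \<beta> \<nu> a"
  proof
    assume "p \<in> enters \<alpha> \<nu> a"
    then obtain j where j: "j \<ge> 1" "pos \<nu> a j < p" "p \<le> pos \<alpha> a j"
      by (auto simp: enters_def)
    obtain i where i: "i \<ge> 1" "pos \<beta> a i = p" "pos \<nu> a i = p" using p by (auto simp: stays_def)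
    show False
      using i j down_pos(1)[OF a j(1)] pos_strict[OF \<beta>, of j i a] down_pos(3)[OF a i(1), of j]
      by (cases i j rule: linorder_cases) auto
  qed
qed

lemma down_weight:
  "LLT1 k x t \<alpha> \<nu> * dual_LLT1 k y t \<beta> \<nu>
     = base x y t * (\<Prod>(a, p)\<in>down_set \<nu>. x * y * t ^ colour_rank k U a p)"
proof -
  have e: "card (enters \<alpha> \<nu> a \<inter> reach \<alpha> \<nu> b) + card (jumps \<beta> \<nu> b \<inter> stays \<beta> \<nu> a)
      = card {p \<in> enters \<alpha> \<nu> a. p - 1 \<in> U b} + card {p \<in> jumps \<beta> \<nu> b. p \<in> U a}"
    if "(a, b) \<in> pairs k" for a b
  proof -
    have ab: "a \<in> {1..k}" "b \<in> {1..k}" using that by (auto simp: pairs_def)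
    have "enters \<alpha> \<nu> a \<inter> reach \<alpha> \<beta> b = {p \<in> enters \<alpha> \<nu> a. p - 1 \<in> U b}"
      by (auto simp: reach_iff_occupied)
    with pair_exponent[where d = 0, simplified, OF finite_enters[OF \<alpha> ab(1)] finite_jumps[OF \<beta>]
        down_reach[OF ab(2)] down_occupied[OF ab(1)]]
    show ?thesis by simp
  qed
  have "LLT1 k x t \<alpha> \<nu> * dual_LLT1 k y t \<beta> \<nu>
      = x ^ (\<Sum>a\<in>{1..k}. card (enters \<alpha> \<nu> a)) * y ^ (\<Sum>a\<in>{1..k}. card (jumps \<beta> \<nu> a))
        * t ^ ((\<Sum>(a, b)\<in>pairs k. card (enters \<alpha> \<nu> a \<inter> reach \<alpha> \<nu> b))
             + (\<Sum>(a, b)\<in>pairs k. card (jumps \<beta> \<nu> b \<inter> stays \<beta> \<nu> a)))"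
    by (simp only: LLT1_eq[OF \<alpha> down_interlaces] dual_LLT1_eq[OF \<beta> down_ktuple down_cointerlaces]
        power_add mult_ac)
  also have "(\<Sum>(a, b)\<in>pairs k. card (enters \<alpha> \<nu> a \<inter> reach \<alpha> \<nu> b))
        + (\<Sum>(a, b)\<in>pairs k. card (jumps \<beta> \<nu> b \<inter> stays \<beta> \<nu> a))
      = (\<Sum>(a, b)\<in>pairs k. card {p \<in> enters \<alpha> \<nu> a. p - 1 \<in> U b} + card {p \<in> jumps \<beta> \<nu> b. p \<in> U a})"
    unfolding sum.distrib[symmetric] by (rule sum.cong) (use e in auto)
  also have "x ^ (\<Sum>a\<in>{1..k}. card (enters \<alpha> \<nu> a)) * y ^ (\<Sum>a\<in>{1..k}. card (jumps \<beta> \<nu> a)) * t ^ \<dots>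
      = base x y t * (\<Prod>(a, p)\<in>down_set \<nu>. x * y * t ^ colour_rank k U a p)"
    unfolding base_def
  proof (rule weight_factor)
    have "down_set \<nu> = (SIGMA a:{1..k}. jumps \<beta> \<nu> a - jumps \<beta> \<alpha> a)" by (auto simp: down_set_def)
    then show "finite (down_set \<nu>)" using finite_jumps[OF \<beta>] by simp
    show "fst ` down_set \<nu> \<subseteq> {1..k}" by (auto simp: down_set_def)
    show "enters \<alpha> \<beta> a \<inter> down_set \<nu> `` {a} = {}" if "a \<in> {1..k}" for a
      using enters_boundary(2)[OF that] down_set_starts by (auto simp: starts_def)
    show "jumps \<beta> \<alpha> a \<inter> down_set \<nu> `` {a} = {}" for a by (auto simp: down_set_def)
  qed (use down_enters down_jumps_split finite_enters[OF \<alpha>] finite_jumps[OF \<beta>] in auto)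
  finally show ?thesis .
qed

lemma down_tuple_down_set: "down_tuple (down_set \<nu>) = \<nu>"
proof (intro ext)
  fix a i
  show "down_tuple (down_set \<nu>) a i = \<nu> a i"
  proof (cases "a \<in> {1..k} \<and> i \<ge> 1")
    case True
    then have a: "a \<in> {1..k}" and i: "i \<ge> 1" by auto
    have "pos \<beta> a i \<in> jumps \<beta> \<alpha> a \<or> (a, pos \<beta> a i) \<in> down_set \<nu> \<longleftrightarrow> pos \<beta> a i \<in> jumps \<beta> \<nu> a"
      using down_jumps_split[OF a] by auto
    also have "\<dots> \<longleftrightarrow> pos \<nu> a i = pos \<beta> a i - 1"
      using i pos_inj[OF \<beta>, of _ i a] by (auto simp: jumps_def)
    finally show ?thesis using a i down_pos(1)[OF a i] by (auto simp: down_tuple_def pos_def)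
  next
    case False
    then have "a \<notin> {1..k} \<or> i = 0" by auto
    then show ?thesis
      using False ktuple_outside[OF \<beta>, of a i] ktuple_outside[OF down_ktuple, of a i]
      by (simp only: down_tuple_def)
  qed
qed

end

section \<open>Every set of left ends is realised by a tuple in \<open>downs\<close>\<close>

context
  fixes T assumes T: "T \<subseteq> starts k U"
begin

text \<open>Suppose row i + 1 of \<alpha> sat directly behind row i of \<beta>. A forced jump would
  identify the two rows; a left end would leave the interval of row i + 1 empty, pushing row i + 1
  of \<beta> to row i or beyond. The room gained here gives interlacing as well as exact
  subtraction.\<close>

lemma down_tuple_room:
  assumes a: "a \<in> {1..k}" and i: "i \<ge> 1"
    and J: "pos \<beta> a i \<in> jumps \<beta> \<alpha> a \<or> (a, pos \<beta> a i) \<in> T"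
  shows "\<alpha> a (i + 1) < \<beta> a i"
proof (rule ccontr)
  assume "\<not> \<alpha> a (i + 1) < \<beta> a i"
  then have "\<alpha> a (i + 1) = \<beta> a i" using lower[OF a i] by simp
  then have q: "pos \<alpha> a (i + 1) = pos \<beta> a i - 1" by (simp add: pos_def)
  from J show False
  proof
    assume "pos \<beta> a i \<in> jumps \<beta> \<alpha> a"
    then obtain j where j: "j \<ge> 1" "pos \<beta> a j = pos \<beta> a i" "pos \<alpha> a j = pos \<alpha> a (i + 1)"
      unfolding jumps_def q by force
    then have "j = i" "j = i + 1" using i pos_inj[OF \<beta>, of j i a] pos_inj[OF \<alpha>, of j "i + 1" a] by auto
    then show False by simp
  next
    assume "(a, pos \<beta> a i) \<in> T"
    then have "(a, pos \<beta> a i) \<in> starts k U" using T by blast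
    then have "pos \<alpha> a (i + 1) \<notin> U a" unfolding q by (simp add: starts_def)
    then have "\<not> pos \<beta> a (i + 1) \<le> pos \<alpha> a (i + 1)" by (fastforce simp: occupied_def)
    then show False using q pos_strict[OF \<beta> i, of "i + 1" a] by simp
  qed
qed

lemma down_tuple_jump:
  assumes "a \<in> {1..k}" "i \<ge> 1"
  shows "pos (down_tuple T) a i = pos \<beta> a i
    - of_bool (pos \<beta> a i \<in> jumps \<beta> \<alpha> a \<or> (a, pos \<beta> a i) \<in> T)"
  using down_tuple_room[OF assms] assms by (auto simp: pos_def down_tuple_def)

lemma down_tuple_cointerlaces: "cointerlaces k \<beta> (down_tuple T)"
  unfolding cointerlaces_def
proof (intro ballI allI impI)
  fix a i :: nat assume "a \<in> {1..k}" "i \<ge> 1"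
  from down_tuple_jump[OF this] show "\<beta> a i = down_tuple T a i \<or> \<beta> a i = down_tuple T a i + 1"
    by (auto simp: pos_def of_bool_def split: if_splits)
qed

lemma down_tuple_interlaces: "interlaces k \<alpha> (down_tuple T)"
  unfolding interlaces_def
proof (intro ballI allI impI conjI)
  fix a i :: nat assume a: "a \<in> {1..k}" and i: "i \<ge> 1"
  show "down_tuple T a i \<le> \<alpha> a i"
  proof (cases "\<beta> a i = \<alpha> a i + 1")
    case True
    then have "pos \<beta> a i \<in> jumps \<beta> \<alpha> a" using i by (auto simp: jumps_def pos_def)
    then show ?thesis using True a i by (simp add: down_tuple_def)
  next
    case False
    then show ?thesis using upper[OF a i] by (simp add: down_tuple_def)
  qed
  show "\<alpha> a (i + 1) \<le> down_tuple T a i"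
    using down_tuple_jump[OF a i] down_tuple_room[OF a i] lower[OF a i]
    by (auto simp: pos_def of_bool_def split: if_splits)
qed

lemma down_tuple_in_downs: "down_tuple T \<in> downs k \<alpha> \<beta>"
proof -
  note il = down_tuple_interlaces[unfolded interlaces_def, rule_format]
  have "is_partition (down_tuple T a)" if a: "a \<in> {1..k}" for a
    unfolding is_partition_def
  proof (intro conjI allI impI)
    show "down_tuple T a 0 = 0" using ktuple_outside[OF \<beta>, of a 0] by (simp add: down_tuple_def)
    show "down_tuple T a (i + 1) \<le> down_tuple T a i" if "i \<ge> 1" for i
      using il[OF a that] il[OF a, of "i + 1"] by simp
    have "{i. down_tuple T a i \<noteq> 0} \<subseteq> {i. \<beta> a i \<noteq> 0}" by (auto simp: down_tuple_def)
    then show "finite {i. down_tuple T a i \<noteq> 0}"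
      by (rule finite_subset) (rule finite_parts[OF \<beta>])
  qed
  then have "down_tuple T \<in> ktuples k"
    using \<beta> by (auto simp: ktuples_def down_tuple_def fun_eq_iff)
  then show ?thesis using down_tuple_interlaces down_tuple_cointerlaces by (simp add: downs_def)
qed

lemma down_set_down_tuple: "down_set (down_tuple T) = T"
proof (intro set_eqI iffI; clarify)
  fix a p assume "(a, p) \<in> down_set (down_tuple T)"
  then have a: "a \<in> {1..k}" and p: "p \<in> jumps \<beta> (down_tuple T) a" "p \<notin> jumps \<beta> \<alpha> a"
    by (auto simp: down_set_def)
  then obtain i where "i \<ge> 1" "pos \<beta> a i = p" "pos (down_tuple T) a i = p - 1" by (auto simp: jumps_def)
  then show "(a, p) \<in> T" using down_tuple_jump[OF a, of i] p(2) by (auto split: if_splits)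
next
  fix a p assume ap: "(a, p) \<in> T"
  then have e: "(a, p) \<in> starts k U" using T by auto
  then have a: "a \<in> {1..k}" and "p \<in> U a" by (auto simp: starts_def)
  then have "p \<notin> jumps \<beta> \<alpha> a" using jumps_not_boundary(1) by blast
  moreover obtain i where "i \<ge> 1" "pos \<beta> a i = p" using start_imp_pos[OF e] .
  then have "p \<in> jumps \<beta> (down_tuple T) a"
    using down_tuple_jump[OF a, of i] ap by (auto simp: jumps_def intro!: exI[of _ i])
  ultimately show "(a, p) \<in> down_set (down_tuple T)" using a by (simp add: down_set_def)
qed

end

lemma bij_betw_down_set: "bij_betw down_set (downs k \<alpha> \<beta>) (Pow (starts k U))"
  by (rule bij_betw_byWitness[of _ down_tuple])
    (use down_tuple_down_set down_set_down_tuple down_set_starts down_tuple_in_downs in blast)+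

lemma finite_downs_compatible: "finite (downs k \<alpha> \<beta>)"
proof -
  obtain B :: int where B: "\<And>a p. a \<in> {1..k} \<Longrightarrow> p < - B \<Longrightarrow> p \<in> U a"
    "\<And>a p. a \<in> {1..k} \<Longrightarrow> p \<ge> B \<Longrightarrow> p \<notin> U a" using occupied_bounds by blast
  show ?thesis
    using bij_betw_finite[OF bij_betw_down_set] finite_boundary(1)[of k B U] B by simp
qed

lemma sum_downs:
  "(\<Sum>\<nu>\<in>downs k \<alpha> \<beta>. LLT1 k x t \<alpha> \<nu> * dual_LLT1 k y t \<beta> \<nu>)
     = base x y t * (\<Prod>(a, p)\<in>starts k U. 1 + x * y * t ^ colour_rank k U a p)"
proof -
  obtain B :: int where B: "\<And>a p. a \<in> {1..k} \<Longrightarrow> p < - B \<Longrightarrow> p \<in> U a"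
    "\<And>a p. a \<in> {1..k} \<Longrightarrow> p \<ge> B \<Longrightarrow> p \<notin> U a" using occupied_bounds by blast
  have "(\<Sum>\<nu>\<in>downs k \<alpha> \<beta>. \<Prod>(a, p)\<in>down_set \<nu>. x * y * t ^ colour_rank k U a p)
      = (\<Sum>T\<in>Pow (starts k U). \<Prod>(a, p)\<in>T. x * y * t ^ colour_rank k U a p)"
    by (rule sum.reindex_bij_betw[OF bij_betw_down_set])
  also have "\<dots> = (\<Prod>(a, p)\<in>starts k U. 1 + x * y * t ^ colour_rank k U a p)"
    using prod_one_add[where f = "\<lambda>(a, p). x * y * t ^ colour_rank k U a p"] finite_boundary(1)[of k B U] B
    by (simp add: case_prod_unfold)
  finally show ?thesis by (simp only: down_weight sum_distrib_left[symmetric] cong: sum.cong)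
qed

lemma compatible_cauchy:
  "(\<Sum>\<kappa>\<in>ups k \<alpha> \<beta>. LLT1 k x t \<kappa> \<beta> * dual_LLT1 k y t \<kappa> \<alpha>)
     = q_prod (x * y) t k * (\<Sum>\<nu>\<in>downs k \<alpha> \<beta>. LLT1 k x t \<alpha> \<nu> * dual_LLT1 k y t \<beta> \<nu>)"
proof -
  obtain B :: int where B: "\<And>a p. a \<in> {1..k} \<Longrightarrow> p < - B \<Longrightarrow> p \<in> U a"
    "\<And>a p. a \<in> {1..k} \<Longrightarrow> p \<ge> B \<Longrightarrow> p \<notin> U a" using occupied_bounds by blast
  show ?thesis
    unfolding sum_ups sum_downs using q_prod_boundary[of k B U "x * y" t] B by simp
qed

end

text \<open>Any member of either set implies the inequalities of the locale, so for all other pairs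
  both sides of the identity are empty sums.\<close>

lemma compatible_pair_or_empty:
  assumes kt: "\<alpha> \<in> ktuples k" "\<beta> \<in> ktuples k"
  obtains "compatible_pair k \<alpha> \<beta>" | "ups k \<alpha> \<beta> = {}" "downs k \<alpha> \<beta> = {}"
proof (cases "ups k \<alpha> \<beta> = {} \<and> downs k \<alpha> \<beta> = {}")
  case False
  have "compatible_pair k \<alpha> \<beta>"
  proof (unfold_locales, fact kt, fact kt)
    fix a i :: nat assume ai: "a \<in> {1..k}" "i \<ge> 1"
    have "\<beta> a i \<le> \<alpha> a i + 1 \<and> \<alpha> a (i + 1) \<le> \<beta> a i"
    proof (cases "ups k \<alpha> \<beta> = {}")
      case True
      then obtain \<nu> where \<nu>: "\<nu> \<in> ktuples k" "interlaces k \<alpha> \<nu>" "cointerlaces k \<beta> \<nu>"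
        using False by (auto simp: downs_def)
      have "\<nu> a i \<le> \<alpha> a i \<and> \<alpha> a (i + 1) \<le> \<nu> a i" using \<nu>(2) ai by (auto simp: interlaces_def)
      then show ?thesis using cointerlaces_le[OF \<nu>(3) kt(2) \<nu>(1), of a i] by linarith
    next
      case False
      then obtain \<kappa> where \<kappa>: "\<kappa> \<in> ktuples k" "interlaces k \<kappa> \<beta>" "cointerlaces k \<kappa> \<alpha>"
        by (auto simp: ups_def)
      have "\<beta> a i \<le> \<kappa> a i \<and> \<kappa> a (i + 1) \<le> \<beta> a i" using \<kappa>(2) ai by (auto simp: interlaces_def)
      then show ?thesis
        using cointerlaces_le[OF \<kappa>(3) \<kappa>(1) kt(1), of a i]
          cointerlaces_le[OF \<kappa>(3) \<kappa>(1) kt(1), of a "i + 1"] by linarith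
    qed
    then show "\<beta> a i \<le> \<alpha> a i + 1" "\<alpha> a (i + 1) \<le> \<beta> a i" by auto
  qed
  then show ?thesis by (rule that)
qed (use that in blast)

lemma finite_ups: "\<alpha> \<in> ktuples k \<Longrightarrow> \<beta> \<in> ktuples k \<Longrightarrow> finite (ups k \<alpha> \<beta>)"
  by (rule compatible_pair_or_empty[of \<alpha> k \<beta>]) (auto intro: compatible_pair.finite_ups_compatible)

lemma finite_downs: "\<alpha> \<in> ktuples k \<Longrightarrow> \<beta> \<in> ktuples k \<Longrightarrow> finite (downs k \<alpha> \<beta>)"
  by (rule compatible_pair_or_empty[of \<alpha> k \<beta>]) (auto intro: compatible_pair.finite_downs_compatible)

theorem skew_cauchy:
  assumes "\<alpha> \<in> ktuples k" "\<beta> \<in> ktuples k"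
  shows "(\<Sum>\<kappa>\<in>ups k \<alpha> \<beta>. LLT1 k x t \<kappa> \<beta> * dual_LLT1 k y t \<kappa> \<alpha>)
     = q_prod (x * y) t k * (\<Sum>\<nu>\<in>downs k \<alpha> \<beta>. LLT1 k x t \<alpha> \<nu> * dual_LLT1 k y t \<beta> \<nu>)"
  by (rule compatible_pair_or_empty[OF assms]) (rule compatible_pair.compatible_cauchy, assumption, simp)

section \<open>The parallel update\<close>

text \<open>Distributivity for functions fixed to a default value outside \<open>A\<close>, the form
  in which configurations are encoded.\<close>

lemma sum_prod_PiE_dflt:
  fixes f :: "'a \<Rightarrow> 'b \<Rightarrow> 'c :: comm_semiring_1"
  assumes "finite A" "\<And>x. x \<in> A \<Longrightarrow> finite (B x)"
  shows "(\<Sum>g\<in>PiE_dflt A d B. \<Prod>x\<in>A. f x (g x)) = (\<Prod>x\<in>A. \<Sum>y\<in>B x. f x y)"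
proof -
  have inj: "inj_on (\<lambda>h. restrict h A) (PiE_dflt A d B)"
    by (force simp: inj_on_def restrict_def fun_eq_iff PiE_dflt_def)
  have "(\<Prod>x\<in>A. \<Sum>y\<in>B x. f x y) = (\<Sum>g\<in>PiE A B. \<Prod>x\<in>A. f x (g x))"
    by (rule prod_sum_PiE) (use assms in auto)
  also have "\<dots> = (\<Sum>g\<in>PiE_dflt A d B. \<Prod>x\<in>A. f x (g x))"
    unfolding restrict_PiE_dflt[of A d B, symmetric] sum.reindex[OF inj]
    by (auto intro!: sum.cong prod.cong)
  finally show ?thesis by simp
qed

text \<open>Both total masses are 1, so C = 1 without comparing partition functions. A point of
  positive mass shows that C is nonnegative, which allows it to leave the \<open>ennreal\<close>
  integral.\<close>

lemma pmf_proportional_eq: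
  assumes "\<And>x. pmf p x = C * pmf q x"
  shows "p = q"
proof (rule pmf_eqI)
  obtain x0 where "x0 \<in> set_pmf q" using set_pmf_not_empty[of q] by blast
  then have "pmf q x0 > 0" by (simp add: pmf_positive)
  moreover have "C * pmf q x0 \<ge> 0" using assms[of x0] pmf_nonneg[of p x0] by simp
  ultimately have C: "C \<ge> 0" by (simp add: zero_le_mult_iff)
  have "1 = (\<integral>\<^sup>+x. ennreal (pmf p x) \<partial>count_space UNIV)"
    by (simp add: nn_integral_pmf measure_pmf.emeasure_space_1[simplified])
  also have "\<dots> = (\<integral>\<^sup>+x. ennreal C * ennreal (pmf q x) \<partial>count_space UNIV)"
    using C by (simp add: assms ennreal_mult)
  also have "\<dots> = ennreal C"
    by (simp add: nn_integral_cmult nn_integral_pmf measure_pmf.emeasure_space_1[simplified])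
  finally have "C = 1" using C by simp
  then show "pmf p x = pmf q x" for x using assms by simp
qed

lemma LLT1_empty [simp]: "LLT k (Suc 0) (\<lambda>_. x) t empty_tuple empty_tuple = 1"
proof -
  have "enters empty_tuple empty_tuple a = {}" for a by (auto simp: enters_def)
  moreover have "interlaces k empty_tuple empty_tuple" by (simp add: interlaces_def empty_tuple_def)
  ultimately show ?thesis by (subst LLT1_eq[unfolded One_nat_def]) auto
qed

lemma dual_LLT1_empty [simp]: "dual_LLT1 k y t empty_tuple empty_tuple = 1"
proof -
  have "jumps empty_tuple empty_tuple a = {}" for a by (auto simp: jumps_def)
  moreover have "cointerlaces k empty_tuple empty_tuple" by (simp add: cointerlaces_def empty_tuple_def)
  ultimately show ?thesis by (subst dual_LLT1_eq) auto
qed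

lemma infsum_ups:
  assumes "\<alpha> \<in> ktuples k" "\<beta> \<in> ktuples k"
  shows "(\<Sum>\<^sub>\<infinity>\<kappa>\<in>ktuples k. LLT1 k x t \<kappa> \<beta> * dual_LLT1 k y t \<kappa> \<alpha>)
    = (\<Sum>\<kappa>\<in>ups k \<alpha> \<beta>. LLT1 k x t \<kappa> \<beta> * dual_LLT1 k y t \<kappa> \<alpha>)"
proof -
  have "(\<Sum>\<^sub>\<infinity>\<kappa>\<in>ktuples k. LLT1 k x t \<kappa> \<beta> * dual_LLT1 k y t \<kappa> \<alpha>)
      = (\<Sum>\<^sub>\<infinity>\<kappa>\<in>ups k \<alpha> \<beta>. LLT1 k x t \<kappa> \<beta> * dual_LLT1 k y t \<kappa> \<alpha>)"
  proof (rule infsum_cong_neutral)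
    fix \<kappa> assume \<kappa>: "\<kappa> \<in> ktuples k - ups k \<alpha> \<beta>"
    show "LLT1 k x t \<kappa> \<beta> * dual_LLT1 k y t \<kappa> \<alpha> = 0"
    proof (rule ccontr)
      assume "LLT1 k x t \<kappa> \<beta> * dual_LLT1 k y t \<kappa> \<alpha> \<noteq> 0"
      then have "interlaces k \<kappa> \<beta>" "cointerlaces k \<kappa> \<alpha>"
        using LLT1_nonzero_interlaces[of k x t \<kappa> \<beta>] dual_LLT1_nonzero_cointerlaces[of k y t \<kappa> \<alpha>]
          assms(2) \<kappa> by (metis DiffD1 mult_eq_0_iff)+
      then show False using \<kappa> by (simp add: ups_def)
    qed
  qed (auto simp: ups_def)
  then show ?thesis using finite_ups[OF assms] by simp
qed

text \<open>The factor \<open>LLT k n c t \<kappa> empty_tuple\<close> is a numerator in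
  \<open>p_up\<close> and a denominator in \<open>p_down\<close>. Apart from the two one-variable
  weights, what remains is the constant \<open>K\<close>, which normalisation removes.\<close>

lemma update_prob_eq:
  assumes c: "\<And>i. i \<in> {1..n} \<Longrightarrow> c i > 0" and n: "n \<ge> 1" and b: "b (N + 2 - n) > 0" and t: "t > 0"
    and kt: "\<alpha> \<in> ktuples k" "\<mu>' \<in> ktuples k" "\<alpha>' \<in> ktuples k"
    and rows: "\<And>a i. i > n \<Longrightarrow> \<alpha> a i = 0" "\<And>a i. i > n - 1 \<Longrightarrow> \<mu>' a i = 0"
  defines "y \<equiv> b (N + 2 - n)"
  shows "update_prob k N c b t n \<alpha> \<mu>' \<alpha>' = LLT1 k (c n) t \<alpha>' \<mu>' * dual_LLT1 k y t \<alpha>' \<alpha>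
    / (\<Sum>\<kappa>\<in>ups k \<alpha> \<mu>'. LLT1 k (c n) t \<kappa> \<mu>' * dual_LLT1 k y t \<kappa> \<alpha>)"
proof -
  define K where "K = 1 / (\<Prod>i\<in>{1..n}. \<Prod>l<k. 1 + c i * y * t ^ l)
    * (LLT k (n - 1) c t \<mu>' empty_tuple / LLT k n c t \<alpha> empty_tuple)"
  have P: "(\<Prod>i\<in>{1..n}. \<Prod>l<k. 1 + c i * y * t ^ l) > 0"
    using c b t by (intro prod_pos ballI add_pos_pos mult_pos_pos) (auto simp: y_def)
  have c': "c i > 0" if "i \<in> {1..n - 1}" for i using c[of i] that by auto
  have K: "K \<noteq> 0"
  proof -
    have "LLT k (n - 1) c t \<mu>' empty_tuple > 0"
      by (rule LLT_empty_pos) (use c' t kt(2) rows(2) in auto)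
    moreover have "LLT k n c t \<alpha> empty_tuple > 0"
      by (rule LLT_empty_pos) (use c t kt(1) rows(1) in auto)
    ultimately have "K > 0" unfolding K_def using P by (intro mult_pos_pos divide_pos_pos) auto
    then show ?thesis by simp
  qed
  have pp: "p_up k t n c y \<alpha> \<kappa> * p_down k t n c \<kappa> \<mu>' = K * (LLT1 k (c n) t \<kappa> \<mu>' * dual_LLT1 k y t \<kappa> \<alpha>)"
    if \<kappa>: "\<kappa> \<in> ktuples k" for \<kappa>
  proof (cases "LLT1 k (c n) t \<kappa> \<mu>' = 0")
    case False
    then have il: "interlaces k \<kappa> \<mu>'" using LLT1_nonzero_interlaces \<kappa> kt(2) by blast
    \<comment> \<open>Cancelling requires a nonzero factor: \<kappa> interlaces with
      \<open>\<mu>'\<close>, which has at most n - 1 rows, so \<kappa> has at most n rows and can be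
      filled with n letters.\<close>
    have "LLT k n c t \<kappa> empty_tuple > 0"
    proof (rule LLT_empty_pos)
      show "\<kappa> a i = 0" if "i > n" for a i
        by (rule interlaces_rows[where n = "n - 1", OF il \<kappa>]) (use rows(2) that n in auto)
    qed (use c t \<kappa> in auto)
    then show ?thesis by (simp add: p_up_def p_down_def K_def)
  qed (simp add: p_down_def)
  have "(\<Sum>\<^sub>\<infinity>\<kappa>\<in>ktuples k. p_up k t n c y \<alpha> \<kappa> * p_down k t n c \<kappa> \<mu>')
      = (\<Sum>\<^sub>\<infinity>\<kappa>\<in>ktuples k. K * (LLT1 k (c n) t \<kappa> \<mu>' * dual_LLT1 k y t \<kappa> \<alpha>))"
    by (rule infsum_cong) (rule pp)
  also have "\<dots> = K * (\<Sum>\<kappa>\<in>ups k \<alpha> \<mu>'. LLT1 k (c n) t \<kappa> \<mu>' * dual_LLT1 k y t \<kappa> \<alpha>)"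
    unfolding infsum_ups[OF kt(1,2), symmetric] by (rule infsum_cmult_right')
  finally show ?thesis unfolding update_prob_def y_def[symmetric] pp[OF kt(3)] using K by simp
qed

lemma new_mu_ktuple: "(\<And>n. \<Lambda> n \<in> ktuples k) \<Longrightarrow> new_mu N \<Lambda> n \<in> ktuples k"
  by (simp add: new_mu_def)

text \<open>The dual factor joining \<open>\<Lambda> i\<close> to \<open>M (i + 1)\<close> is filed
  under n = i + 1, so each \<open>M n\<close> occurs in factor n only, and
  \<open>b (N + 1 - i)\<close> becomes \<open>b (N + 2 - n)\<close>. The extra factors at n = 1 and
  n = N + 1 compare empty tuples and equal 1.\<close>

lemma process_weight_eq_prod:
  assumes "(\<Lambda>, M) \<in> configs k N"
  shows "process_weight k N c b t (\<Lambda>, M)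
    = (\<Prod>n\<in>{1..N + 1}. LLT1 k (c n) t (\<Lambda> n) (M n) * dual_LLT1 k (b (N + 2 - n)) t (new_mu N \<Lambda> n) (M n))"
proof -
  have L: "\<Lambda> (N + 1) = empty_tuple" and M: "M (N + 1) = empty_tuple" "M 1 = empty_tuple"
    using assms unfolding configs_def by auto
  have "(\<Prod>n\<in>{1..N + 1}. dual_LLT1 k (b (N + 2 - n)) t (new_mu N \<Lambda> n) (M n))
      = dual_LLT1 k (b (N + 1)) t (new_mu N \<Lambda> 1) (M 1)
        * (\<Prod>n\<in>{1..N}. dual_LLT1 k (b (N + 1 - n)) t (new_mu N \<Lambda> (n + 1)) (M (n + 1)))"
  proof -
    have "{1..N + 1} = insert 1 {1 + 1..N + 1}" by auto
    then have "(\<Prod>n\<in>{1..N + 1}. dual_LLT1 k (b (N + 2 - n)) t (new_mu N \<Lambda> n) (M n))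
      = dual_LLT1 k (b (N + 2 - 1)) t (new_mu N \<Lambda> 1) (M 1)
        * (\<Prod>n\<in>{1 + 1..N + 1}. dual_LLT1 k (b (N + 2 - n)) t (new_mu N \<Lambda> n) (M n))" by simp
    then show ?thesis unfolding prod.shift_bounds_cl_nat_ivl by simp
  qed
  also have "\<dots> = (\<Prod>n\<in>{1..N}. dual_LLT1 k (b (N + 1 - n)) t (\<Lambda> n) (M (n + 1)))"
    using M by (auto simp: new_mu_def intro!: prod.cong)
  finally have d: "(\<Prod>n\<in>{1..N + 1}. dual_LLT1 k (b (N + 2 - n)) t (new_mu N \<Lambda> n) (M n)) = \<dots>" .
  have "(\<Prod>n\<in>{1..N + 1}. LLT1 k (c n) t (\<Lambda> n) (M n)) = (\<Prod>n\<in>{1..N}. LLT1 k (c n) t (\<Lambda> n) (M n))"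
    using L M by simp
  with d show ?thesis by (simp only: process_weight_def prod.case prod.distrib)
qed

section \<open>The law of the updated configuration\<close>

context
  fixes k N :: nat and c b :: "nat \<Rightarrow> real" and t :: real
  assumes c: "\<And>i. i \<in> {1..N + 1} \<Longrightarrow> c i > 0"
    and b: "\<And>i. i \<in> {1..N + 1} \<Longrightarrow> b i > 0"
    and t: "t > 0"
begin

definition update_num :: "(nat \<Rightarrow> ktuple) \<Rightarrow> (nat \<Rightarrow> ktuple) \<Rightarrow> nat \<Rightarrow> real" where
  "update_num \<Lambda> \<Lambda>' n = LLT1 k (c n) t (\<Lambda>' n) (new_mu N \<Lambda> n) * dual_LLT1 k (b (N + 2 - n)) t (\<Lambda>' n) (\<Lambda> n)"

definition update_den :: "(nat \<Rightarrow> ktuple) \<Rightarrow> nat \<Rightarrow> real" where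
  "update_den \<Lambda> n = (\<Sum>\<kappa>\<in>ups k (\<Lambda> n) (new_mu N \<Lambda> n).
     LLT1 k (c n) t \<kappa> (new_mu N \<Lambda> n) * dual_LLT1 k (b (N + 2 - n)) t \<kappa> (\<Lambda> n))"

lemma set_pmf_process:
  "\<omega> \<in> set_pmf (LLT_process k N c b t) \<Longrightarrow> \<omega> \<in> configs k N \<and> process_weight k N c b t \<omega> \<noteq> 0"
  unfolding set_pmf_iff by (subst (asm) pmf_LLT_process) (use c b t in \<open>auto split: if_splits\<close>)

text \<open>Restricted to the support of the process, where the function under
  \<open>embed_pmf\<close> is known to be normalised.\<close>

lemma pmf_update_eq:
  assumes \<omega>: "(\<Lambda>, M) \<in> set_pmf (LLT_process k N c b t)" and n: "n \<in> {1..N + 1}"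
    and \<Lambda>': "\<Lambda>' n \<in> ktuples k"
  shows "pmf (update_pmf k N c b t n (\<Lambda> n) (new_mu N \<Lambda> n)) (\<Lambda>' n)
       = update_num \<Lambda> \<Lambda>' n / update_den \<Lambda> n"
proof -
  have cfg: "(\<Lambda>, M) \<in> configs k N" and w: "process_weight k N c b t (\<Lambda>, M) \<noteq> 0"
    using set_pmf_process[OF \<omega>] by auto
  have kt: "\<Lambda> n \<in> ktuples k" for n using cfg by (auto simp: configs_def)
  have "N + 2 - n \<in> {1..N + 1}" using n by auto
  then have bn: "b (N + 2 - n) > 0" by (rule b)
  have cn: "c i > 0" if "i \<in> {1..n}" for i using that n by (intro c) auto
  have rows: "\<Lambda> n a i = 0" if "i > n" for a i using process_rows(1)[OF cfg w] that by blast
  have rows': "new_mu N \<Lambda> n a i = 0" if "i > n - 1" for a i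
    using process_rows(1)[OF cfg w, of "n - 1" i a] that by (simp add: new_mu_def empty_tuple_def)
  have "update_prob k N c b t n (\<Lambda> n) (new_mu N \<Lambda> n) (\<Lambda>' n) = update_num \<Lambda> \<Lambda>' n / update_den \<Lambda> n"
    unfolding update_num_def update_den_def
    by (rule update_prob_eq) (use n bn cn t kt \<Lambda>' rows rows' new_mu_ktuple[of \<Lambda>] in auto)
  then show ?thesis
    using pmf_update_pmf[OF c b t n \<omega>] \<Lambda>' by simp
qed

lemma pmf_parallel_update_eq:
  assumes \<omega>: "(\<Lambda>, M) \<in> set_pmf (LLT_process k N c b t)"
    and cfg: "(\<Lambda>', new_mu N \<Lambda>) \<in> configs k (N + 1)"
  shows "pmf (parallel_update k N c b t (\<Lambda>, M)) (\<Lambda>', new_mu N \<Lambda>)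
       = (\<Prod>n\<in>{1..N + 1}. update_num \<Lambda> \<Lambda>' n / update_den \<Lambda> n)"
proof -
  have "inj (\<lambda>\<Lambda>'. (\<Lambda>', new_mu N \<Lambda>))" by (simp add: inj_on_def)
  then have "pmf (map_pmf (\<lambda>\<Lambda>'. (\<Lambda>', new_mu N \<Lambda>)) Q) (\<Lambda>', new_mu N \<Lambda>) = pmf Q \<Lambda>'" for Q
    by (rule pmf_map_inj')
  moreover have "\<Lambda>' n \<in> ktuples k" "n \<notin> {1..N + 1} \<Longrightarrow> \<Lambda>' n = empty_tuple" for n
    using cfg unfolding configs_def by blast+
  moreover have "pmf (Pi_pmf {1..N + 1} empty_tuple
      (\<lambda>n. update_pmf k N c b t n (\<Lambda> n) (new_mu N \<Lambda> n))) \<Lambda>'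
    = (\<Prod>n\<in>{1..N + 1}. update_num \<Lambda> \<Lambda>' n / update_den \<Lambda> n)"
    using calculation(2,3)
    by (subst pmf_Pi') (auto intro!: prod.cong pmf_update_eq[OF \<omega>] simp del: prod.cl_ivl_Suc)
  ultimately show ?thesis
    unfolding parallel_update_def prod.case by simp
qed

lemma set_pmf_update:
  assumes "(\<Lambda>', M') \<in> set_pmf (bind_pmf (LLT_process k N c b t) (parallel_update k N c b t))"
  shows "(\<Lambda>', M') \<in> configs k (N + 1)"
proof -
  obtain \<Lambda> M where \<omega>: "(\<Lambda>, M) \<in> set_pmf (LLT_process k N c b t)"
    and "(\<Lambda>', M') \<in> set_pmf (parallel_update k N c b t (\<Lambda>, M))"
    using assms by auto
  then have M': "M' = new_mu N \<Lambda>"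
    and \<Lambda>': "\<Lambda>' \<in> PiE_dflt {1..N + 1} empty_tuple (\<lambda>n. set_pmf (update_pmf k N c b t n (\<Lambda> n) (new_mu N \<Lambda> n)))"
    by (auto simp: parallel_update_def set_Pi_pmf comp_def)
  have kt: "\<Lambda> n \<in> ktuples k" for n using set_pmf_process[OF \<omega>] by (auto simp: configs_def)
  have "\<Lambda>' n \<in> ktuples k" if "n \<in> {1..N + 1}" for n
  proof -
    have "\<Lambda>' n \<in> set_pmf (update_pmf k N c b t n (\<Lambda> n) (new_mu N \<Lambda> n))"
      using \<Lambda>' that by (simp add: PiE_dflt_def)
    then show ?thesis
      unfolding set_pmf_iff using pmf_update_pmf[OF c b t that \<omega>, of "\<Lambda>' n"] by (auto split: if_splits)
  qed
  moreover have "\<Lambda>' n = empty_tuple" if "n \<notin> {1..N + 1}" for n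
    using \<Lambda>' that by (auto simp: PiE_dflt_def)
  ultimately have "\<Lambda>' n \<in> ktuples k" "n \<notin> {1..N + 1} \<Longrightarrow> \<Lambda>' n = empty_tuple" for n
    using empty_tuple_ktuple by metis+
  moreover have "M' n = empty_tuple" if "n \<notin> {2..N + 1}" for n using that unfolding M' new_mu_def by (rule if_not_P)
  moreover have "M' n \<in> ktuples k" for n unfolding M' by (intro new_mu_ktuple kt)
  ultimately show ?thesis unfolding configs_def by blast
qed

lemma sum_process_weight:
  assumes \<Lambda>: "\<And>n. \<Lambda> n \<in> ktuples k" "\<And>n. n \<notin> {1..N} \<Longrightarrow> \<Lambda> n = empty_tuple"
  defines "Ms \<equiv> PiE_dflt {1..N + 1} empty_tuple (\<lambda>n. downs k (\<Lambda> n) (new_mu N \<Lambda> n))"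
  shows "\<And>M. M \<in> Ms \<Longrightarrow> (\<Lambda>, M) \<in> configs k N"
    and "(\<Prod>n\<in>{1..N + 1}. q_prod (c n * b (N + 2 - n)) t k) * (\<Sum>M\<in>Ms. process_weight k N c b t (\<Lambda>, M))
       = (\<Prod>n\<in>{1..N + 1}. update_den \<Lambda> n)"
proof -
  have kt: "new_mu N \<Lambda> n \<in> ktuples k" for n by (intro new_mu_ktuple \<Lambda>)
  show cfg: "(\<Lambda>, M) \<in> configs k N" if M: "M \<in> Ms" for M
  proof -
    have d: "M n \<in> downs k (\<Lambda> n) (new_mu N \<Lambda> n)" if "n \<in> {1..N + 1}" for n
      using M that by (simp add: Ms_def PiE_dflt_def)
    have o: "M n = empty_tuple" if "n \<notin> {1..N + 1}" for n
      using M that by (auto simp: Ms_def PiE_dflt_def)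
    have Mk: "M n \<in> ktuples k" for n
      using d[of n] o[of n] by (cases "n \<in> {1..N + 1}") (auto simp: downs_def)
    \<comment> \<open>The end conditions on \<open>M\<close> are automatic: a member of
      \<open>downs\<close> is contained in both of its neighbours, and
      \<open>new_mu N \<Lambda> 1\<close> and \<open>\<Lambda> (N + 1)\<close> are empty.\<close>
    have "M n = empty_tuple" if n: "n \<notin> {2..N}" for n
    proof (cases "n \<in> {1..N + 1}")
      case True
      then consider "n = 1" | "n = N + 1" using n by force
      then have "M n a i = 0" for a i
      proof cases
        case 1
        then have "new_mu N \<Lambda> n = empty_tuple" by (simp add: new_mu_def)
        then have "cointerlaces k empty_tuple (M n)" using d[OF True] by (simp add: downs_def)
        from cointerlaces_le(1)[OF this empty_tuple_ktuple Mk, of a i] show ?thesis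
          by (simp add: empty_tuple_def)
      next
        case 2
        then have "\<Lambda> n = empty_tuple" by (intro \<Lambda>(2)) auto
        then have "interlaces k empty_tuple (M n)" using d[OF True] by (simp add: downs_def)
        from interlaces_le[OF this empty_tuple_ktuple Mk, of a i] show ?thesis
          by (simp add: empty_tuple_def)
      qed
      then show ?thesis by (intro ext) (simp add: empty_tuple_def)
    qed (rule o)
    then show ?thesis using \<Lambda> Mk unfolding configs_def by blast
  qed
  have "(\<Sum>M\<in>Ms. process_weight k N c b t (\<Lambda>, M))
      = (\<Sum>M\<in>Ms. \<Prod>n\<in>{1..N + 1}. LLT1 k (c n) t (\<Lambda> n) (M n)
          * dual_LLT1 k (b (N + 2 - n)) t (new_mu N \<Lambda> n) (M n))"
    by (intro sum.cong refl process_weight_eq_prod cfg)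
  also have "\<dots> = (\<Prod>n\<in>{1..N + 1}. \<Sum>\<nu>\<in>downs k (\<Lambda> n) (new_mu N \<Lambda> n).
      LLT1 k (c n) t (\<Lambda> n) \<nu> * dual_LLT1 k (b (N + 2 - n)) t (new_mu N \<Lambda> n) \<nu>)"
    unfolding Ms_def by (rule sum_prod_PiE_dflt) (auto intro!: finite_downs \<Lambda> kt)
  finally show "(\<Prod>n\<in>{1..N + 1}. q_prod (c n * b (N + 2 - n)) t k)
      * (\<Sum>M\<in>Ms. process_weight k N c b t (\<Lambda>, M)) = (\<Prod>n\<in>{1..N + 1}. update_den \<Lambda> n)"
    by (simp only: update_den_def skew_cauchy[OF \<Lambda>(1) kt] prod.distrib)
qed

text \<open>Lets \<open>update_den\<close> cancel even where it vanishes: a zero sum of nonnegative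
  terms has only zero terms, and \<open>update_num\<close> is one of them or is zero anyway.\<close>

lemma update_num_zero:
  assumes "\<And>n. \<Lambda> n \<in> ktuples k" "\<Lambda>' n \<in> ktuples k" "n \<in> {1..N + 1}" "update_den \<Lambda> n = 0"
  shows "update_num \<Lambda> \<Lambda>' n = 0"
proof (rule ccontr)
  assume nz: "update_num \<Lambda> \<Lambda>' n \<noteq> 0"
  have kt: "new_mu N \<Lambda> n \<in> ktuples k" by (intro new_mu_ktuple assms)
  have "c n > 0" using assms(3) by (rule c)
  moreover have "N + 2 - n \<in> {1..N + 1}" using assms(3) by auto
  then have "b (N + 2 - n) > 0" by (rule b)
  ultimately have nn: "LLT1 k (c n) t \<kappa> (new_mu N \<Lambda> n) * dual_LLT1 k (b (N + 2 - n)) t \<kappa> (\<Lambda> n) \<ge> 0" for \<kappa>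
    using t by (intro mult_nonneg_nonneg LLT_nonneg dual_LLT1_nonneg) auto
  have "LLT1 k (c n) t (\<Lambda>' n) (new_mu N \<Lambda> n) \<noteq> 0" "dual_LLT1 k (b (N + 2 - n)) t (\<Lambda>' n) (\<Lambda> n) \<noteq> 0"
    using nz by (auto simp: update_num_def)
  then have "\<Lambda>' n \<in> ups k (\<Lambda> n) (new_mu N \<Lambda> n)"
    using assms(2) kt by (auto simp: ups_def intro: LLT1_nonzero_interlaces dual_LLT1_nonzero_cointerlaces)
  then have "update_num \<Lambda> \<Lambda>' n = 0"
    using assms(4) finite_ups[OF assms(1) kt] nn
    unfolding update_den_def update_num_def by (simp add: sum_nonneg_eq_0_iff)
  with nz show False ..
qed

lemma pmf_bind_update_eq:
  assumes cfg: "(\<Lambda>', M') \<in> configs k (N + 1)"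
  shows "pmf (bind_pmf (LLT_process k N c b t) (parallel_update k N c b t)) (\<Lambda>', M')
    = process_weight k (N + 1) c b t (\<Lambda>', M')
      / (partition_function k N c b t * (\<Prod>n\<in>{1..N + 1}. q_prod (c n * b (N + 2 - n)) t k))"
proof -
  let ?P = "LLT_process k N c b t" and ?K = "parallel_update k N c b t"
  let ?Z = "partition_function k N c b t"
  let ?q = "\<Prod>n\<in>{1..N + 1}. q_prod (c n * b (N + 2 - n)) t k"
  \<comment> \<open>Undoes the shift in \<open>new_mu\<close>: this is the only
    \<open>\<Lambda>\<close> from which \<open>M'\<close> can arise.\<close>
  define \<Lambda> where "\<Lambda> = (\<lambda>n. if n \<in> {1..N} then M' (n + 1) else empty_tuple)"
  define Ms where "Ms = PiE_dflt {1..N + 1} empty_tuple (\<lambda>n. downs k (\<Lambda> n) (new_mu N \<Lambda> n))"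
  have \<Lambda>': "\<Lambda>' n \<in> ktuples k" for n using cfg unfolding configs_def by blast
  have M'k: "M' n \<in> ktuples k" and M'0: "n \<notin> {2..N + 1} \<Longrightarrow> M' n = empty_tuple" for n
    using cfg unfolding configs_def by blast+
  have \<Lambda>k: "\<Lambda> n \<in> ktuples k" and \<Lambda>0: "n \<notin> {1..N} \<Longrightarrow> \<Lambda> n = empty_tuple" for n
    using M'k by (auto simp: \<Lambda>_def)
  have M': "M' = new_mu N \<Lambda>"
  proof
    fix n show "M' n = new_mu N \<Lambda> n"
      using M'0[of n] by (cases "n \<in> {2..N + 1}") (auto simp: new_mu_def \<Lambda>_def)
  qed
  have \<Lambda>_unique: "\<Lambda>0 = \<Lambda>" if "(\<Lambda>0, M0) \<in> configs k N" "M' = new_mu N \<Lambda>0" for \<Lambda>0 M0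
  proof
    fix n
    have "n \<notin> {1..N} \<Longrightarrow> \<Lambda>0 n = empty_tuple" using that(1) unfolding configs_def by blast
    then show "\<Lambda>0 n = \<Lambda> n" using that(2) by (cases "n \<in> {1..N}") (auto simp: new_mu_def \<Lambda>_def)
  qed
  have S1: "(\<Lambda>, M) \<in> configs k N" if "M \<in> Ms" for M
    by (rule sum_process_weight(1)[of \<Lambda>]) (use \<Lambda>k \<Lambda>0 that in \<open>auto simp: Ms_def\<close>)
  have S2: "(\<Sum>M\<in>Ms. process_weight k N c b t (\<Lambda>, M)) * ?q = (\<Prod>n\<in>{1..N + 1}. update_den \<Lambda> n)"
    unfolding Ms_def by (subst mult.commute, rule sum_process_weight(2)[of \<Lambda>]) (use \<Lambda>k \<Lambda>0 in auto)
  have kt: "new_mu N \<Lambda> n \<in> ktuples k" for n by (intro new_mu_ktuple \<Lambda>k)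
  have fin: "finite Ms" unfolding Ms_def by (intro finite_PiE_dflt finite_downs \<Lambda>k kt) auto
  have "pmf (bind_pmf ?P ?K) (\<Lambda>', M') = (\<integral>\<omega>. pmf (?K \<omega>) (\<Lambda>', M') \<partial>measure_pmf ?P)"
    by (rule pmf_bind)
  also have "\<dots> = (\<Sum>\<omega>\<in>(\<lambda>M. (\<Lambda>, M)) ` Ms. pmf (?K \<omega>) (\<Lambda>', M') * pmf ?P \<omega>)"
  proof (rule integral_measure_pmf_real)
    fix \<omega> assume \<omega>: "\<omega> \<in> set_pmf ?P" and "pmf (?K \<omega>) (\<Lambda>', M') \<noteq> 0"
    then have "(\<Lambda>', M') \<in> set_pmf (?K \<omega>)" by (simp add: set_pmf_iff)
    moreover obtain \<Lambda>0 M where \<omega>': "\<omega> = (\<Lambda>0, M)" by (cases \<omega>)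
    ultimately have "M' = new_mu N \<Lambda>0" by (auto simp: parallel_update_def)
    moreover have cfg: "(\<Lambda>0, M) \<in> configs k N" and w: "process_weight k N c b t (\<Lambda>0, M) \<noteq> 0"
      using set_pmf_process \<omega> \<omega>' by auto
    ultimately have [simp]: "\<Lambda>0 = \<Lambda>" using \<Lambda>_unique by blast
    have Mk: "M n \<in> ktuples k" and M0: "n \<notin> {2..N} \<Longrightarrow> M n = empty_tuple" for n
      using cfg unfolding configs_def by blast+
    have "M n \<in> downs k (\<Lambda> n) (new_mu N \<Lambda> n)" if n: "n \<in> {1..N + 1}" for n
    proof -
      have "LLT1 k (c n) t (\<Lambda> n) (M n) * dual_LLT1 k (b (N + 2 - n)) t (new_mu N \<Lambda> n) (M n) \<noteq> 0"
        using w process_weight_eq_prod[OF cfg, of c b t] n by (simp del: prod.cl_ivl_Suc)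
      then show ?thesis
        using Mk \<Lambda>k by (auto simp: downs_def intro: LLT1_nonzero_interlaces dual_LLT1_nonzero_cointerlaces)
    qed
    then have "M \<in> Ms" using M0 by (auto simp: Ms_def PiE_dflt_def)
    then show "\<omega> \<in> (\<lambda>M. (\<Lambda>, M)) ` Ms" by (simp add: \<omega>')
  qed (use fin in auto)
  also have "\<dots> = (\<Sum>M\<in>Ms. pmf (?K (\<Lambda>, M)) (\<Lambda>', M') * pmf ?P (\<Lambda>, M))"
    by (subst sum.reindex) (auto simp: inj_on_def)
  also have "\<dots> = (\<Sum>M\<in>Ms. (\<Prod>n\<in>{1..N + 1}. update_num \<Lambda> \<Lambda>' n / update_den \<Lambda> n)
      * (process_weight k N c b t (\<Lambda>, M) / ?Z))"
  proof (rule sum.cong)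
    fix M assume M: "M \<in> Ms"
    have P: "pmf ?P (\<Lambda>, M) = process_weight k N c b t (\<Lambda>, M) / ?Z"
      using S1[OF M] by (subst pmf_LLT_process) (use c b t in auto)
    show "pmf (?K (\<Lambda>, M)) (\<Lambda>', M') * pmf ?P (\<Lambda>, M)
        = (\<Prod>n\<in>{1..N + 1}. update_num \<Lambda> \<Lambda>' n / update_den \<Lambda> n) * (process_weight k N c b t (\<Lambda>, M) / ?Z)"
    \<comment> \<open>The kernel formula is available on the support only; off it the mass from the
      process makes both sides 0.\<close>
    proof (cases "pmf ?P (\<Lambda>, M) = 0")
      case False
      then have "(\<Lambda>, M) \<in> set_pmf ?P" by (simp add: set_pmf_iff)
      then have "pmf (?K (\<Lambda>, M)) (\<Lambda>', M') = (\<Prod>n\<in>{1..N + 1}. update_num \<Lambda> \<Lambda>' n / update_den \<Lambda> n)"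
        using pmf_parallel_update_eq[of \<Lambda> M \<Lambda>'] cfg unfolding M' by blast
      then show ?thesis by (simp only: P)
    qed (simp only: P mult_zero_right)
  qed simp
  also have "\<dots> = (\<Prod>n\<in>{1..N + 1}. update_num \<Lambda> \<Lambda>' n / update_den \<Lambda> n)
      * (\<Sum>M\<in>Ms. process_weight k N c b t (\<Lambda>, M)) / ?Z"
    by (simp only: sum_distrib_left sum_divide_distrib times_divide_eq_right)
  also have "(\<Sum>M\<in>Ms. process_weight k N c b t (\<Lambda>, M)) = (\<Prod>n\<in>{1..N + 1}. update_den \<Lambda> n) / ?q"
  proof -
    have "q_prod (c n * b (N + 2 - n)) t k > 0" if "n \<in> {1..N + 1}" for n
    proof -
      have "N + 2 - n \<in> {1..N + 1}" using that by auto
      then show ?thesis using c[OF that] b t by (intro q_prod_pos mult_pos_pos)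
    qed
    then have "?q > 0" by (intro prod_pos ballI)
    then have "?q \<noteq> 0" by (rule less_imp_neq[symmetric])
    then show ?thesis using S2 by (rule eq_divide_imp)
  qed
  also have "(\<Prod>n\<in>{1..N + 1}. update_num \<Lambda> \<Lambda>' n / update_den \<Lambda> n) * ((\<Prod>n\<in>{1..N + 1}. update_den \<Lambda> n) / ?q) / ?Z
      = (\<Prod>n\<in>{1..N + 1}. update_num \<Lambda> \<Lambda>' n) / (?Z * ?q)"
  proof -
    have "(\<Prod>n\<in>{1..N + 1}. update_num \<Lambda> \<Lambda>' n / update_den \<Lambda> n) * (\<Prod>n\<in>{1..N + 1}. update_den \<Lambda> n)
        = (\<Prod>n\<in>{1..N + 1}. update_num \<Lambda> \<Lambda>' n)"
      unfolding prod.distrib[symmetric]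
      by (rule prod.cong) (use update_num_zero[OF \<Lambda>k \<Lambda>'] in auto)
    moreover have "u * (v / w) / z = u * v / (z * w)" for u v w z :: real by (simp add: mult.commute)
    ultimately show ?thesis by (simp only:)
  qed
  also have "(\<Prod>n\<in>{1..N + 1}. update_num \<Lambda> \<Lambda>' n) = process_weight k (N + 1) c b t (\<Lambda>', M')"
    unfolding process_weight_def prod.case
  proof (rule prod.cong)
    fix n assume n: "n \<in> {1..N + 1}"
    \<comment> \<open>At n = N + 1 both sides are the empty tuple, which closes the new process at
      its right end.\<close>
    have "M' (n + 1) = \<Lambda> n" using n M'0[of "n + 1"] by (auto simp: \<Lambda>_def)
    then show "update_num \<Lambda> \<Lambda>' n = LLT1 k (c n) t (\<Lambda>' n) (M' n)
        * dual_LLT1 k (b (N + 1 + 1 - n)) t (\<Lambda>' n) (M' (n + 1))"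
      by (simp add: update_num_def M')
  qed simp
  finally show ?thesis .
qed

end

theorem proposition3p8:
  fixes k N :: nat and c b :: "nat \<Rightarrow> real" and t :: real
  assumes "k \<ge> 1" and "N \<ge> 1"
    and "\<And>i. i \<in> {1..N + 1} \<Longrightarrow> c i > 0"
    and "\<And>i. i \<in> {1..N + 1} \<Longrightarrow> b i > 0"
    and "t > 0"
  shows "bind_pmf (LLT_process k N c b t) (parallel_update k N c b t)
         = LLT_process k (N + 1) c b t"
proof (rule pmf_proportional_eq)
  let ?q = "\<Prod>n\<in>{1..N + 1}. q_prod (c n * b (N + 2 - n)) t k"
  let ?Z = "partition_function k N c b t" and ?Z' = "partition_function k (N + 1) c b t"
  fix \<omega>
  have R: "pmf (LLT_process k (N + 1) c b t) \<omega>
      = (if \<omega> \<in> configs k (N + 1) then process_weight k (N + 1) c b t \<omega> / ?Z' else 0)" for \<omega>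
    by (rule pmf_LLT_process) (use assms in auto)
  \<comment> \<open>\<open>?Z'\<close> must cancel against the proportionality constant. Were it 0,
    division by zero would make every mass 0.\<close>
  have "?Z' \<noteq> 0"
  proof
    assume "?Z' = 0"
    then have "pmf (LLT_process k (N + 1) c b t) \<omega> = 0" for \<omega> by (subst R) simp
    then have "set_pmf (LLT_process k (N + 1) c b t) = {}" by (simp add: set_pmf_eq)
    then show False using set_pmf_not_empty by blast
  qed
  then show "pmf (bind_pmf (LLT_process k N c b t) (parallel_update k N c b t)) \<omega>
      = ?Z' / (?Z * ?q) * pmf (LLT_process k (N + 1) c b t) \<omega>"
  proof (cases "\<omega> \<in> configs k (N + 1)")
    case True
    then show ?thesis
      using \<open>?Z' \<noteq> 0\<close> pmf_bind_update_eq[of N c b t "fst \<omega>" "snd \<omega>" k, OF assms(3-5)]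
      unfolding R by simp
  next
    case False
    then have "\<omega> \<notin> set_pmf (bind_pmf (LLT_process k N c b t) (parallel_update k N c b t))"
      using set_pmf_update[of N c b t "fst \<omega>" "snd \<omega>" k, OF assms(3-5)] by auto
    then have "pmf (bind_pmf (LLT_process k N c b t) (parallel_update k N c b t)) \<omega> = 0"
      by (rule pmf_eq_0_set_pmf[THEN iffD2])
    then show ?thesis using False by (simp only: R if_False mult_zero_right)
  qed
qed

end
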